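(* Let $\Bbbk$ be a field and let $A=\bigoplus_{n\ge 0}A_n$ be a locally finite positively graded $\Bbbk$-algebra with $A_0=\bigoplus_{i=1}^r\Bbbk e_i$, where $e_1,\ldots,e_r$ are primitive orthogonal idempotents, and assume that every vertex simple $S_j$ ($1\le j\le r$) is of graded type $\mathrm{FP}_\infty$. Let $C_A(x)$ be the matrix Hilbert series of $A$ and $\widehat{\mathcal E}_A(x)$ its completed Euler matrix. Then $$C_A(x)\,\widehat{\mathcal E}_A(x)=I_r\qquad\text{in } M_r(\mathbb Z[[x]]).$$
   Context: All algebras are associative and unital; $\Bbbk$ is an arbitrary field. Locally finite means $\dim_\Bbbk A_n<\infty$ for all $n$. Put $E=A_0$, $J=A_{>0}=\bigoplus_{n>0}A_n$. Modules are graded left modules. The vertex simples are $S_j=Ae_j/Je_j$. Grading shifts: $M\langle m\rangle_n=M_{n-m}$. A graded module is of (graded) type $\mathrm{FP}_\infty$ if it has a projective resolution by finitely generated graded projectives in every homological degree. Matrix Hilbert series: $C_A(x)\in M_r(\mathbb Z[[x]])$ has entries $C_A(x)_{ij}=\sum_{n\ge0}\dim_\Bbbk(e_iA_ne_j)x^n$. For a graded vector space $W$ with finite-dimensional components, $\mathrm{Hilb}_x(W)=\sum_m\dim_\Bbbk(W_m)x^m$. Completed Euler matrix: for each $j$ choose a minimal graded projective resolution $\cdots\to P_1^{(j)}\to P_0^{(j)}\to S_j\to0$ by finitely generated graded projectives, where minimal means that every differential $P_p^{(j)}\to P_{p-1}^{(j)}$ has image in $JP_{p-1}^{(j)}$.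 Write $P_p^{(j)}\cong\bigoplus_{i=1}^r Ae_i\otimes_\Bbbk W_{p,ij}$ with $W_{p,ij}$ finite-dimensional graded vector spaces (equivalently $W_{p,ij}\cong e_i\operatorname{Tor}_p^A(E,S_j)$). One has $(W_{p,ij})_m=0$ for $m<p$, so the following sum is coefficientwise finite: $$\widehat{\mathcal E}_A(x)_{ij}:=\sum_{p\ge0}(-1)^p\,\mathrm{Hilb}_x(W_{p,ij})\in\mathbb Z[[x]].$$ *)

theory Defs
  imports
    "Jordan_Normal_Form.Missing_VectorSpace"
    "HOL-Algebra.AbelCoset"
    "HOL-Algebra.Generated_Groups"
    "HOL-Analysis.Finite_Cartesian_Product"
    "HOL-Computational_Algebra.Formal_Power_Series"
begin

section \<open>Graded modules over a graded algebra\<close>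

text \<open>
  Rings, vector spaces and modules are records with explicit carriers, as in \<open>HOL-Algebra\<close>.
  The record below adds the family of homogeneous components, indexed by the integers. It is
  used for the algebra itself (scalars in the ground field), for graded vector spaces, and for
  graded left modules (scalars in the algebra). The fields \<open>mult\<close> and \<open>one\<close> inherited from
  \<^typ>\<open>('a, 'm) module\<close> are meaningful only for the algebra.
\<close>

record ('a, 'm) gmodule = "('a, 'm) module" +
  grade :: "int \<Rightarrow> 'm set"

text \<open>The carrier is the internal direct sum of the components.\<close>

definition graded_group :: "('a, 'm) gmodule \<Rightarrow> bool" where
  "graded_group M \<longleftrightarrow>
     (\<forall>n. additive_subgroup (grade M n) M) \<and>
     (\<forall>x\<in>carrier M. \<exists>!f. (\<forall>n. f n \<in> grade M n) \<and> finite {n. f n \<noteq> \<zero>\<^bsub>M\<^esub>} \<and>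
        x = (\<Oplus>\<^bsub>M\<^esub> n\<in>{n. f n \<noteq> \<zero>\<^bsub>M\<^esub>}. f n))"

definition graded_space :: "('k, 'z) ring_scheme \<Rightarrow> ('k, 'v) gmodule \<Rightarrow> bool" where
  "graded_space K V \<longleftrightarrow> vectorspace K V \<and> graded_group V \<and>
     (\<forall>n. \<forall>c\<in>carrier K. \<forall>v\<in>grade V n. c \<odot>\<^bsub>V\<^esub> v \<in> grade V n)"

definition hilb :: "('k, 'z) ring_scheme \<Rightarrow> ('k, 'v) gmodule \<Rightarrow> int fps" where
  \<comment> \<open>Only for graded vector spaces concentrated in non-negative degrees.\<close>
  "hilb K V = Abs_fps (\<lambda>n. int (vectorspace.dim K (V\<lparr>carrier := grade V (int n)\<rparr>)))"

text \<open>The locale \<open>algebra\<close> of \<open>HOL-Algebra\<close> is commutative, hence not applicable here.\<close>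

locale graded_algebra =
  fixes K :: "('k, 'z) ring_scheme" and A :: "('k, 'a) gmodule"
  assumes field: "field K"
    and ring: "ring A"
    and module: "Module.module K A"
    and smult_mult_left:
      "\<lbrakk>c \<in> carrier K; a \<in> carrier A; b \<in> carrier A\<rbrakk> \<Longrightarrow>
        (c \<odot>\<^bsub>A\<^esub> a) \<otimes>\<^bsub>A\<^esub> b = c \<odot>\<^bsub>A\<^esub> (a \<otimes>\<^bsub>A\<^esub> b)"
    and smult_mult_right:
      "\<lbrakk>c \<in> carrier K; a \<in> carrier A; b \<in> carrier A\<rbrakk> \<Longrightarrow>
        a \<otimes>\<^bsub>A\<^esub> (c \<odot>\<^bsub>A\<^esub> b) = c \<odot>\<^bsub>A\<^esub> (a \<otimes>\<^bsub>A\<^esub> b)"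
    and graded_space: "graded_space K A"
    and grade_mult:
      "\<lbrakk>a \<in> grade A m; b \<in> grade A n\<rbrakk> \<Longrightarrow> a \<otimes>\<^bsub>A\<^esub> b \<in> grade A (m + n)"
    and grade_one: "\<one>\<^bsub>A\<^esub> \<in> grade A 0"
    and grade_neg: "n < 0 \<Longrightarrow> grade A n = {\<zero>\<^bsub>A\<^esub>}"
    and locally_finite: "vectorspace.fin_dim K (A\<lparr>carrier := grade A n\<rparr>)"

definition primitive_idempotent :: "('a, 'z) ring_scheme \<Rightarrow> 'a \<Rightarrow> bool" where
  "primitive_idempotent R e \<longleftrightarrow> e \<in> carrier R \<and> e \<otimes>\<^bsub>R\<^esub> e = e \<and> e \<noteq> \<zero>\<^bsub>R\<^esub> \<and>
     (\<forall>f\<in>carrier R. \<forall>g\<in>carrier R.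
        f \<otimes>\<^bsub>R\<^esub> f = f \<and> g \<otimes>\<^bsub>R\<^esub> g = g \<and> f \<otimes>\<^bsub>R\<^esub> g = \<zero>\<^bsub>R\<^esub> \<and> g \<otimes>\<^bsub>R\<^esub> f = \<zero>\<^bsub>R\<^esub> \<and> e = f \<oplus>\<^bsub>R\<^esub> g
        \<longrightarrow> f = \<zero>\<^bsub>R\<^esub> \<or> g = \<zero>\<^bsub>R\<^esub>)"

text \<open>The vertices are indexed by a finite type, so that the number of vertices is \<open>CARD('r)\<close>.\<close>

locale vertex_graded_algebra = graded_algebra K A
  for K :: "('k, 'z) ring_scheme" and A :: "('k, 'a) gmodule" +
  fixes e :: "'r::finite \<Rightarrow> 'a"
  assumes primitive: "primitive_idempotent A (e i)"
    and orthogonal: "i \<noteq> j \<Longrightarrow> e i \<otimes>\<^bsub>A\<^esub> e j = \<zero>\<^bsub>A\<^esub>"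
    and vertex_in_grade_0: "e i \<in> grade A 0"
    and grade_0_direct_sum:
      "x \<in> grade A 0 \<Longrightarrow>
        \<exists>!c. (\<forall>i. c i \<in> carrier K) \<and> x = (\<Oplus>\<^bsub>A\<^esub> i\<in>UNIV. c i \<odot>\<^bsub>A\<^esub> e i)"

text \<open>The locale \<open>module\<close> of \<open>HOL-Algebra\<close> requires a commutative ring of scalars.\<close>

locale left_module =
  fixes R :: "('a, 'z) ring_scheme" and M :: "('a, 'm, 'y) module_scheme"
  assumes ring: "ring R"
    and abelian_group: "abelian_group M"
    and smult_closed:
      "\<lbrakk>a \<in> carrier R; x \<in> carrier M\<rbrakk> \<Longrightarrow> a \<odot>\<^bsub>M\<^esub> x \<in> carrier M"
    and smult_l_distr:
      "\<lbrakk>a \<in> carrier R; b \<in> carrier R; x \<in> carrier M\<rbrakk> \<Longrightarrow>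
        (a \<oplus>\<^bsub>R\<^esub> b) \<odot>\<^bsub>M\<^esub> x = a \<odot>\<^bsub>M\<^esub> x \<oplus>\<^bsub>M\<^esub> b \<odot>\<^bsub>M\<^esub> x"
    and smult_r_distr:
      "\<lbrakk>a \<in> carrier R; x \<in> carrier M; y \<in> carrier M\<rbrakk> \<Longrightarrow>
        a \<odot>\<^bsub>M\<^esub> (x \<oplus>\<^bsub>M\<^esub> y) = a \<odot>\<^bsub>M\<^esub> x \<oplus>\<^bsub>M\<^esub> a \<odot>\<^bsub>M\<^esub> y"
    and smult_assoc:
      "\<lbrakk>a \<in> carrier R; b \<in> carrier R; x \<in> carrier M\<rbrakk> \<Longrightarrow>
        (a \<otimes>\<^bsub>R\<^esub> b) \<odot>\<^bsub>M\<^esub> x = a \<odot>\<^bsub>M\<^esub> (b \<odot>\<^bsub>M\<^esub> x)"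
    and smult_one: "x \<in> carrier M \<Longrightarrow> \<one>\<^bsub>R\<^esub> \<odot>\<^bsub>M\<^esub> x = x"

definition graded_left_module :: "('k, 'a) gmodule \<Rightarrow> ('a, 'm) gmodule \<Rightarrow> bool" where
  "graded_left_module A M \<longleftrightarrow> left_module A M \<and> graded_group M \<and>
     (\<forall>m n. \<forall>a\<in>grade A m. \<forall>x\<in>grade M n. a \<odot>\<^bsub>M\<^esub> x \<in> grade M (m + n))"

definition gmodule_hom ::
  "('k, 'a) gmodule \<Rightarrow> ('a, 'm) gmodule \<Rightarrow> ('a, 'n) gmodule \<Rightarrow> ('m \<Rightarrow> 'n) set" where
  "gmodule_hom A M N = {f \<in> LinearCombinations.module_hom A M N. \<forall>n. f ` grade M n \<subseteq> grade N n}"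

definition gmodule_isomorphic ::
  "('k, 'a) gmodule \<Rightarrow> ('a, 'm) gmodule \<Rightarrow> ('a, 'n) gmodule \<Rightarrow> bool" where
  "gmodule_isomorphic A M N \<longleftrightarrow>
     (\<exists>f\<in>gmodule_hom A M N. bij_betw f (carrier M) (carrier N))"

definition shift :: "('a, 'm) gmodule \<Rightarrow> int \<Rightarrow> ('a, 'm) gmodule" where
  "shift M d = M\<lparr>grade := (\<lambda>n. grade M (n - d))\<rparr>"

definition direct_sum :: "'i set \<Rightarrow> ('i \<Rightarrow> ('a, 'm) gmodule) \<Rightarrow> ('a, 'i \<Rightarrow> 'm) gmodule" where
  "direct_sum I M =
    (let C = {f \<in> (\<Pi>\<^sub>E i\<in>I. carrier (M i)). finite {i\<in>I. f i \<noteq> \<zero>\<^bsub>M i\<^esub>}} in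
    \<lparr>carrier = C, monoid.mult = undefined, one = undefined,
     zero = (\<lambda>i\<in>I. \<zero>\<^bsub>M i\<^esub>),
     add = (\<lambda>f g. \<lambda>i\<in>I. f i \<oplus>\<^bsub>M i\<^esub> g i),
     smult = (\<lambda>a f. \<lambda>i\<in>I. a \<odot>\<^bsub>M i\<^esub> f i),
     grade = (\<lambda>n. {f \<in> C. \<forall>i\<in>I. f i \<in> grade (M i) n})\<rparr>)"

definition quotient_module :: "('a, 'm) gmodule \<Rightarrow> 'm set \<Rightarrow> ('a, 'm set) gmodule" where
  "quotient_module M N =
    \<lparr>carrier = a_rcosets\<^bsub>M\<^esub> N, monoid.mult = undefined, one = undefined,
     zero = N,
     add = set_add M,
     smult = (\<lambda>a X. \<Union>x\<in>X. N +>\<^bsub>M\<^esub> (a \<odot>\<^bsub>M\<^esub> x)),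
     grade = (\<lambda>n. (\<lambda>x. N +>\<^bsub>M\<^esub> x) ` grade M n)\<rparr>"

text \<open>A homogeneous left ideal \<open>X\<close> of \<open>A\<close>, viewed as a graded left module.\<close>

definition left_ideal_module :: "('k, 'a) gmodule \<Rightarrow> 'a set \<Rightarrow> ('a, 'a) gmodule" where
  "left_ideal_module A X =
    \<lparr>carrier = X, monoid.mult = undefined, one = undefined,
     zero = \<zero>\<^bsub>A\<^esub>, add = add A, smult = monoid.mult A, grade = (\<lambda>n. grade A n \<inter> X)\<rparr>"

definition finitely_generated :: "('k, 'a) gmodule \<Rightarrow> ('a, 'm) gmodule \<Rightarrow> bool" where
  "finitely_generated A M \<longleftrightarrow> (\<exists>S. finite S \<and> S \<subseteq> carrier M \<and>
     carrier M = generate (add_monoid M) {a \<odot>\<^bsub>M\<^esub> s | a s. a \<in> carrier A \<and> s \<in> S})"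

text \<open>
  A graded module is projective iff it is a direct summand of a graded free module, i.e. of a
  direct sum of shifts of \<open>A\<close>. A graded module on the type \<open>'m\<close> is generated by its nonzero
  homogeneous elements, so it suffices to consider free modules on index sets in \<open>'m\<close>.
\<close>

definition graded_projective :: "('k, 'a) gmodule \<Rightarrow> ('a, 'm) gmodule \<Rightarrow> bool" where
  "graded_projective A P \<longleftrightarrow> (\<exists>(I :: 'm set) d.
     let F = direct_sum I (\<lambda>b. shift (left_ideal_module A (carrier A)) (d b)) in
     \<exists>f\<in>gmodule_hom A P F. \<exists>g\<in>gmodule_hom A F P. \<forall>x\<in>carrier P. g (f x) = x)"

section \<open>Vertex simples, resolutions and type \<open>FP\<^sub>\<infinity>\<close>\<close>

definition positive_part :: "('k, 'a) gmodule \<Rightarrow> 'a set" where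
  "positive_part A = generate (add_monoid A) (\<Union>n\<in>{0<..}. grade A n)"

definition positive_part_mult :: "('k, 'a) gmodule \<Rightarrow> ('a, 'm) gmodule \<Rightarrow> 'm set" where
  "positive_part_mult A M =
     generate (add_monoid M) {a \<odot>\<^bsub>M\<^esub> x | a x. a \<in> positive_part A \<and> x \<in> carrier M}"

definition vertex_projective :: "('k, 'a) gmodule \<Rightarrow> ('r \<Rightarrow> 'a) \<Rightarrow> 'r \<Rightarrow> ('a, 'a) gmodule" where
  "vertex_projective A e j = left_ideal_module A {a \<otimes>\<^bsub>A\<^esub> e j | a. a \<in> carrier A}"

definition vertex_simple :: "('k, 'a) gmodule \<Rightarrow> ('r \<Rightarrow> 'a) \<Rightarrow> 'r \<Rightarrow> ('a, 'a set) gmodule" where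
  "vertex_simple A e j =
     quotient_module (vertex_projective A e j) {a \<otimes>\<^bsub>A\<^esub> e j | a. a \<in> positive_part A}"

text \<open>The differential \<open>d p\<close> goes from \<open>P (Suc p)\<close> to \<open>P p\<close>, and \<open>\<epsilon>\<close> is the augmentation.\<close>

definition fg_projective_resolution ::
  "('k, 'a) gmodule \<Rightarrow> ('a, 's) gmodule \<Rightarrow>
   (nat \<Rightarrow> ('a, 'm) gmodule) \<Rightarrow> (nat \<Rightarrow> 'm \<Rightarrow> 'm) \<Rightarrow> ('m \<Rightarrow> 's) \<Rightarrow> bool" where
  "fg_projective_resolution A S P d \<epsilon> \<longleftrightarrow>
     (\<forall>p. graded_left_module A (P p) \<and> graded_projective A (P p) \<and> finitely_generated A (P p)) \<and>
     (\<forall>p. d p \<in> gmodule_hom A (P (Suc p)) (P p)) \<and>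
     \<epsilon> \<in> gmodule_hom A (P 0) S \<and>
     \<epsilon> ` carrier (P 0) = carrier S \<and>
     d 0 ` carrier (P (Suc 0)) = {x \<in> carrier (P 0). \<epsilon> x = \<zero>\<^bsub>S\<^esub>} \<and>
     (\<forall>p. d (Suc p) ` carrier (P (Suc (Suc p))) =
        {x \<in> carrier (P (Suc p)). d p x = \<zero>\<^bsub>P p\<^esub>})"

text \<open>
  A finitely generated graded projective is a direct summand of some \<open>A \<oplus> \<dots> \<oplus> A\<close> (with shifts),
  hence isomorphic to a graded module with carrier in \<^typ>\<open>nat \<Rightarrow> 'a\<close>. Fixing this type for the
  terms of a resolution is thus no restriction.
\<close>

definition FP_infinity :: "('k, 'a) gmodule \<Rightarrow> ('a, 's) gmodule \<Rightarrow> bool" where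
  "FP_infinity A S \<longleftrightarrow>
     (\<exists>(P :: nat \<Rightarrow> ('a, nat \<Rightarrow> 'a) gmodule) d \<epsilon>. fg_projective_resolution A S P d \<epsilon>)"

definition minimal_fg_resolution ::
  "('k, 'a) gmodule \<Rightarrow> ('a, 's) gmodule \<Rightarrow>
   (nat \<Rightarrow> ('a, 'm) gmodule) \<Rightarrow> (nat \<Rightarrow> 'm \<Rightarrow> 'm) \<Rightarrow> ('m \<Rightarrow> 's) \<Rightarrow> bool" where
  "minimal_fg_resolution A S P d \<epsilon> \<longleftrightarrow> fg_projective_resolution A S P d \<epsilon> \<and>
     (\<forall>p. d p ` carrier (P (Suc p)) \<subseteq> positive_part_mult A (P p))"

section \<open>Tensor products over the ground field\<close>

text \<open>
  Elements of \<open>V \<otimes>\<^sub>K W\<close> are classes of finite formal sums of pure tensors, represented by multisets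
  of pairs, modulo the congruence generated by \<open>K\<close>-bilinearity. Formal negatives are not needed,
  since \<open>(\<ominus>v) \<otimes> w\<close> is a negative of \<open>v \<otimes> w\<close>. Here \<open>V\<close> is a left \<open>A\<close>-module, on which \<open>K\<close> acts through
  \<open>K \<rightarrow> A\<close>, \<open>c \<mapsto> c \<cdot> 1\<close>, and \<open>W\<close> is a \<open>K\<close>-vector space.
\<close>

inductive tensor_eq ::
  "('k, 'z) ring_scheme \<Rightarrow> ('k, 'a) gmodule \<Rightarrow> ('a, 'v) gmodule \<Rightarrow> ('k, 'w) gmodule \<Rightarrow>
   ('v \<times> 'w) multiset \<Rightarrow> ('v \<times> 'w) multiset \<Rightarrow> bool"
  for K :: "('k, 'z) ring_scheme" and A :: "('k, 'a) gmodule"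
    and V :: "('a, 'v) gmodule" and W :: "('k, 'w) gmodule" where
  refl: "set_mset X \<subseteq> carrier V \<times> carrier W \<Longrightarrow> tensor_eq K A V W X X"
| sym: "tensor_eq K A V W X Y \<Longrightarrow> tensor_eq K A V W Y X"
| trans: "\<lbrakk>tensor_eq K A V W X Y; tensor_eq K A V W Y Z\<rbrakk> \<Longrightarrow> tensor_eq K A V W X Z"
| plus: "\<lbrakk>tensor_eq K A V W X X'; tensor_eq K A V W Y Y'\<rbrakk> \<Longrightarrow>
    tensor_eq K A V W (X + Y) (X' + Y')"
| zero: "w \<in> carrier W \<Longrightarrow> tensor_eq K A V W {#(\<zero>\<^bsub>V\<^esub>, w)#} {#}"
| left: "\<lbrakk>v \<in> carrier V; v' \<in> carrier V; w \<in> carrier W\<rbrakk> \<Longrightarrow>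
    tensor_eq K A V W {#(v \<oplus>\<^bsub>V\<^esub> v', w)#} {#(v, w), (v', w)#}"
| right: "\<lbrakk>v \<in> carrier V; w \<in> carrier W; w' \<in> carrier W\<rbrakk> \<Longrightarrow>
    tensor_eq K A V W {#(v, w \<oplus>\<^bsub>W\<^esub> w')#} {#(v, w), (v, w')#}"
| balanced: "\<lbrakk>c \<in> carrier K; v \<in> carrier V; w \<in> carrier W\<rbrakk> \<Longrightarrow>
    tensor_eq K A V W {#((c \<odot>\<^bsub>A\<^esub> \<one>\<^bsub>A\<^esub>) \<odot>\<^bsub>V\<^esub> v, w)#} {#(v, c \<odot>\<^bsub>W\<^esub> w)#}"

definition tensor ::
  "('k, 'z) ring_scheme \<Rightarrow> ('k, 'a) gmodule \<Rightarrow> ('a, 'v) gmodule \<Rightarrow> ('k, 'w) gmodule \<Rightarrow>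
   ('a, ('v \<times> 'w) multiset set) gmodule" where
  "tensor K A V W =
    (let cls = (\<lambda>X. {Y. tensor_eq K A V W X Y}) in
    \<lparr>carrier = {cls X | X. set_mset X \<subseteq> carrier V \<times> carrier W},
     monoid.mult = undefined, one = undefined,
     zero = cls {#},
     add = (\<lambda>S T. \<Union>X\<in>S. \<Union>Y\<in>T. cls (X + Y)),
     smult = (\<lambda>a S. \<Union>X\<in>S. cls (image_mset (\<lambda>(v, w). (a \<odot>\<^bsub>V\<^esub> v, w)) X)),
     grade = (\<lambda>n. {cls X | X. \<forall>(v, w)\<in>set_mset X. \<exists>m. v \<in> grade V (n - m) \<and> w \<in> grade W m})\<rparr>)"

section \<open>Matrix Hilbert series and completed Euler matrix\<close>

definition matrix_hilbert_series ::
  "('k, 'z) ring_scheme \<Rightarrow> ('k, 'a) gmodule \<Rightarrow> ('r \<Rightarrow> 'a) \<Rightarrow> int fps ^ 'r ^ 'r" where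
  "matrix_hilbert_series K A e = (\<chi> i j. Abs_fps (\<lambda>n. int (vectorspace.dim K
     (A\<lparr>carrier := {e i \<otimes>\<^bsub>A\<^esub> a \<otimes>\<^bsub>A\<^esub> e j | a. a \<in> grade A (int n)}\<rparr>))))"

text \<open>
  The spaces \<open>W p i\<close> are multiplicity spaces of a minimal resolution \<open>P\<close> of the vertex simple at
  \<open>j\<close>, i.e. \<open>P p \<cong> \<Oplus>\<^sub>i A e\<^sub>i \<otimes>\<^sub>K W p i\<close>. Every finite-dimensional graded vector space
  is isomorphic to one with carrier in \<^typ>\<open>nat \<Rightarrow> 'k\<close>.
\<close>

definition is_multiplicity ::
  "('k, 'z) ring_scheme \<Rightarrow> ('k, 'a) gmodule \<Rightarrow> ('r::finite \<Rightarrow> 'a) \<Rightarrow> 'r \<Rightarrow>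
   (nat \<Rightarrow> 'r \<Rightarrow> ('k, nat \<Rightarrow> 'k) gmodule) \<Rightarrow> bool" where
  "is_multiplicity K A e j W \<longleftrightarrow>
     (\<exists>(P :: nat \<Rightarrow> ('a, nat \<Rightarrow> 'a) gmodule) d \<epsilon>.
        minimal_fg_resolution A (vertex_simple A e j) P d \<epsilon> \<and>
        (\<forall>p. (\<forall>i. graded_space K (W p i) \<and> vectorspace.fin_dim K (W p i)) \<and>
             gmodule_isomorphic A (P p)
               (direct_sum UNIV (\<lambda>i. tensor K A (vertex_projective A e i) (W p i)))))"

definition multiplicity ::
  "('k, 'z) ring_scheme \<Rightarrow> ('k, 'a) gmodule \<Rightarrow> ('r::finite \<Rightarrow> 'a) \<Rightarrow> 'r \<Rightarrow>
   nat \<Rightarrow> 'r \<Rightarrow> ('k, nat \<Rightarrow> 'k) gmodule" where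
  "multiplicity K A e j = (SOME W. is_multiplicity K A e j W)"

text \<open>
  The infinite sum is taken in the topology of \<^typ>\<open>int fps\<close>, in which a series converges iff
  each coefficient of its partial sums is eventually constant.
\<close>

definition completed_euler_matrix ::
  "('k, 'z) ring_scheme \<Rightarrow> ('k, 'a) gmodule \<Rightarrow> ('r::finite \<Rightarrow> 'a) \<Rightarrow> int fps ^ 'r ^ 'r" where
  "completed_euler_matrix K A e =
     (\<chi> i j. \<Sum>p. (-1) ^ p * hilb K (multiplicity K A e j p i))"

end

theory Submission
  imports Defs
begin

text \<open>
  Fix a vertex \<open>j\<close> and a minimal resolution \<open>P\<^sub>*\<close> of the vertex simple \<open>S\<^sub>j\<close>, with
  \<open>P\<^sub>p \<cong> \<Oplus>\<^sub>k A e\<^sub>k \<otimes> W\<^sub>p\<^sub>k\<close>. In degree \<open>n\<close>, the idempotent \<open>e\<^sub>i\<close> cuts out of \<open>P\<^sub>p\<close> a vector space of dimension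
  \<open>\<Sum>\<^sub>k \<Sum>\<^sub>m dim (e\<^sub>i A\<^sub>n\<^sub>-\<^sub>m e\<^sub>k) dim (W\<^sub>p\<^sub>k)\<^sub>m\<close>, which is the coefficient of \<open>x\<^sup>n\<close> in \<open>\<Sum>\<^sub>k C\<^sub>i\<^sub>k Hilb(W\<^sub>p\<^sub>k)\<close>. These
  spaces form an exact complex that ends in \<open>e\<^sub>i (S\<^sub>j)\<^sub>n\<close>, so the alternating sum of their dimensions over
  \<open>p\<close> is the dimension of \<open>e\<^sub>i (S\<^sub>j)\<^sub>n\<close>, namely one if \<open>i = j\<close> and \<open>n = 0\<close>, and zero otherwise. This is the
  entry of the identity matrix. The sum is finite, since by minimality \<open>P\<^sub>p\<close> lives in degrees at
  least \<open>p\<close>: a generator of smaller degree would be a cycle, hence a boundary, but boundaries lie in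
  \<open>J P\<^sub>p\<close>. The lemmas \<open>degree_bound\<close> and \<open>euler_characteristic\<close> carry this argument.

  Two things have to be provided before it applies. The first is that a minimal resolution by
  finitely generated projectives exists (\<open>minimal_resolution_exists\<close>). Covers with the least number
  of generators are minimal (\<open>minimal_cover\<close>), so the point is that the syzygies of a minimal
  resolution inherit finite generation from those of an arbitrary resolution by finitely generated
  projectives. The two resolutions are compared by maps \<open>\<phi>\<close> and \<open>\<psi>\<close>, constructed one step at a time. On
  a minimal syzygy \<open>Z\<close> the composite \<open>\<psi> \<phi>\<close> differs from the identity by the restriction of a map \<open>t\<close>
  with values in \<open>Z\<close>, defined on the whole projective \<open>Q\<close> that contains \<open>Z\<close>; since \<open>Z \<subseteq> J Q\<close>, this
  difference lies in \<open>J Z\<close>. Hence the image of \<open>\<psi>\<close> generates \<open>Z\<close> modulo \<open>J Z\<close>, and by the graded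
  Nakayama lemma it is all of \<open>Z\<close> (\<open>syzygy_image\<close>).

  The second is the passage between \<open>\<Oplus>\<^sub>k A e\<^sub>k \<otimes> W\<^sub>k\<close> and a sum of shifted copies of the modules \<open>A e\<^sub>k\<close>,
  one for each element of homogeneous bases of the spaces \<open>W\<^sub>k\<close> (\<open>tensor_sum_isomorphism\<close>). Such bases
  are minimal covers again, over the ground field regarded as a graded algebra (\<open>homogeneous_basis\<close>).
\<close>


section \<open>Graded abelian groups\<close>

definition additive_map :: "('a, 'm, 'y) module_scheme \<Rightarrow> ('b, 'n, 'z) module_scheme \<Rightarrow> ('m \<Rightarrow> 'n) \<Rightarrow> bool" where
  "additive_map M N f \<longleftrightarrow> f \<in> carrier M \<rightarrow> carrier N \<and>
     (\<forall>x\<in>carrier M. \<forall>y\<in>carrier M. f (x \<oplus>\<^bsub>M\<^esub> y) = f x \<oplus>\<^bsub>N\<^esub> f y)"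

lemma additive_mapD:
  assumes "additive_map M N f"
  shows additive_map_closed: "x \<in> carrier M \<Longrightarrow> f x \<in> carrier N"
    and additive_map_add: "\<lbrakk>x \<in> carrier M; y \<in> carrier M\<rbrakk> \<Longrightarrow> f (x \<oplus>\<^bsub>M\<^esub> y) = f x \<oplus>\<^bsub>N\<^esub> f y"
  using assms by (auto simp: additive_map_def)

lemma additive_map_zero:
  assumes f: "additive_map M N f" and "abelian_group M" "abelian_group N"
  shows "f \<zero>\<^bsub>M\<^esub> = \<zero>\<^bsub>N\<^esub>"
proof -
  interpret M: abelian_group M by fact
  interpret N: abelian_group N by fact
  have c: "f \<zero>\<^bsub>M\<^esub> \<in> carrier N" using additive_map_closed[OF f] by simp
  have "f \<zero>\<^bsub>M\<^esub> \<oplus>\<^bsub>N\<^esub> f \<zero>\<^bsub>M\<^esub> = f \<zero>\<^bsub>M\<^esub>"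
    using additive_map_add[OF f, of "\<zero>\<^bsub>M\<^esub>" "\<zero>\<^bsub>M\<^esub>"] by simp
  with c show ?thesis by (metis N.add.l_cancel_one')
qed

lemma additive_map_uminus:
  assumes f: "additive_map M N f" and M: "abelian_group M" and N: "abelian_group N"
    and x: "x \<in> carrier M"
  shows "f (\<ominus>\<^bsub>M\<^esub> x) = \<ominus>\<^bsub>N\<^esub> f x"
proof -
  interpret M: abelian_group M by fact
  interpret N: abelian_group N by fact
  have "f x \<oplus>\<^bsub>N\<^esub> f (\<ominus>\<^bsub>M\<^esub> x) = \<zero>\<^bsub>N\<^esub>"
    using additive_map_add[OF f, of x "\<ominus>\<^bsub>M\<^esub> x"] x additive_map_zero[OF f M N]
    by (simp add: M.r_neg)
  then show ?thesis using additive_map_closed[OF f] x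
    by (metis M.add.inv_closed N.minus_equality N.add.m_comm)
qed

lemma additive_map_finsum:
  assumes f: "additive_map M N f" and M: "abelian_group M" and N: "abelian_group N"
    and g: "g \<in> I \<rightarrow> carrier M" and fin: "finite I"
  shows "f (finsum M g I) = finsum N (\<lambda>i. f (g i)) I"
  using fin g
proof (induction I)
  case empty
  interpret M: abelian_group M by fact
  interpret N: abelian_group N by fact
  show ?case using additive_map_zero[OF f M N] by simp
next
  case (insert i I)
  interpret M: abelian_group M by fact
  interpret N: abelian_group N by fact
  have *: "(\<lambda>i. f (g i)) \<in> insert i I \<rightarrow> carrier N"
    using insert.prems additive_map_closed[OF f] by auto
  have "f (finsum M g (insert i I)) = f (g i \<oplus>\<^bsub>M\<^esub> finsum M g I)"
    using insert by (subst M.finsum_insert) auto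
  also have "\<dots> = f (g i) \<oplus>\<^bsub>N\<^esub> finsum N (\<lambda>i. f (g i)) I"
    using insert by (subst additive_map_add[OF f]) auto
  finally show ?case
    using insert * by (subst N.finsum_insert) auto
qed

lemma (in abelian_group) finsum_single:
  assumes "finite T" "m \<in> T" "f m \<in> carrier G" "\<And>n. n \<in> T \<Longrightarrow> n \<noteq> m \<Longrightarrow> f n = \<zero>"
  shows "finsum G f T = f m"
proof -
  have "f \<in> T \<rightarrow> carrier G"
    using assms(3,4) by (metis Pi_I zero_closed)
  then have "finsum G f T = finsum G f {m}"
    using assms by (intro add.finprod_mono_neutral_cong_right) auto
  then show ?thesis using assms by simp
qed

lemma (in abelian_group) finsum_support:
  assumes "finite T" "\<And>n. n \<notin> T \<Longrightarrow> f n = \<zero>" "\<And>n. f n \<in> carrier G"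
  shows "finsum G f {n. f n \<noteq> \<zero>} = finsum G f T"
  by (rule add.finprod_mono_neutral_cong_left) (use assms in auto)

locale graded_grp = abelian_group M for M :: "('a, 'm) gmodule" (structure) +
  assumes graded: "graded_group M"

text \<open>
  The homogeneous component of degree \<^term>\<open>n\<close>, read off from the unique decomposition that
  \<^const>\<open>graded_group\<close> provides.
\<close>

definition hcomp :: "('a, 'm) gmodule \<Rightarrow> int \<Rightarrow> 'm \<Rightarrow> 'm" where
  "hcomp M n x = (THE f. (\<forall>n. f n \<in> grade M n) \<and> finite {n. f n \<noteq> \<zero>\<^bsub>M\<^esub>} \<and>
     x = (\<Oplus>\<^bsub>M\<^esub>n\<in>{n. f n \<noteq> \<zero>\<^bsub>M\<^esub>}. f n)) n"

context graded_grp
begin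

lemma grade_subgroup: "additive_subgroup (grade M n) M"
  using graded by (simp add: graded_group_def)

lemma grade_closed: "x \<in> grade M n \<Longrightarrow> x \<in> carrier M"
  using additive_subgroup.a_Hcarr[OF grade_subgroup] .

lemma grade_zero [simp]: "\<zero> \<in> grade M n"
  using additive_subgroup.zero_closed[OF grade_subgroup] .

lemma grade_add: "\<lbrakk>x \<in> grade M n; y \<in> grade M n\<rbrakk> \<Longrightarrow> x \<oplus> y \<in> grade M n"
  using additive_subgroup.a_closed[OF grade_subgroup] .

lemma grade_uminus: "x \<in> grade M n \<Longrightarrow> \<ominus> x \<in> grade M n"
  using additive_subgroup.a_inv_closed[OF grade_subgroup] .

lemma hcomp_spec:
  assumes "x \<in> carrier M"
  shows "(\<forall>n. hcomp M n x \<in> grade M n) \<and> finite {n. hcomp M n x \<noteq> \<zero>} \<and>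
     x = (\<Oplus>n\<in>{n. hcomp M n x \<noteq> \<zero>}. hcomp M n x)"
proof -
  have "\<exists>!f. (\<forall>n. f n \<in> grade M n) \<and> finite {n. f n \<noteq> \<zero>} \<and> x = (\<Oplus>n\<in>{n. f n \<noteq> \<zero>}. f n)"
    using graded assms by (simp add: graded_group_def)
  from theI'[OF this] show ?thesis unfolding hcomp_def .
qed

lemma hcomp_grade: "x \<in> carrier M \<Longrightarrow> hcomp M n x \<in> grade M n"
  and hcomp_finite: "x \<in> carrier M \<Longrightarrow> finite {n. hcomp M n x \<noteq> \<zero>}"
  and hcomp_sum: "x \<in> carrier M \<Longrightarrow> x = (\<Oplus>n\<in>{n. hcomp M n x \<noteq> \<zero>}. hcomp M n x)"
  using hcomp_spec by blast+

lemma hcomp_closed [simp]: "x \<in> carrier M \<Longrightarrow> hcomp M n x \<in> carrier M"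
  using hcomp_grade grade_closed by blast

lemma hcomp_unique:
  assumes T: "finite T" "\<And>n. n \<notin> T \<Longrightarrow> f n = \<zero>" and f: "\<And>n. f n \<in> grade M n"
    and x: "x = (\<Oplus>n\<in>T. f n)"
  shows "hcomp M n x = f n"
proof -
  have fc: "f n \<in> carrier M" for n using f grade_closed by blast
  then have xc: "x \<in> carrier M" unfolding x by (intro finsum_closed) auto
  have ex: "\<exists>!f. (\<forall>n. f n \<in> grade M n) \<and> finite {n. f n \<noteq> \<zero>} \<and> x = (\<Oplus>n\<in>{n. f n \<noteq> \<zero>}. f n)"
    using graded xc by (simp add: graded_group_def)
  have "{n. f n \<noteq> \<zero>} \<subseteq> T" using T by auto
  then have "finite {n. f n \<noteq> \<zero>}" using T finite_subset by auto
  then have "(\<forall>n. f n \<in> grade M n) \<and> finite {n. f n \<noteq> \<zero>} \<and> x = (\<Oplus>n\<in>{n. f n \<noteq> \<zero>}. f n)"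
    using f x finsum_support[OF T fc] by simp
  then have "(THE f. (\<forall>n. f n \<in> grade M n) \<and> finite {n. f n \<noteq> \<zero>} \<and>
      x = (\<Oplus>n\<in>{n. f n \<noteq> \<zero>}. f n)) = f"
    by (intro the1_equality[OF ex]) auto
  then show ?thesis by (simp add: hcomp_def)
qed

lemma hcomp_sum_over:
  assumes "x \<in> carrier M" "finite T" "\<And>n. n \<notin> T \<Longrightarrow> hcomp M n x = \<zero>"
  shows "x = (\<Oplus>n\<in>T. hcomp M n x)"
  using hcomp_sum[OF assms(1)] finsum_support[OF assms(2,3)] assms(1) by simp

lemma hcomp_homogeneous:
  assumes "x \<in> grade M m"
  shows "hcomp M n x = (if n = m then x else \<zero>)"
  by (rule hcomp_unique[of "{m}" "\<lambda>n. if n = m then x else \<zero>"])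
    (use assms grade_closed in auto)

lemma hcomp_zero [simp]: "hcomp M n \<zero> = \<zero>"
  using hcomp_homogeneous[of \<zero> n n] by simp

lemma hcomp_idem [simp]:
  "x \<in> carrier M \<Longrightarrow> hcomp M n (hcomp M m x) = (if n = m then hcomp M m x else \<zero>)"
  by (simp add: hcomp_homogeneous[OF hcomp_grade])

lemma additive_map_graded_finsum:
  assumes f: "additive_map M N f" and N: "abelian_group N" and x: "x \<in> carrier M"
    and T: "finite T" "\<And>n. n \<notin> T \<Longrightarrow> hcomp M n x = \<zero>"
  shows "f x = (\<Oplus>\<^bsub>N\<^esub>n\<in>T. f (hcomp M n x))"
proof -
  have "f x = f (\<Oplus>n\<in>T. hcomp M n x)" using hcomp_sum_over[OF x T] by simp
  also have "\<dots> = (\<Oplus>\<^bsub>N\<^esub>n\<in>T. f (hcomp M n x))"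
    by (rule additive_map_finsum[OF f abelian_group_axioms N _ T(1)]) (use x in auto)
  finally show ?thesis .
qed

lemma homogeneous_induct [consumes 1, case_names homogeneous add]:
  assumes x: "x \<in> carrier M"
    and h: "\<And>n y. y \<in> grade M n \<Longrightarrow> P y"
    and a: "\<And>y z. \<lbrakk>y \<in> carrier M; z \<in> carrier M; P y; P z\<rbrakk> \<Longrightarrow> P (y \<oplus> z)"
  shows "P x"
proof -
  have "finite T \<Longrightarrow> P (\<Oplus>n\<in>T. hcomp M n x)" for T
  proof (induction T rule: finite_induct)
    case empty
    then show ?case using h[OF grade_zero] by simp
  next
    case (insert n T)
    have "P (hcomp M n x \<oplus> (\<Oplus>n\<in>T. hcomp M n x))"
      using insert h[OF hcomp_grade[OF x]] x by (intro a) auto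
    then show ?case using insert x by (subst finsum_insert) auto
  qed
  from this[OF hcomp_finite[OF x]] show ?thesis using hcomp_sum[OF x] by simp
qed

end

text \<open>
  An additive map of degree \<^term>\<open>k\<close> commutes with taking components, since the images of the
  components of \<^term>\<open>x\<close> form a decomposition of the image of \<^term>\<open>x\<close>.
\<close>

lemma hcomp_additive_map:
  assumes M: "graded_grp M" and N: "graded_grp N" and f: "additive_map M N f"
    and deg: "\<And>n. f ` grade M n \<subseteq> grade N (n + k)"
    and x: "x \<in> carrier M"
  shows "hcomp N (n + k) (f x) = f (hcomp M n x)"
proof -
  interpret M: graded_grp M by fact
  interpret N: graded_grp N by fact
  let ?T = "{n. hcomp M n x \<noteq> \<zero>\<^bsub>M\<^esub>}"
  have 0: "f \<zero>\<^bsub>M\<^esub> = \<zero>\<^bsub>N\<^esub>"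
    using additive_map_zero[OF f M.abelian_group_axioms N.abelian_group_axioms] .
  have fT: "finite ?T" using M.hcomp_finite[OF x] .
  have fc: "f (hcomp M n x) \<in> carrier N" for n
    using additive_map_closed[OF f] x by simp
  have "f x = (\<Oplus>\<^bsub>N\<^esub>n\<in>?T. f (hcomp M n x))"
    by (rule M.additive_map_graded_finsum[OF f N.abelian_group_axioms x fT]) auto
  also have "\<dots> = (\<Oplus>\<^bsub>N\<^esub>n\<in>(\<lambda>n. n + k) ` ?T. f (hcomp M (n - k) x))"
    by (subst N.add.finprod_reindex) (use fc in \<open>auto simp: inj_on_def\<close>)
  finally have *: "f x = (\<Oplus>\<^bsub>N\<^esub>n\<in>(\<lambda>n. n + k) ` ?T. f (hcomp M (n - k) x))" .
  have "hcomp N (n + k) (f x) = f (hcomp M (n + k - k) x)"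
  proof (rule N.hcomp_unique[OF _ _ _ *])
    show "finite ((\<lambda>n. n + k) ` ?T)" using fT by simp
    show "f (hcomp M (n - k) x) = \<zero>\<^bsub>N\<^esub>" if "n \<notin> (\<lambda>n. n + k) ` ?T" for n
    proof -
      have "n - k \<notin> ?T" using that by (metis diff_add_cancel imageI)
      then show ?thesis using 0 by simp
    qed
    show "f (hcomp M (n - k) x) \<in> grade N n" for n
      using deg[of "n - k"] M.hcomp_grade[OF x] by auto
  qed
  then show ?thesis by simp
qed

lemma (in graded_grp) hcomp_add:
  assumes x: "x \<in> carrier M" and y: "y \<in> carrier M"
  shows "hcomp M n (x \<oplus> y) = hcomp M n x \<oplus> hcomp M n y"
proof -
  let ?T = "{n. hcomp M n x \<noteq> \<zero>} \<union> {n. hcomp M n y \<noteq> \<zero>}"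
  have T: "finite ?T" using hcomp_finite x y by simp
  show ?thesis
  proof (rule hcomp_unique[OF T])
    have "x \<oplus> y = (\<Oplus>n\<in>?T. hcomp M n x) \<oplus> (\<Oplus>n\<in>?T. hcomp M n y)"
      using hcomp_sum_over[OF x T] hcomp_sum_over[OF y T] by auto
    also have "\<dots> = (\<Oplus>n\<in>?T. hcomp M n x \<oplus> hcomp M n y)"
      by (rule finsum_addf[symmetric]) (use x y in auto)
    finally show "x \<oplus> y = (\<Oplus>n\<in>?T. hcomp M n x \<oplus> hcomp M n y)" .
  qed (use hcomp_grade[OF x] hcomp_grade[OF y] grade_add in auto)
qed

lemma (in graded_grp) additive_map_hcomp: "additive_map M M (hcomp M n)"
  by (auto simp: additive_map_def hcomp_add)

lemma (in graded_grp) hcomp_uminus: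
  assumes "x \<in> carrier M"
  shows "hcomp M n (\<ominus> x) = \<ominus> hcomp M n x"
  using additive_map_uminus[OF additive_map_hcomp abelian_group_axioms abelian_group_axioms assms] .

text \<open>
  A family of additive projections onto the components certifies a grading: it exhibits a
  decomposition of every element, and applied to an arbitrary decomposition it returns its terms.
\<close>

lemma graded_group_by_projections:
  assumes M: "abelian_group M"
    and sub: "\<And>n. additive_subgroup (grade M n) M"
    and add: "\<And>n. additive_map M M (p n)"
    and img: "\<And>n x. x \<in> carrier M \<Longrightarrow> p n x \<in> grade M n"
    and hom: "\<And>n m x. x \<in> grade M m \<Longrightarrow> p n x = (if n = m then x else \<zero>\<^bsub>M\<^esub>)"
    and fin: "\<And>x. x \<in> carrier M \<Longrightarrow> finite {n. p n x \<noteq> \<zero>\<^bsub>M\<^esub>}"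
    and dec: "\<And>x. x \<in> carrier M \<Longrightarrow> x = (\<Oplus>\<^bsub>M\<^esub>n\<in>{n. p n x \<noteq> \<zero>\<^bsub>M\<^esub>}. p n x)"
  shows "graded_grp M" and "x \<in> carrier M \<Longrightarrow> hcomp M n x = p n x"
proof -
  interpret M: abelian_group M by fact
  show gr: "graded_grp M"
  proof (unfold_locales, unfold graded_group_def, intro conjI ballI allI)
    fix x assume x: "x \<in> carrier M"
    show "\<exists>!f. (\<forall>n. f n \<in> grade M n) \<and> finite {n. f n \<noteq> \<zero>\<^bsub>M\<^esub>} \<and> x = (\<Oplus>\<^bsub>M\<^esub>n\<in>{n. f n \<noteq> \<zero>\<^bsub>M\<^esub>}. f n)"
    proof (rule ex1I[of _ "\<lambda>n. p n x"])
      show "(\<forall>n. p n x \<in> grade M n) \<and> finite {n. p n x \<noteq> \<zero>\<^bsub>M\<^esub>} \<and> x = (\<Oplus>\<^bsub>M\<^esub>n\<in>{n. p n x \<noteq> \<zero>\<^bsub>M\<^esub>}. p n x)"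
        using img fin dec x by blast
      fix f assume f: "(\<forall>n. f n \<in> grade M n) \<and> finite {n. f n \<noteq> \<zero>\<^bsub>M\<^esub>} \<and> x = (\<Oplus>\<^bsub>M\<^esub>n\<in>{n. f n \<noteq> \<zero>\<^bsub>M\<^esub>}. f n)"
      have fc: "f n \<in> carrier M" for n
        using f additive_subgroup.a_Hcarr[OF sub] by blast
      show "f = (\<lambda>n. p n x)"
      proof
        fix n
        have pf: "p n (f m) = (if n = m then f m else \<zero>\<^bsub>M\<^esub>)" for m
          using hom f by auto
        have "p n x = p n (\<Oplus>\<^bsub>M\<^esub>n\<in>{n. f n \<noteq> \<zero>\<^bsub>M\<^esub>}. f n)" using f by simp
        also have "\<dots> = (\<Oplus>\<^bsub>M\<^esub>m\<in>{n. f n \<noteq> \<zero>\<^bsub>M\<^esub>}. p n (f m))"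
          by (rule additive_map_finsum[OF add M M]) (use f fc in auto)
        also have "\<dots> = f n"
        proof (cases "f n = \<zero>\<^bsub>M\<^esub>")
          case True
          then show ?thesis using pf by (intro M.finsum_all0[THEN HOL.trans]) auto
        next
          case False
          then show ?thesis
            using M.finsum_single[of "{n. f n \<noteq> \<zero>\<^bsub>M\<^esub>}" n "\<lambda>m. p n (f m)"] f fc pf by auto
        qed
        finally show "f n = p n x" by simp
      qed
    qed
  qed (rule sub)
  interpret M: graded_grp M by fact
  show "hcomp M n x = p n x" if x: "x \<in> carrier M"
    by (rule M.hcomp_unique[OF fin[OF x] _ _ dec[OF x]]) (use img x in auto)
qed

section \<open>Graded modules and their homomorphisms\<close>

sublocale graded_algebra \<subseteq> K: field K by (rule field)
sublocale graded_algebra \<subseteq> A: ring A by (rule ring)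
sublocale graded_algebra \<subseteq> A: graded_grp A
proof
  show "graded_group A" using graded_space unfolding graded_space_def by blast
qed

text \<open>
  The predicate \<^const>\<open>graded_left_module\<close> as a locale, so that the laws of a graded module and the
  calculus of its components come with an interpretation.
\<close>

locale gmod = graded_algebra K A + graded_grp M
  for K :: "('k, 'z) ring_scheme" and A :: "('k, 'a) gmodule" and M :: "('a, 'm) gmodule" +
  assumes left_module: "left_module A M"
    and grade_smult: "\<lbrakk>a \<in> grade A m; x \<in> grade M n\<rbrakk> \<Longrightarrow> a \<odot>\<^bsub>M\<^esub> x \<in> grade M (m + n)"

lemma (in graded_algebra) gmodI:
  assumes "left_module A M" "graded_group M"
    and "\<And>m n a x. \<lbrakk>a \<in> grade A m; x \<in> grade M n\<rbrakk> \<Longrightarrow> a \<odot>\<^bsub>M\<^esub> x \<in> grade M (m + n)"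
  shows "gmod K A M"
proof (rule gmod.intro)
  show "graded_algebra K A" by (rule graded_algebra_axioms)
  show "graded_grp M"
    using left_module.abelian_group[OF assms(1)] assms(2)
    by (simp add: graded_grp_def graded_grp_axioms_def)
  show "gmod_axioms A M" by (rule gmod_axioms.intro) (fact assms)+
qed

lemma (in graded_algebra) gmod_iff: "gmod K A M \<longleftrightarrow> graded_left_module A M"
proof
  assume "gmod K A M"
  then interpret gmod K A M .
  show "graded_left_module A M"
    unfolding graded_left_module_def using left_module graded grade_smult by blast
next
  assume "graded_left_module A M"
  then show "gmod K A M"
    unfolding graded_left_module_def by (intro gmodI) blast+
qed

context gmod
begin

lemma smult_closed [simp, intro]: "\<lbrakk>a \<in> carrier A; x \<in> carrier M\<rbrakk> \<Longrightarrow> a \<odot>\<^bsub>M\<^esub> x \<in> carrier M"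
  and smult_l_distr: "\<lbrakk>a \<in> carrier A; b \<in> carrier A; x \<in> carrier M\<rbrakk> \<Longrightarrow>
    (a \<oplus>\<^bsub>A\<^esub> b) \<odot>\<^bsub>M\<^esub> x = a \<odot>\<^bsub>M\<^esub> x \<oplus>\<^bsub>M\<^esub> b \<odot>\<^bsub>M\<^esub> x"
  and smult_r_distr: "\<lbrakk>a \<in> carrier A; x \<in> carrier M; y \<in> carrier M\<rbrakk> \<Longrightarrow>
    a \<odot>\<^bsub>M\<^esub> (x \<oplus>\<^bsub>M\<^esub> y) = a \<odot>\<^bsub>M\<^esub> x \<oplus>\<^bsub>M\<^esub> a \<odot>\<^bsub>M\<^esub> y"
  and smult_assoc: "\<lbrakk>a \<in> carrier A; b \<in> carrier A; x \<in> carrier M\<rbrakk> \<Longrightarrow>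
    (a \<otimes>\<^bsub>A\<^esub> b) \<odot>\<^bsub>M\<^esub> x = a \<odot>\<^bsub>M\<^esub> (b \<odot>\<^bsub>M\<^esub> x)"
  and smult_one [simp]: "x \<in> carrier M \<Longrightarrow> \<one>\<^bsub>A\<^esub> \<odot>\<^bsub>M\<^esub> x = x"
  using left_module by (simp_all add: left_module_def)

lemma additive_map_smult: "a \<in> carrier A \<Longrightarrow> additive_map M M (\<lambda>x. a \<odot>\<^bsub>M\<^esub> x)"
  by (auto simp: additive_map_def smult_r_distr)

lemma additive_map_scalar: "x \<in> carrier M \<Longrightarrow> additive_map A M (\<lambda>a. a \<odot>\<^bsub>M\<^esub> x)"
  by (auto simp: additive_map_def smult_l_distr)

lemma smult_zero_right [simp]: "a \<in> carrier A \<Longrightarrow> a \<odot>\<^bsub>M\<^esub> \<zero>\<^bsub>M\<^esub> = \<zero>\<^bsub>M\<^esub>"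
  using additive_map_zero[OF additive_map_smult abelian_group_axioms abelian_group_axioms] .

lemma smult_zero_left [simp]: "x \<in> carrier M \<Longrightarrow> \<zero>\<^bsub>A\<^esub> \<odot>\<^bsub>M\<^esub> x = \<zero>\<^bsub>M\<^esub>"
  using additive_map_zero[OF additive_map_scalar A.abelian_group_axioms abelian_group_axioms] .

lemma smult_uminus_right: "\<lbrakk>a \<in> carrier A; x \<in> carrier M\<rbrakk> \<Longrightarrow> a \<odot>\<^bsub>M\<^esub> (\<ominus>\<^bsub>M\<^esub> x) = \<ominus>\<^bsub>M\<^esub> (a \<odot>\<^bsub>M\<^esub> x)"
  using additive_map_uminus[OF additive_map_smult abelian_group_axioms abelian_group_axioms] .

lemma hcomp_smult:
  assumes a: "a \<in> grade A m" and x: "x \<in> carrier M"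
  shows "hcomp M n (a \<odot>\<^bsub>M\<^esub> x) = a \<odot>\<^bsub>M\<^esub> hcomp M (n - m) x"
proof -
  have "hcomp M (n - m + m) (a \<odot>\<^bsub>M\<^esub> x) = a \<odot>\<^bsub>M\<^esub> hcomp M (n - m) x"
  proof (rule hcomp_additive_map[OF graded_grp_axioms graded_grp_axioms additive_map_smult])
    show "(\<odot>\<^bsub>M\<^esub>) a ` grade M n \<subseteq> grade M (n + m)" for n
      using grade_smult[OF a] by (force simp: algebra_simps)
  qed (use a x A.grade_closed in auto)
  then show ?thesis by simp
qed

end

lemma gmodule_homD:
  assumes "f \<in> gmodule_hom A M N"
  shows hom_closed: "x \<in> carrier M \<Longrightarrow> f x \<in> carrier N"
    and hom_add: "\<lbrakk>x \<in> carrier M; y \<in> carrier M\<rbrakk> \<Longrightarrow> f (x \<oplus>\<^bsub>M\<^esub> y) = f x \<oplus>\<^bsub>N\<^esub> f y"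
    and hom_smult: "\<lbrakk>a \<in> carrier A; x \<in> carrier M\<rbrakk> \<Longrightarrow> f (a \<odot>\<^bsub>M\<^esub> x) = a \<odot>\<^bsub>N\<^esub> f x"
    and hom_grade: "x \<in> grade M n \<Longrightarrow> f x \<in> grade N n"
    and hom_additive: "additive_map M N f"
  using assms
  by (auto simp: gmodule_hom_def LinearCombinations.module_hom_def additive_map_def image_subset_iff)

lemma gmodule_homI:
  assumes "\<And>x. x \<in> carrier M \<Longrightarrow> f x \<in> carrier N"
    and "\<And>x y. \<lbrakk>x \<in> carrier M; y \<in> carrier M\<rbrakk> \<Longrightarrow> f (x \<oplus>\<^bsub>M\<^esub> y) = f x \<oplus>\<^bsub>N\<^esub> f y"
    and "\<And>a x. \<lbrakk>a \<in> carrier A; x \<in> carrier M\<rbrakk> \<Longrightarrow> f (a \<odot>\<^bsub>M\<^esub> x) = a \<odot>\<^bsub>N\<^esub> f x"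
    and "\<And>n x. x \<in> grade M n \<Longrightarrow> f x \<in> grade N n"
  shows "f \<in> gmodule_hom A M N"
  using assms by (auto simp: gmodule_hom_def LinearCombinations.module_hom_def)

lemma hom_comp:
  assumes f: "f \<in> gmodule_hom A M N" and g: "g \<in> gmodule_hom A N L"
  shows "(\<lambda>x. g (f x)) \<in> gmodule_hom A M L"
  by (intro gmodule_homI)
    (simp_all add: hom_closed[OF f] hom_closed[OF g] hom_add[OF f] hom_add[OF g]
      hom_smult[OF f] hom_smult[OF g] hom_grade[OF f] hom_grade[OF g])

context graded_algebra
begin

lemma hom_zero:
  assumes M: "gmod K A M" and N: "gmod K A N" and f: "f \<in> gmodule_hom A M N"
  shows "f \<zero>\<^bsub>M\<^esub> = \<zero>\<^bsub>N\<^esub>"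
proof -
  interpret M: gmod K A M by fact
  interpret N: gmod K A N by fact
  show ?thesis
    using additive_map_zero[OF hom_additive[OF f] M.abelian_group_axioms N.abelian_group_axioms] .
qed

lemma hom_uminus:
  assumes M: "gmod K A M" and N: "gmod K A N" and f: "f \<in> gmodule_hom A M N"
    and x: "x \<in> carrier M"
  shows "f (\<ominus>\<^bsub>M\<^esub> x) = \<ominus>\<^bsub>N\<^esub> f x"
proof -
  interpret M: gmod K A M by fact
  interpret N: gmod K A N by fact
  show ?thesis
    using additive_map_uminus[OF hom_additive[OF f] M.abelian_group_axioms
      N.abelian_group_axioms x] .
qed

lemma hom_finsum:
  assumes M: "gmod K A M" and N: "gmod K A N" and f: "f \<in> gmodule_hom A M N"
    and "g \<in> I \<rightarrow> carrier M" "finite I"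
  shows "f (finsum M g I) = finsum N (\<lambda>i. f (g i)) I"
proof -
  interpret M: gmod K A M by fact
  interpret N: gmod K A N by fact
  show ?thesis
    using additive_map_finsum[OF hom_additive[OF f] M.abelian_group_axioms
      N.abelian_group_axioms assms(4,5)] .
qed

lemma hom_hcomp:
  assumes M: "gmod K A M" and N: "gmod K A N" and f: "f \<in> gmodule_hom A M N"
    and x: "x \<in> carrier M"
  shows "hcomp N n (f x) = f (hcomp M n x)"
proof -
  interpret M: gmod K A M by fact
  interpret N: gmod K A N by fact
  show ?thesis
    using hcomp_additive_map[OF M.graded_grp_axioms N.graded_grp_axioms hom_additive[OF f] _ x,
      of 0 n] hom_grade[OF f] by auto
qed

lemma hom_add_fun:
  assumes N: "gmod K A N" and f: "f \<in> gmodule_hom A M N" and g: "g \<in> gmodule_hom A M N"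
  shows "(\<lambda>x. f x \<oplus>\<^bsub>N\<^esub> g x) \<in> gmodule_hom A M N"
proof -
  interpret N: gmod K A N by fact
  show ?thesis
    by (intro gmodule_homI)
      (simp_all add: hom_closed[OF f] hom_closed[OF g] hom_add[OF f] hom_add[OF g]
        hom_smult[OF f] hom_smult[OF g] hom_grade[OF f] hom_grade[OF g] N.smult_r_distr
        N.grade_add N.a_ac)
qed

lemma hom_uminus_fun:
  assumes N: "gmod K A N" and f: "f \<in> gmodule_hom A M N"
  shows "(\<lambda>x. \<ominus>\<^bsub>N\<^esub> f x) \<in> gmodule_hom A M N"
proof -
  interpret N: gmod K A N by fact
  show ?thesis
    by (intro gmodule_homI)
      (simp_all add: hom_closed[OF f] hom_add[OF f] hom_smult[OF f] hom_grade[OF f]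
        N.smult_uminus_right N.grade_uminus N.minus_add)
qed

text \<open>
  Bijective homomorphisms reflect degrees because they commute with taking components.
\<close>

lemma hom_inverse:
  assumes M: "gmod K A M" and N: "gmod K A N" and f: "f \<in> gmodule_hom A M N"
    and bij: "bij_betw f (carrier M) (carrier N)"
  shows "inv_into (carrier M) f \<in> gmodule_hom A N M"
proof -
  interpret M: gmod K A M by fact
  interpret N: gmod K A N by fact
  let ?g = "inv_into (carrier M) f"
  have inj: "inj_on f (carrier M)" and im: "f ` carrier M = carrier N"
    using bij by (auto simp: bij_betw_def)
  have gc: "?g y \<in> carrier M" if "y \<in> carrier N" for y
    using that im by (simp add: inv_into_into)
  have fg: "f (?g y) = y" if "y \<in> carrier N" for y
    using that im by (simp add: f_inv_into_f)
  have eqI: "x = y" if "x \<in> carrier M" "y \<in> carrier M" "f x = f y" for x y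
    using inj that by (auto dest: inj_onD)
  show ?thesis
  proof (rule gmodule_homI)
    fix n y assume y: "y \<in> grade N n"
    then have yc: "y \<in> carrier N" by (rule N.grade_closed)
    have "f (hcomp M n (?g y)) = hcomp N n (f (?g y))"
      using hom_hcomp[OF M N f] gc yc by simp
    also have "\<dots> = f (?g y)" using N.hcomp_homogeneous[OF y] fg yc by simp
    finally have "hcomp M n (?g y) = ?g y" using eqI gc yc by simp
    then show "?g y \<in> grade M n" using M.hcomp_grade[OF gc[OF yc]] by metis
  next
    fix x y assume "x \<in> carrier N" "y \<in> carrier N"
    then show "?g (x \<oplus>\<^bsub>N\<^esub> y) = ?g x \<oplus>\<^bsub>M\<^esub> ?g y"
      by (intro eqI) (simp_all add: gc hom_add[OF f] fg)
  next
    fix a x assume "a \<in> carrier A" "x \<in> carrier N"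
    then show "?g (a \<odot>\<^bsub>N\<^esub> x) = a \<odot>\<^bsub>M\<^esub> ?g x"
      by (intro eqI) (simp_all add: gc hom_smult[OF f] fg)
  qed (rule gc)
qed

end

lemma (in abelian_group) additive_subgroupI:
  assumes "\<And>x. x \<in> H \<Longrightarrow> x \<in> carrier G" "\<zero> \<in> H"
    and "\<And>x y. \<lbrakk>x \<in> H; y \<in> H\<rbrakk> \<Longrightarrow> x \<oplus> y \<in> H" "\<And>x. x \<in> H \<Longrightarrow> \<ominus> x \<in> H"
  shows "additive_subgroup H G"
  by (intro additive_subgroup.intro subgroup.intro)
    (use assms in \<open>auto simp: a_inv_def[symmetric]\<close>)

section \<open>Sums of shifted principal projectives\<close>

text \<open>
  The graded module \<open>\<Oplus>\<^sub>s A u\<^sub>s\<langle>d\<^sub>s\<rangle>\<close>, consisting of families with finite support. With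
  \<^term>\<open>u s = \<one>\<^bsub>A\<^esub>\<close> it is a graded free module, and with vertices \<^term>\<open>u s\<close> it is a term of a
  minimal resolution; both cases are needed, so the idempotents are a parameter.
\<close>

definition FS :: "('k, 'a) gmodule \<Rightarrow> 'i set \<Rightarrow> ('i \<Rightarrow> 'a) \<Rightarrow> ('i \<Rightarrow> int) \<Rightarrow> ('a, 'i \<Rightarrow> 'a) gmodule" where
  "FS A I u d = direct_sum I (\<lambda>s. shift (left_ideal_module A {a \<otimes>\<^bsub>A\<^esub> u s | a. a \<in> carrier A}) (d s))"

definition unit_vec :: "('k, 'a) gmodule \<Rightarrow> 'i set \<Rightarrow> 'i \<Rightarrow> 'a \<Rightarrow> 'i \<Rightarrow> 'a" where
  "unit_vec A I s a = (\<lambda>t\<in>I. if t = s then a else \<zero>\<^bsub>A\<^esub>)"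

locale principal_family = graded_algebra K A
  for K :: "('k, 'z) ring_scheme" and A :: "('k, 'a) gmodule" +
  fixes I :: "'i set" and u :: "'i \<Rightarrow> 'a" and d :: "'i \<Rightarrow> int"
  assumes unit_grade: "s \<in> I \<Longrightarrow> u s \<in> grade A 0"
    and unit_idem: "s \<in> I \<Longrightarrow> u s \<otimes>\<^bsub>A\<^esub> u s = u s"
begin

abbreviation F where "F \<equiv> FS A I u d"

lemma unit_closed [simp]: "s \<in> I \<Longrightarrow> u s \<in> carrier A"
  using unit_grade A.grade_closed by blast

lemma principal_eq:
  assumes "s \<in> I"
  shows "{a \<otimes>\<^bsub>A\<^esub> u s | a. a \<in> carrier A} = {x \<in> carrier A. x \<otimes>\<^bsub>A\<^esub> u s = x}"
proof (intro Set.equalityI subsetI)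
  fix x assume "x \<in> {a \<otimes>\<^bsub>A\<^esub> u s | a. a \<in> carrier A}"
  then obtain a where "a \<in> carrier A" "x = a \<otimes>\<^bsub>A\<^esub> u s" by blast
  then show "x \<in> {x \<in> carrier A. x \<otimes>\<^bsub>A\<^esub> u s = x}"
    using assms by (simp add: A.m_assoc unit_idem)
next
  fix x assume "x \<in> {x \<in> carrier A. x \<otimes>\<^bsub>A\<^esub> u s = x}"
  then have "x \<in> carrier A" "x = x \<otimes>\<^bsub>A\<^esub> u s" by simp_all
  then show "x \<in> {a \<otimes>\<^bsub>A\<^esub> u s | a. a \<in> carrier A}" by blast
qed

lemma FS_carrier: "x \<in> carrier F \<longleftrightarrow>
    x \<in> extensional I \<and> (\<forall>s\<in>I. x s \<in> carrier A \<and> x s \<otimes>\<^bsub>A\<^esub> u s = x s) \<and> finite {s\<in>I. x s \<noteq> \<zero>\<^bsub>A\<^esub>}"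
proof -
  have "(\<Pi>\<^sub>E s\<in>I. {a \<otimes>\<^bsub>A\<^esub> u s | a. a \<in> carrier A}) = (\<Pi>\<^sub>E s\<in>I. {x \<in> carrier A. x \<otimes>\<^bsub>A\<^esub> u s = x})"
    by (rule PiE_cong) (rule principal_eq)
  moreover have "carrier F = {f \<in> (\<Pi>\<^sub>E s\<in>I. {a \<otimes>\<^bsub>A\<^esub> u s | a. a \<in> carrier A}). finite {s\<in>I. f s \<noteq> \<zero>\<^bsub>A\<^esub>}}"
    by (simp add: FS_def direct_sum_def Let_def shift_def left_ideal_module_def)
  ultimately have "carrier F = {f \<in> (\<Pi>\<^sub>E s\<in>I. {x \<in> carrier A. x \<otimes>\<^bsub>A\<^esub> u s = x}). finite {s\<in>I. f s \<noteq> \<zero>\<^bsub>A\<^esub>}}"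
    by simp
  then show ?thesis by (simp add: PiE_iff) blast
qed

lemma FS_grade: "x \<in> grade F n \<longleftrightarrow> x \<in> carrier F \<and> (\<forall>s\<in>I. x s \<in> grade A (n - d s))"
proof -
  have "grade F n = {f \<in> carrier F. \<forall>s\<in>I. f s \<in> grade A (n - d s) \<inter> {a \<otimes>\<^bsub>A\<^esub> u s | a. a \<in> carrier A}}"
    by (simp add: FS_def direct_sum_def Let_def shift_def left_ideal_module_def)
  then have "x \<in> grade F n \<longleftrightarrow>
      x \<in> carrier F \<and> (\<forall>s\<in>I. x s \<in> grade A (n - d s) \<inter> {a \<otimes>\<^bsub>A\<^esub> u s | a. a \<in> carrier A})"
    by blast
  moreover have "x s \<in> {a \<otimes>\<^bsub>A\<^esub> u s | a. a \<in> carrier A}" if "x \<in> carrier F" "s \<in> I" for s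
    unfolding principal_eq[OF that(2)] using that by (simp add: FS_carrier)
  ultimately show ?thesis by blast
qed

lemma FS_zero: "\<zero>\<^bsub>F\<^esub> = (\<lambda>s\<in>I. \<zero>\<^bsub>A\<^esub>)"
  unfolding FS_def direct_sum_def Let_def shift_def left_ideal_module_def by simp

lemma FS_add: "x \<oplus>\<^bsub>F\<^esub> y = (\<lambda>s\<in>I. x s \<oplus>\<^bsub>A\<^esub> y s)"
  unfolding FS_def direct_sum_def Let_def shift_def left_ideal_module_def by simp

lemma FS_smult: "a \<odot>\<^bsub>F\<^esub> x = (\<lambda>s\<in>I. a \<otimes>\<^bsub>A\<^esub> x s)"
  unfolding FS_def direct_sum_def Let_def shift_def left_ideal_module_def by simp

lemma FS_closed [simp]: "x \<in> carrier F \<Longrightarrow> s \<in> I \<Longrightarrow> x s \<in> carrier A"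
  and FS_unit [simp]: "x \<in> carrier F \<Longrightarrow> s \<in> I \<Longrightarrow> x s \<otimes>\<^bsub>A\<^esub> u s = x s"
  and FS_finite: "x \<in> carrier F \<Longrightarrow> finite {s\<in>I. x s \<noteq> \<zero>\<^bsub>A\<^esub>}"
  and FS_extensional: "x \<in> carrier F \<Longrightarrow> x \<in> extensional I"
  unfolding FS_carrier by blast+

lemma FS_eqI: "\<lbrakk>x \<in> carrier F; y \<in> carrier F; \<And>s. s \<in> I \<Longrightarrow> x s = y s\<rbrakk> \<Longrightarrow> x = y"
  by (rule extensionalityI[of x I y]) (unfold FS_carrier, blast+)

lemma FS_memI:
  assumes "x \<in> extensional I" "\<And>s. s \<in> I \<Longrightarrow> x s \<in> carrier A" "\<And>s. s \<in> I \<Longrightarrow> x s \<otimes>\<^bsub>A\<^esub> u s = x s"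
    and "finite T" "\<And>s. s \<in> I \<Longrightarrow> s \<notin> T \<Longrightarrow> x s = \<zero>\<^bsub>A\<^esub>"
  shows "x \<in> carrier F"
proof -
  have "{s\<in>I. x s \<noteq> \<zero>\<^bsub>A\<^esub>} \<subseteq> T" using assms(5) by blast
  then have "finite {s\<in>I. x s \<noteq> \<zero>\<^bsub>A\<^esub>}" using assms(4) by (rule finite_subset)
  then show ?thesis unfolding FS_carrier using assms(1-3) by blast
qed

lemma FS_zero_closed: "(\<lambda>s\<in>I. \<zero>\<^bsub>A\<^esub>) \<in> carrier F"
  by (rule FS_memI[of _ "{}"]) simp_all

lemma FS_add_closed:
  assumes "x \<in> carrier F" "y \<in> carrier F"
  shows "x \<oplus>\<^bsub>F\<^esub> y \<in> carrier F"
  by (rule FS_memI[of _ "{s\<in>I. x s \<noteq> \<zero>\<^bsub>A\<^esub>} \<union> {s\<in>I. y s \<noteq> \<zero>\<^bsub>A\<^esub>}"])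
    (use assms FS_finite in \<open>auto simp: FS_add A.l_distr\<close>)

lemma FS_smult_closed:
  assumes "a \<in> carrier A" "x \<in> carrier F"
  shows "a \<odot>\<^bsub>F\<^esub> x \<in> carrier F"
  by (rule FS_memI[of _ "{s\<in>I. x s \<noteq> \<zero>\<^bsub>A\<^esub>}"])
    (use assms FS_finite in \<open>auto simp: FS_smult A.m_assoc\<close>)

lemma FS_abelian_group: "abelian_group F"
proof (rule abelian_groupI)
  fix x assume x: "x \<in> carrier F"
  show "\<exists>y\<in>carrier F. y \<oplus>\<^bsub>F\<^esub> x = \<zero>\<^bsub>F\<^esub>"
  proof (rule bexI)
    show "(\<lambda>s\<in>I. \<ominus>\<^bsub>A\<^esub> x s) \<in> carrier F"
      by (rule FS_memI[of _ "{s\<in>I. x s \<noteq> \<zero>\<^bsub>A\<^esub>}"])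
        (use x FS_finite in \<open>auto simp: A.l_minus\<close>)
    then show "(\<lambda>s\<in>I. \<ominus>\<^bsub>A\<^esub> x s) \<oplus>\<^bsub>F\<^esub> x = \<zero>\<^bsub>F\<^esub>"
      using x by (auto simp: FS_add FS_zero A.l_neg intro!: restrict_ext)
  qed
next
  fix x assume x: "x \<in> carrier F"
  have "\<zero>\<^bsub>F\<^esub> \<oplus>\<^bsub>F\<^esub> x \<in> carrier F"
    using FS_zero_closed x unfolding FS_zero by (rule FS_add_closed)
  then show "\<zero>\<^bsub>F\<^esub> \<oplus>\<^bsub>F\<^esub> x = x"
    using x by (rule FS_eqI) (use x in \<open>simp add: FS_add FS_zero\<close>)
next
  fix x y z assume xyz: "x \<in> carrier F" "y \<in> carrier F" "z \<in> carrier F"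
  then show "x \<oplus>\<^bsub>F\<^esub> y \<oplus>\<^bsub>F\<^esub> z = x \<oplus>\<^bsub>F\<^esub> (y \<oplus>\<^bsub>F\<^esub> z)"
    by (auto simp: FS_add A.a_assoc intro!: restrict_ext)
next
  fix x y assume "x \<in> carrier F" "y \<in> carrier F"
  then show "x \<oplus>\<^bsub>F\<^esub> y = y \<oplus>\<^bsub>F\<^esub> x"
    by (auto simp: FS_add A.a_comm intro!: restrict_ext)
qed (simp_all add: FS_add_closed FS_zero_closed FS_zero)

lemma FS_left_module: "left_module A F"
proof (rule left_module.intro)
  fix a b x assume ab: "a \<in> carrier A" "b \<in> carrier A" and x: "x \<in> carrier F"
  show "(a \<oplus>\<^bsub>A\<^esub> b) \<odot>\<^bsub>F\<^esub> x = a \<odot>\<^bsub>F\<^esub> x \<oplus>\<^bsub>F\<^esub> b \<odot>\<^bsub>F\<^esub> x"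
    using ab x by (auto simp: FS_add FS_smult A.l_distr intro!: restrict_ext)
  show "(a \<otimes>\<^bsub>A\<^esub> b) \<odot>\<^bsub>F\<^esub> x = a \<odot>\<^bsub>F\<^esub> (b \<odot>\<^bsub>F\<^esub> x)"
    using ab x by (auto simp: FS_add FS_smult A.m_assoc intro!: restrict_ext)
next
  fix a x y assume "a \<in> carrier A" "x \<in> carrier F" "y \<in> carrier F"
  then show "a \<odot>\<^bsub>F\<^esub> (x \<oplus>\<^bsub>F\<^esub> y) = a \<odot>\<^bsub>F\<^esub> x \<oplus>\<^bsub>F\<^esub> a \<odot>\<^bsub>F\<^esub> y"
    by (auto simp: FS_add FS_smult A.r_distr intro!: restrict_ext)
next
  fix x assume "x \<in> carrier F"
  then show "\<one>\<^bsub>A\<^esub> \<odot>\<^bsub>F\<^esub> x = x"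
    using FS_smult_closed by (intro FS_eqI) (auto simp: FS_smult)
qed (simp_all add: FS_smult_closed FS_abelian_group ring)

lemma FS_coordinate_additive: "s \<in> I \<Longrightarrow> additive_map F A (\<lambda>x. x s)"
  by (auto simp: additive_map_def FS_add)

lemma FS_finsum:
  assumes "finite T" "f \<in> T \<rightarrow> carrier F" "s \<in> I"
  shows "finsum F f T s = (\<Oplus>\<^bsub>A\<^esub>t\<in>T. f t s)"
  using additive_map_finsum[OF FS_coordinate_additive[OF assms(3)] FS_abelian_group
    A.abelian_group_axioms assms(2,1)] .

lemma unit_hcomp:
  assumes a: "a \<in> carrier A" and s: "s \<in> I" and au: "a \<otimes>\<^bsub>A\<^esub> u s = a"
  shows "hcomp A n a \<otimes>\<^bsub>A\<^esub> u s = hcomp A n a"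
proof -
  have "hcomp A (n + 0) (a \<otimes>\<^bsub>A\<^esub> u s) = hcomp A n a \<otimes>\<^bsub>A\<^esub> u s"
  proof (rule hcomp_additive_map[OF A.graded_grp_axioms A.graded_grp_axioms _ _ a])
    show "additive_map A A (\<lambda>a. a \<otimes>\<^bsub>A\<^esub> u s)" using s by (auto simp: additive_map_def A.l_distr)
    show "(\<lambda>a. a \<otimes>\<^bsub>A\<^esub> u s) ` grade A n \<subseteq> grade A (n + 0)" for n
      using grade_mult[OF _ unit_grade[OF s]] by auto
  qed
  then show ?thesis using au by simp
qed

lemma FS_component_closed:
  assumes x: "x \<in> carrier F"
  shows "(\<lambda>s\<in>I. hcomp A (n - d s) (x s)) \<in> carrier F"
  by (rule FS_memI[of _ "{s\<in>I. x s \<noteq> \<zero>\<^bsub>A\<^esub>}"])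
    (use x FS_finite in \<open>auto simp: unit_hcomp\<close>)

lemma hcomp_shifted_sum:
  assumes a: "a \<in> carrier A" and T: "finite T" "\<And>n. n \<notin> T \<Longrightarrow> hcomp A (n - k) a = \<zero>\<^bsub>A\<^esub>"
  shows "(\<Oplus>\<^bsub>A\<^esub>n\<in>T. hcomp A (n - k) a) = a"
proof -
  have "(\<Oplus>\<^bsub>A\<^esub>n\<in>T. hcomp A (n - k) a) = (\<Oplus>\<^bsub>A\<^esub>m\<in>(\<lambda>n. n - k) ` T. hcomp A m a)"
    by (subst A.add.finprod_reindex) (use a in \<open>auto simp: inj_on_def\<close>)
  also have "\<dots> = a"
  proof (rule A.hcomp_sum_over[symmetric, OF a])
    fix m assume "m \<notin> (\<lambda>n. n - k) ` T"
    then have "m + k \<notin> T" by (metis add_diff_cancel imageI)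
    from T(2)[OF this] show "hcomp A m a = \<zero>\<^bsub>A\<^esub>" by simp
  qed (use T in simp)
  finally show ?thesis .
qed

lemma FS_graded: "graded_grp F"
  and FS_hcomp: "x \<in> carrier F \<Longrightarrow> hcomp F n x = (\<lambda>s\<in>I. hcomp A (n - d s) (x s))"
proof -
  define p where "p n x = (\<lambda>s\<in>I. hcomp A (n - d s) (x s))" for n x
  interpret F: abelian_group F by (rule FS_abelian_group)
  have pc: "p n x \<in> carrier F" if "x \<in> carrier F" for n x
    using FS_component_closed[OF that] by (simp add: p_def)
  have a_inv: "(\<ominus>\<^bsub>F\<^esub> x) s = \<ominus>\<^bsub>A\<^esub> x s" if "x \<in> carrier F" "s \<in> I" for x s
    using additive_map_uminus[OF FS_coordinate_additive FS_abelian_group A.abelian_group_axioms]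
      that by blast
  have fin: "finite {n. p n x \<noteq> \<zero>\<^bsub>F\<^esub>}" if x: "x \<in> carrier F" for x
  proof -
    have "{n. p n x \<noteq> \<zero>\<^bsub>F\<^esub>} \<subseteq>
        (\<Union>s\<in>{s\<in>I. x s \<noteq> \<zero>\<^bsub>A\<^esub>}. (\<lambda>m. m + d s) ` {m. hcomp A m (x s) \<noteq> \<zero>\<^bsub>A\<^esub>})"
    proof
      fix n assume "n \<in> {n. p n x \<noteq> \<zero>\<^bsub>F\<^esub>}"
      then obtain s where s: "s \<in> I" "hcomp A (n - d s) (x s) \<noteq> \<zero>\<^bsub>A\<^esub>"
        by (auto simp: p_def FS_zero fun_eq_iff restrict_def split: if_splits)
      moreover have "x s \<noteq> \<zero>\<^bsub>A\<^esub>" using s by auto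
      moreover have "n = (n - d s) + d s" by simp
      ultimately show "n \<in> (\<Union>s\<in>{s\<in>I. x s \<noteq> \<zero>\<^bsub>A\<^esub>}. (\<lambda>m. m + d s) ` {m. hcomp A m (x s) \<noteq> \<zero>\<^bsub>A\<^esub>})"
        by blast
    qed
    moreover have "finite \<dots>" using FS_finite[OF x] A.hcomp_finite x by auto
    ultimately show ?thesis using finite_subset by blast
  qed
  have sub: "additive_subgroup (grade F n) F" for n
  proof (rule F.additive_subgroupI)
    show "\<ominus>\<^bsub>F\<^esub> x \<in> grade F n" if "x \<in> grade F n" for x
      using that by (simp add: FS_grade a_inv A.grade_uminus)
    show "x \<oplus>\<^bsub>F\<^esub> y \<in> grade F n" if "x \<in> grade F n" "y \<in> grade F n" for x y
      using that FS_add_closed[of x y] by (simp add: FS_grade) (simp add: FS_add A.grade_add)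
    show "\<zero>\<^bsub>F\<^esub> \<in> grade F n"
      using FS_zero_closed by (simp add: FS_grade FS_zero)
  qed (simp add: FS_grade)
  have add: "additive_map F F (p n)" for n
    using pc FS_add_closed
    by (auto simp: additive_map_def p_def FS_add A.hcomp_add intro!: restrict_ext)
  have img: "p n x \<in> grade F n" if "x \<in> carrier F" for n x
    using that pc[OF that] by (auto simp: FS_grade p_def A.hcomp_grade)
  have hom: "p n x = (if n = m then x else \<zero>\<^bsub>F\<^esub>)" if "x \<in> grade F m" for n m x
  proof -
    have h: "hcomp A (n - d s) (x s) = (if n = m then x s else \<zero>\<^bsub>A\<^esub>)" if "s \<in> I" for s
      using A.hcomp_homogeneous[of "x s" "m - d s" "n - d s"] \<open>x \<in> grade F m\<close> that
      by (auto simp: FS_grade)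
    show ?thesis
    proof (cases "n = m")
      case True
      have "x \<in> extensional I" using that FS_extensional by (simp add: FS_grade)
      then show ?thesis using True h by (auto simp: p_def restrict_def extensional_def fun_eq_iff)
    next
      case False
      then show ?thesis using h by (auto simp: p_def FS_zero intro!: restrict_ext)
    qed
  qed
  have dec: "x = (\<Oplus>\<^bsub>F\<^esub>n\<in>{n. p n x \<noteq> \<zero>\<^bsub>F\<^esub>}. p n x)" if x: "x \<in> carrier F" for x
  proof (rule FS_eqI[OF x])
    show "(\<Oplus>\<^bsub>F\<^esub>n\<in>{n. p n x \<noteq> \<zero>\<^bsub>F\<^esub>}. p n x) \<in> carrier F" using pc x by simp
    fix s assume s: "s \<in> I"
    have "(\<Oplus>\<^bsub>F\<^esub>n\<in>{n. p n x \<noteq> \<zero>\<^bsub>F\<^esub>}. p n x) s = (\<Oplus>\<^bsub>A\<^esub>n\<in>{n. p n x \<noteq> \<zero>\<^bsub>F\<^esub>}. p n x s)"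
      by (rule FS_finsum[OF fin[OF x] _ s]) (use pc x in auto)
    also have "\<dots> = (\<Oplus>\<^bsub>A\<^esub>n\<in>{n. p n x \<noteq> \<zero>\<^bsub>F\<^esub>}. hcomp A (n - d s) (x s))"
      using s by (simp add: p_def)
    also have "\<dots> = x s"
    proof (rule hcomp_shifted_sum[OF FS_closed[OF x s] fin[OF x]])
      fix n assume "n \<notin> {n. p n x \<noteq> \<zero>\<^bsub>F\<^esub>}"
      then have "p n x s = \<zero>\<^bsub>F\<^esub> s" by simp
      then show "hcomp A (n - d s) (x s) = \<zero>\<^bsub>A\<^esub>" using s by (simp add: p_def FS_zero)
    qed
    finally show "x s = (\<Oplus>\<^bsub>F\<^esub>n\<in>{n. p n x \<noteq> \<zero>\<^bsub>F\<^esub>}. p n x) s" by simp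
  qed
  show "graded_grp F" "x \<in> carrier F \<Longrightarrow> hcomp F n x = (\<lambda>s\<in>I. hcomp A (n - d s) (x s))"
    using graded_group_by_projections[where p = p, OF FS_abelian_group sub add img hom fin dec]
    by (simp_all add: p_def)
qed

lemma FS_gmod: "gmod K A F"
proof (rule gmodI)
  show "left_module A F" by (rule FS_left_module)
  show "graded_group F" by (rule graded_grp.graded[OF FS_graded])
  fix a m x n assume a: "a \<in> grade A m" and x: "x \<in> grade F n"
  have "a \<otimes>\<^bsub>A\<^esub> x s \<in> grade A (m + n - d s)" if "s \<in> I" for s
    using grade_mult[OF a, of "x s" "n - d s"] x that by (simp add: FS_grade add_diff_eq)
  then show "a \<odot>\<^bsub>F\<^esub> x \<in> grade F (m + n)"
    using x FS_smult_closed[OF A.grade_closed[OF a], of x] by (simp add: FS_grade) (simp add: FS_smult)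
qed

abbreviation \<iota> where "\<iota> s \<equiv> unit_vec A I s (u s)"

lemma unit_vec_closed:
  assumes "s \<in> I" "a \<in> carrier A" "a \<otimes>\<^bsub>A\<^esub> u s = a"
  shows "unit_vec A I s a \<in> carrier F"
  by (rule FS_memI[of _ "{s}"]) (use assms in \<open>auto simp: unit_vec_def\<close>)

lemma unit_vec_unit_closed [simp]: "s \<in> I \<Longrightarrow> \<iota> s \<in> carrier F"
  by (simp add: unit_vec_closed unit_idem)

lemma unit_vec_grade: "s \<in> I \<Longrightarrow> \<iota> s \<in> grade F (d s)"
  by (auto simp: FS_grade unit_vec_def unit_grade)
    (auto simp: unit_vec_def[symmetric])

lemma unit_vec_idem: "s \<in> I \<Longrightarrow> u s \<odot>\<^bsub>F\<^esub> \<iota> s = \<iota> s"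
  by (auto simp: FS_smult unit_vec_def unit_idem intro!: restrict_ext)

lemma FS_decompose:
  assumes x: "x \<in> carrier F" and T: "finite T" "T \<subseteq> I" "\<And>s. s \<in> I \<Longrightarrow> s \<notin> T \<Longrightarrow> x s = \<zero>\<^bsub>A\<^esub>"
  shows "x = (\<Oplus>\<^bsub>F\<^esub>s\<in>T. x s \<odot>\<^bsub>F\<^esub> \<iota> s)"
proof -
  interpret F: gmod K A F by (rule FS_gmod)
  have c: "(\<lambda>s. x s \<odot>\<^bsub>F\<^esub> \<iota> s) \<in> T \<rightarrow> carrier F" using x T by (auto intro!: F.smult_closed)
  show ?thesis
  proof (rule FS_eqI[OF x])
    show "(\<Oplus>\<^bsub>F\<^esub>s\<in>T. x s \<odot>\<^bsub>F\<^esub> \<iota> s) \<in> carrier F" using c by simp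
    fix s assume s: "s \<in> I"
    have "(\<Oplus>\<^bsub>F\<^esub>t\<in>T. x t \<odot>\<^bsub>F\<^esub> \<iota> t) s = (\<Oplus>\<^bsub>A\<^esub>t\<in>T. (x t \<odot>\<^bsub>F\<^esub> \<iota> t) s)"
      by (rule FS_finsum[OF T(1) c s])
    also have "\<dots> = x s"
    proof (cases "s \<in> T")
      case True
      have "(\<Oplus>\<^bsub>A\<^esub>t\<in>T. (x t \<odot>\<^bsub>F\<^esub> \<iota> t) s) = (x s \<odot>\<^bsub>F\<^esub> \<iota> s) s"
        by (rule A.finsum_single[OF T(1) True]) (use x s T in \<open>auto simp: FS_smult unit_vec_def\<close>)
      then show ?thesis using x s by (simp add: FS_smult unit_vec_def)
    next
      case False
      have "(\<Oplus>\<^bsub>A\<^esub>t\<in>T. (x t \<odot>\<^bsub>F\<^esub> \<iota> t) s) = \<zero>\<^bsub>A\<^esub>"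
        by (rule A.finsum_all0) (use x s T False in \<open>auto simp: FS_smult unit_vec_def\<close>)
      then show ?thesis using T(3)[OF s False] by simp
    qed
    finally show "x s = (\<Oplus>\<^bsub>F\<^esub>t\<in>T. x t \<odot>\<^bsub>F\<^esub> \<iota> t) s" by simp
  qed
qed

lemma hom_FS_formula:
  assumes Y: "gmod K A Y" and f: "f \<in> gmodule_hom A F Y" and x: "x \<in> carrier F"
    and T: "finite T" "T \<subseteq> I" "\<And>s. s \<in> I \<Longrightarrow> s \<notin> T \<Longrightarrow> x s = \<zero>\<^bsub>A\<^esub>"
  shows "f x = (\<Oplus>\<^bsub>Y\<^esub>s\<in>T. x s \<odot>\<^bsub>Y\<^esub> f (\<iota> s))"
proof -
  interpret F: gmod K A F by (rule FS_gmod)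
  interpret Y: gmod K A Y by fact
  have "f x = f (\<Oplus>\<^bsub>F\<^esub>s\<in>T. x s \<odot>\<^bsub>F\<^esub> \<iota> s)" using FS_decompose[OF x T] by simp
  also have "\<dots> = (\<Oplus>\<^bsub>Y\<^esub>s\<in>T. f (x s \<odot>\<^bsub>F\<^esub> \<iota> s))"
    by (rule hom_finsum[OF FS_gmod Y f]) (use x T in \<open>auto intro!: F.smult_closed\<close>)
  also have "\<dots> = (\<Oplus>\<^bsub>Y\<^esub>s\<in>T. x s \<odot>\<^bsub>Y\<^esub> f (\<iota> s))"
    by (rule Y.add.finprod_cong') (use x T hom_closed[OF f] in \<open>auto simp: hom_smult[OF f] subset_iff\<close>)
  finally show ?thesis .
qed

lemma hom_FS_unique:
  assumes Y: "gmod K A Y" and f: "f \<in> gmodule_hom A F Y" and g: "g \<in> gmodule_hom A F Y"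
    and eq: "\<And>s. s \<in> I \<Longrightarrow> f (\<iota> s) = g (\<iota> s)" and x: "x \<in> carrier F"
  shows "f x = g x"
proof -
  interpret Y: gmod K A Y by fact
  let ?T = "{s\<in>I. x s \<noteq> \<zero>\<^bsub>A\<^esub>}"
  have T: "finite ?T" "?T \<subseteq> I" "\<And>s. s \<in> I \<Longrightarrow> s \<notin> ?T \<Longrightarrow> x s = \<zero>\<^bsub>A\<^esub>" using FS_finite[OF x] by auto
  have "f x = (\<Oplus>\<^bsub>Y\<^esub>s\<in>?T. x s \<odot>\<^bsub>Y\<^esub> f (\<iota> s))" by (rule hom_FS_formula[OF Y f x T])
  also have "\<dots> = (\<Oplus>\<^bsub>Y\<^esub>s\<in>?T. x s \<odot>\<^bsub>Y\<^esub> g (\<iota> s))"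
    by (rule Y.add.finprod_cong') (use x hom_closed[OF g] eq in \<open>auto intro!: Y.smult_closed\<close>)
  also have "\<dots> = g x" by (rule hom_FS_formula[OF Y g x T, symmetric])
  finally show ?thesis .
qed

text \<open>
  The generator at \<^term>\<open>s\<close> is homogeneous of degree \<^term>\<open>d s\<close> and fixed by \<^term>\<open>u s\<close>. It is
  free subject to these two conditions: the homomorphism sends \<^term>\<open>x\<close> to
  \<^term>\<open>\<Oplus>\<^bsub>X\<^esub>s\<in>{s\<in>I. x s \<noteq> \<zero>\<^bsub>A\<^esub>}. x s \<odot>\<^bsub>X\<^esub> m s\<close>.
\<close>

lemma FS_universal:
  assumes X: "gmod K A X" and m: "\<And>s. s \<in> I \<Longrightarrow> m s \<in> grade X (d s)"
    and um: "\<And>s. s \<in> I \<Longrightarrow> u s \<odot>\<^bsub>X\<^esub> m s = m s"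
  shows "\<exists>h\<in>gmodule_hom A F X. \<forall>s\<in>I. h (\<iota> s) = m s"
proof -
  interpret X: gmod K A X by fact
  have mc: "s \<in> I \<Longrightarrow> m s \<in> carrier X" for s using m X.grade_closed by blast
  define h where "h x = (\<Oplus>\<^bsub>X\<^esub>s\<in>{s\<in>I. x s \<noteq> \<zero>\<^bsub>A\<^esub>}. x s \<odot>\<^bsub>X\<^esub> m s)" for x
  have h: "h x = (\<Oplus>\<^bsub>X\<^esub>s\<in>T. x s \<odot>\<^bsub>X\<^esub> m s)"
    if "x \<in> carrier F" "finite T" "T \<subseteq> I" "\<And>s. s \<in> I \<Longrightarrow> s \<notin> T \<Longrightarrow> x s = \<zero>\<^bsub>A\<^esub>" for x T
    unfolding h_def by (rule X.add.finprod_mono_neutral_cong_left) (use that mc in auto)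
  have "h \<in> gmodule_hom A F X"
  proof (rule gmodule_homI)
    fix x assume x: "x \<in> carrier F"
    show "h x \<in> carrier X" unfolding h_def by (intro X.finsum_closed) (use x mc in auto)
  next
    fix x y assume x: "x \<in> carrier F" and y: "y \<in> carrier F"
    let ?T = "{s\<in>I. x s \<noteq> \<zero>\<^bsub>A\<^esub>} \<union> {s\<in>I. y s \<noteq> \<zero>\<^bsub>A\<^esub>}"
    have T: "finite ?T" using x y FS_finite by simp
    have "h (x \<oplus>\<^bsub>F\<^esub> y) = (\<Oplus>\<^bsub>X\<^esub>s\<in>?T. (x \<oplus>\<^bsub>F\<^esub> y) s \<odot>\<^bsub>X\<^esub> m s)"
      by (rule h) (use x y T FS_add_closed in \<open>auto simp: FS_add\<close>)
    also have "\<dots> = (\<Oplus>\<^bsub>X\<^esub>s\<in>?T. x s \<odot>\<^bsub>X\<^esub> m s \<oplus>\<^bsub>X\<^esub> y s \<odot>\<^bsub>X\<^esub> m s)"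
      by (rule X.add.finprod_cong') (use x y mc in \<open>auto simp: FS_add X.smult_l_distr\<close>)
    also have "\<dots> = (\<Oplus>\<^bsub>X\<^esub>s\<in>?T. x s \<odot>\<^bsub>X\<^esub> m s) \<oplus>\<^bsub>X\<^esub> (\<Oplus>\<^bsub>X\<^esub>s\<in>?T. y s \<odot>\<^bsub>X\<^esub> m s)"
      by (rule X.finsum_addf) (use x y mc in auto)
    also have "\<dots> = h x \<oplus>\<^bsub>X\<^esub> h y"
      using h[OF x T] h[OF y T] by auto
    finally show "h (x \<oplus>\<^bsub>F\<^esub> y) = h x \<oplus>\<^bsub>X\<^esub> h y" .
  next
    fix a x assume a: "a \<in> carrier A" and x: "x \<in> carrier F"
    let ?T = "{s\<in>I. x s \<noteq> \<zero>\<^bsub>A\<^esub>}"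
    have T: "finite ?T" using x FS_finite by simp
    have "h (a \<odot>\<^bsub>F\<^esub> x) = (\<Oplus>\<^bsub>X\<^esub>s\<in>?T. (a \<odot>\<^bsub>F\<^esub> x) s \<odot>\<^bsub>X\<^esub> m s)"
      by (rule h) (use a x T FS_smult_closed in \<open>auto simp: FS_smult\<close>)
    also have "\<dots> = (\<Oplus>\<^bsub>X\<^esub>s\<in>?T. a \<odot>\<^bsub>X\<^esub> (x s \<odot>\<^bsub>X\<^esub> m s))"
      by (rule X.add.finprod_cong') (use a x mc in \<open>auto simp: FS_smult X.smult_assoc\<close>)
    also have "\<dots> = a \<odot>\<^bsub>X\<^esub> (\<Oplus>\<^bsub>X\<^esub>s\<in>?T. x s \<odot>\<^bsub>X\<^esub> m s)"
      by (rule additive_map_finsum[OF X.additive_map_smult[OF a] X.abelian_group_axioms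
          X.abelian_group_axioms _ T, symmetric]) (use x mc in auto)
    finally show "h (a \<odot>\<^bsub>F\<^esub> x) = a \<odot>\<^bsub>X\<^esub> h x" by (simp add: h_def)
  next
    fix n x assume x: "x \<in> grade F n"
    then have xc: "x \<in> carrier F" by (simp add: FS_grade)
    have g: "x s \<odot>\<^bsub>X\<^esub> m s \<in> grade X n" if "s \<in> I" for s
      using X.grade_smult[of "x s" "n - d s" "m s" "d s"] x m that by (simp add: FS_grade)
    have "finite T \<Longrightarrow> T \<subseteq> I \<Longrightarrow> (\<Oplus>\<^bsub>X\<^esub>s\<in>T. x s \<odot>\<^bsub>X\<^esub> m s) \<in> grade X n" for T
    proof (induction T rule: finite_induct)
      case (insert s T)
      then show ?case using xc mc g
        by (subst X.finsum_insert) (auto intro!: X.grade_add X.smult_closed simp: subset_iff)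
    qed simp
    then show "h x \<in> grade X n" using FS_finite[OF xc] by (simp add: h_def)
  qed
  moreover have "h (\<iota> s) = m s" if s: "s \<in> I" for s
  proof -
    have "h (\<iota> s) = (\<Oplus>\<^bsub>X\<^esub>t\<in>{s}. \<iota> s t \<odot>\<^bsub>X\<^esub> m t)"
      by (rule h) (use s in \<open>auto simp: unit_vec_def[of A I s "u s"] unit_vec_unit_closed[OF s, unfolded unit_vec_def]\<close>)
    then show ?thesis using s mc um by (simp add: unit_vec_def)
  qed
  ultimately show ?thesis by blast
qed

text \<open>
  Projectivity of sums of principal projectives: a generator is lifted by lifting its image
  arbitrarily, and cutting the lift down to the right degree and to the right idempotent.
\<close>

lemma FS_lift:
  assumes X: "gmod K A X" and Y: "gmod K A Y"
    and h: "h \<in> gmodule_hom A F Y" and q: "q \<in> gmodule_hom A X Y"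
    and im: "h ` carrier F \<subseteq> q ` carrier X"
  shows "\<exists>g\<in>gmodule_hom A F X. \<forall>x\<in>carrier F. q (g x) = h x"
proof -
  interpret F: gmod K A F by (rule FS_gmod)
  interpret X: gmod K A X by fact
  interpret Y: gmod K A Y by fact
  have "\<exists>y. y \<in> grade X (d s) \<and> u s \<odot>\<^bsub>X\<^esub> y = y \<and> q y = h (\<iota> s)" if s: "s \<in> I" for s
  proof -
    obtain x where x: "x \<in> carrier X" "q x = h (\<iota> s)"
      using im s by (metis imageE image_subset_iff unit_vec_unit_closed)
    let ?y = "u s \<odot>\<^bsub>X\<^esub> hcomp X (d s) x"
    have "?y \<in> grade X (d s)"
      using X.grade_smult[OF unit_grade[OF s] X.hcomp_grade[OF x(1)]] by simp
    moreover have "u s \<odot>\<^bsub>X\<^esub> ?y = ?y"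
      using X.smult_assoc[of "u s" "u s" "hcomp X (d s) x"] s x unit_idem by simp
    moreover have "q ?y = u s \<odot>\<^bsub>Y\<^esub> hcomp Y (d s) (h (\<iota> s))"
      using s x by (simp add: hom_smult[OF q] hom_hcomp[OF X Y q, symmetric])
    moreover have "u s \<odot>\<^bsub>Y\<^esub> hcomp Y (d s) (h (\<iota> s)) = h (\<iota> s)"
      using Y.hcomp_homogeneous[OF hom_grade[OF h unit_vec_grade[OF s]], of "d s"] s
        hom_smult[OF h, of "u s" "\<iota> s"] unit_vec_idem[OF s] by simp
    ultimately show ?thesis by metis
  qed
  then obtain m where m: "\<And>s. s \<in> I \<Longrightarrow> m s \<in> grade X (d s)"
    "\<And>s. s \<in> I \<Longrightarrow> u s \<odot>\<^bsub>X\<^esub> m s = m s" "\<And>s. s \<in> I \<Longrightarrow> q (m s) = h (\<iota> s)"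
    by metis
  obtain g where g: "g \<in> gmodule_hom A F X" "\<forall>s\<in>I. g (\<iota> s) = m s"
    using FS_universal[OF X m(1,2)] by blast
  have "q (g x) = h x" if "x \<in> carrier F" for x
    by (rule hom_FS_unique[OF Y hom_comp[OF g(1) q] h _ that]) (use g(2) m(3) in auto)
  then show ?thesis using g(1) by blast
qed

end

text \<open>
  A map on a direct summand of a graded free module extends by the retraction to the free module,
  where it can be lifted on the basis.
\<close>

lemma (in graded_algebra) graded_projective_lift:
  fixes P :: "('a, 'p) gmodule"
  assumes P: "graded_projective A P" and X: "gmod K A X" and Y: "gmod K A Y"
    and h: "h \<in> gmodule_hom A P Y" and q: "q \<in> gmodule_hom A X Y"
    and im: "h ` carrier P \<subseteq> q ` carrier X"
  shows "\<exists>g\<in>gmodule_hom A P X. \<forall>x\<in>carrier P. q (g x) = h x"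
proof -
  obtain I :: "'p set" and d f g where
    f: "f \<in> gmodule_hom A P (direct_sum I (\<lambda>b. shift (left_ideal_module A (carrier A)) (d b)))"
    and g: "g \<in> gmodule_hom A (direct_sum I (\<lambda>b. shift (left_ideal_module A (carrier A)) (d b))) P"
    and gf: "\<forall>x\<in>carrier P. g (f x) = x"
    using P[unfolded graded_projective_def Let_def] by (elim exE bexE) (rule that)
  have "{a \<otimes>\<^bsub>A\<^esub> \<one>\<^bsub>A\<^esub> | a. a \<in> carrier A} = (\<lambda>a. a \<otimes>\<^bsub>A\<^esub> \<one>\<^bsub>A\<^esub>) ` carrier A" by blast
  also have "\<dots> = carrier A" by simp
  finally have "{a \<otimes>\<^bsub>A\<^esub> \<one>\<^bsub>A\<^esub> | a. a \<in> carrier A} = carrier A" .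
  then have eq: "direct_sum I (\<lambda>b. shift (left_ideal_module A (carrier A)) (d b)) = FS A I (\<lambda>_. \<one>\<^bsub>A\<^esub>) d"
    by (simp add: FS_def)
  interpret F: principal_family K A I "\<lambda>_. \<one>\<^bsub>A\<^esub>" d
    by unfold_locales (simp_all add: grade_one)
  have f': "f \<in> gmodule_hom A P F.F" and g': "g \<in> gmodule_hom A F.F P"
    using f g by (simp_all only: eq)
  have "(\<lambda>x. h (g x)) ` carrier F.F \<subseteq> q ` carrier X"
  proof
    fix y assume "y \<in> (\<lambda>x. h (g x)) ` carrier F.F"
    then obtain x where x: "x \<in> carrier F.F" "y = h (g x)" by (elim imageE)
    then have "h (g x) \<in> h ` carrier P" by (intro imageI hom_closed[OF g'])
    then show "y \<in> q ` carrier X" unfolding x(2) by (rule subsetD[OF im])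
  qed
  from F.FS_lift[OF X Y hom_comp[OF g' h] q this]
  obtain l where l: "l \<in> gmodule_hom A F.F X" "\<forall>x\<in>carrier F.F. q (l x) = h (g x)"
    by (elim bexE)
  have "q (l (f x)) = h x" if x: "x \<in> carrier P" for x
  proof -
    have "q (l (f x)) = h (g (f x))" using l(2) hom_closed[OF f' x] by (rule bspec)
    also have "g (f x) = x" using gf x by (rule bspec)
    finally show ?thesis .
  qed
  then show ?thesis by (intro bexI[OF _ hom_comp[OF f' l(1)]] ballI)
qed

section \<open>Submodules and graded Nakayama\<close>

lemma vimage_additive_subgroup:
  assumes M: "abelian_group M" and N: "abelian_group N" and f: "additive_map M N f"
    and H: "additive_subgroup H N"
  shows "additive_subgroup {x \<in> carrier M. f x \<in> H} M"
proof -
  interpret M: abelian_group M by fact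
  show ?thesis
    by (rule M.additive_subgroupI)
      (simp_all add: additive_map_zero[OF f M N] additive_map_add[OF f]
        additive_map_uminus[OF f M N] additive_subgroup.zero_closed[OF H]
        additive_subgroup.a_closed[OF H] additive_subgroup.a_inv_closed[OF H])
qed

lemma (in abelian_group) zero_additive_subgroup: "additive_subgroup {\<zero>} G"
  by (rule additive_subgroupI) simp_all

lemma kernel_additive_subgroup:
  assumes M: "abelian_group M" and N: "abelian_group N" and f: "additive_map M N f"
  shows "additive_subgroup {x \<in> carrier M. f x = \<zero>\<^bsub>N\<^esub>} M"
  using vimage_additive_subgroup[OF M N f abelian_group.zero_additive_subgroup[OF N]] by simp

lemma image_additive_subgroup:
  assumes M: "abelian_group M" and N: "abelian_group N" and f: "additive_map M N f"
  shows "additive_subgroup (f ` carrier M) N"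
proof -
  interpret M: abelian_group M by fact
  interpret N: abelian_group N by fact
  show ?thesis
  proof (rule N.additive_subgroupI)
    show "x \<in> carrier N" if "x \<in> f ` carrier M" for x
      using that additive_map_closed[OF f] by blast
    show "\<zero>\<^bsub>N\<^esub> \<in> f ` carrier M"
      using additive_map_zero[OF f M N] M.zero_closed by (metis imageI)
    show "x \<oplus>\<^bsub>N\<^esub> y \<in> f ` carrier M" if xy: "x \<in> f ` carrier M" "y \<in> f ` carrier M" for x y
    proof -
      obtain x' y' where "x' \<in> carrier M" "y' \<in> carrier M" "x = f x'" "y = f y'" using xy by blast
      then show ?thesis using additive_map_add[OF f, of x' y'] M.a_closed by (metis imageI)
    qed
    show "\<ominus>\<^bsub>N\<^esub> x \<in> f ` carrier M" if x: "x \<in> f ` carrier M" for x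
    proof -
      obtain x' where "x' \<in> carrier M" "x = f x'" using x by blast
      then show ?thesis using additive_map_uminus[OF f M N, of x'] M.a_inv_closed by (metis imageI)
    qed
  qed
qed

context abelian_group
begin

lemma subgroup_finsum:
  assumes H: "additive_subgroup H G" and fin: "finite T" and f: "\<And>t. t \<in> T \<Longrightarrow> f t \<in> H"
  shows "finsum G f T \<in> H"
  using fin f
proof (induction T rule: finite_induct)
  case empty
  then show ?case using additive_subgroup.zero_closed[OF H] by simp
next
  case (insert t T)
  then show ?case
    using additive_subgroup.a_Hcarr[OF H]
    by (subst finsum_insert) (auto intro!: additive_subgroup.a_closed[OF H])
qed

lemma generate_additive_subgroup:
  assumes "X \<subseteq> carrier G"
  shows "additive_subgroup (generate (add_monoid G) X) G"
proof -
  have "subgroup (generate (add_monoid G) X) (add_monoid G)"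
    using add.generate_is_subgroup[of X] assms by simp
  then show ?thesis by (rule additive_subgroup.intro)
qed

lemma generate_subset:
  assumes "X \<subseteq> H" "additive_subgroup H G"
  shows "generate (add_monoid G) X \<subseteq> H"
  using add.generate_subgroup_incl[of X H] assms by (simp add: additive_subgroup_def)

lemma generate_incl: "x \<in> X \<Longrightarrow> x \<in> generate (add_monoid G) X"
  by (rule generate.incl)

end

context graded_algebra
begin

lemma hcomp_mult_left:
  assumes a: "a \<in> grade A m" and b: "b \<in> carrier A"
  shows "hcomp A n (a \<otimes>\<^bsub>A\<^esub> b) = a \<otimes>\<^bsub>A\<^esub> hcomp A (n - m) b"
proof -
  have "hcomp A (n - m + m) (a \<otimes>\<^bsub>A\<^esub> b) = a \<otimes>\<^bsub>A\<^esub> hcomp A (n - m) b"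
  proof (rule hcomp_additive_map[OF A.graded_grp_axioms A.graded_grp_axioms _ _ b])
    show "additive_map A A (\<lambda>b. a \<otimes>\<^bsub>A\<^esub> b)"
      using a A.grade_closed by (auto simp: additive_map_def A.r_distr)
    show "(\<otimes>\<^bsub>A\<^esub>) a ` grade A n \<subseteq> grade A (n + m)" for n
      using grade_mult[OF a] by (force simp: algebra_simps)
  qed
  then show ?thesis by simp
qed

lemma hcomp_neg: "n < 0 \<Longrightarrow> a \<in> carrier A \<Longrightarrow> hcomp A n a = \<zero>\<^bsub>A\<^esub>"
  using A.hcomp_grade[of a n] grade_neg[of n] by simp

lemma positive_part_least:
  assumes "additive_subgroup H A" "\<And>n. n > 0 \<Longrightarrow> grade A n \<subseteq> H"
  shows "positive_part A \<subseteq> H"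
  unfolding positive_part_def using assms by (intro A.generate_subset) auto

text \<open>
  An algebra without elements of negative degree is the sum of its degree zero component and its
  positive part.
\<close>

lemma positive_part_iff: "a \<in> positive_part A \<longleftrightarrow> a \<in> carrier A \<and> hcomp A 0 a = \<zero>\<^bsub>A\<^esub>"
proof
  have "positive_part A \<subseteq> {a \<in> carrier A. hcomp A 0 a = \<zero>\<^bsub>A\<^esub>}"
  proof (rule positive_part_least)
    show "additive_subgroup {a \<in> carrier A. hcomp A 0 a = \<zero>\<^bsub>A\<^esub>} A"
      by (rule kernel_additive_subgroup[OF A.abelian_group_axioms A.abelian_group_axioms
        A.additive_map_hcomp])
    show "grade A n \<subseteq> {a \<in> carrier A. hcomp A 0 a = \<zero>\<^bsub>A\<^esub>}" if "n > 0" for n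
      using that A.grade_closed A.hcomp_homogeneous[of _ n 0] by auto
  qed
  then show "a \<in> positive_part A \<Longrightarrow> a \<in> carrier A \<and> hcomp A 0 a = \<zero>\<^bsub>A\<^esub>" by blast
next
  assume a: "a \<in> carrier A \<and> hcomp A 0 a = \<zero>\<^bsub>A\<^esub>"
  have sub: "additive_subgroup (positive_part A) A"
    unfolding positive_part_def using A.grade_closed by (intro A.generate_additive_subgroup) auto
  have "hcomp A n a \<in> positive_part A" if "hcomp A n a \<noteq> \<zero>\<^bsub>A\<^esub>" for n
  proof -
    have "n > 0" using that a hcomp_neg by (metis linorder_neqE_linordered_idom)
    then show ?thesis
      using A.hcomp_grade[of a n] a unfolding positive_part_def by (intro A.generate_incl) auto
  qed
  then have "(\<Oplus>\<^bsub>A\<^esub>n\<in>{n. hcomp A n a \<noteq> \<zero>\<^bsub>A\<^esub>}. hcomp A n a) \<in> positive_part A"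
    using A.hcomp_finite a by (intro A.subgroup_finsum[OF sub]) auto
  then show "a \<in> positive_part A" using A.hcomp_sum a by metis
qed

lemma hcomp_0_mult:
  assumes a: "a \<in> positive_part A" and b: "b \<in> carrier A"
  shows "hcomp A 0 (a \<otimes>\<^bsub>A\<^esub> b) = \<zero>\<^bsub>A\<^esub>"
proof -
  have m: "additive_map A A (\<lambda>a. hcomp A 0 (a \<otimes>\<^bsub>A\<^esub> b))"
    using b by (auto simp: additive_map_def A.l_distr A.hcomp_add)
  have "positive_part A \<subseteq> {a \<in> carrier A. hcomp A 0 (a \<otimes>\<^bsub>A\<^esub> b) = \<zero>\<^bsub>A\<^esub>}"
  proof (rule positive_part_least)
    show "additive_subgroup {a \<in> carrier A. hcomp A 0 (a \<otimes>\<^bsub>A\<^esub> b) = \<zero>\<^bsub>A\<^esub>} A"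
      by (rule kernel_additive_subgroup[OF A.abelian_group_axioms A.abelian_group_axioms m])
    show "grade A n \<subseteq> {a \<in> carrier A. hcomp A 0 (a \<otimes>\<^bsub>A\<^esub> b) = \<zero>\<^bsub>A\<^esub>}" if "n > 0" for n
      using that A.grade_closed b by (auto simp: hcomp_mult_left hcomp_neg)
  qed
  then show ?thesis using a by blast
qed

lemma positive_part_mult_subgroup:
  assumes "gmod K A M"
  shows "additive_subgroup (positive_part_mult A M) M"
proof -
  interpret M: gmod K A M by fact
  show ?thesis
    unfolding positive_part_mult_def
    by (intro M.generate_additive_subgroup) (auto simp: positive_part_iff)
qed

lemma positive_part_mult_incl:
  assumes "gmod K A M" "a \<in> positive_part A" "x \<in> carrier M"
  shows "a \<odot>\<^bsub>M\<^esub> x \<in> positive_part_mult A M"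
proof -
  interpret M: gmod K A M by fact
  show ?thesis
    unfolding positive_part_mult_def using assms(2,3) by (intro M.generate_incl) blast
qed

lemma positive_part_mult_least:
  assumes "gmod K A M" "additive_subgroup H M"
    and "\<And>a x. \<lbrakk>a \<in> positive_part A; x \<in> carrier M\<rbrakk> \<Longrightarrow> a \<odot>\<^bsub>M\<^esub> x \<in> H"
  shows "positive_part_mult A M \<subseteq> H"
proof -
  interpret M: gmod K A M by fact
  show ?thesis
    unfolding positive_part_mult_def using assms(2,3) by (intro M.generate_subset) auto
qed

lemma positive_part_mult_closed:
  "gmod K A M \<Longrightarrow> x \<in> positive_part_mult A M \<Longrightarrow> x \<in> carrier M"
  by (rule additive_subgroup.a_Hcarr[OF positive_part_mult_subgroup])

text \<open>
  Homomorphisms are linear, so they carry \<open>J M\<close> into \<open>J N\<close>. This is how minimality is transported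
  along isomorphisms, and how it is exploited in the comparison of resolutions.
\<close>

lemma hom_positive_part_mult:
  assumes M: "gmod K A M" and N: "gmod K A N" and f: "f \<in> gmodule_hom A M N"
    and x: "x \<in> positive_part_mult A M"
  shows "f x \<in> positive_part_mult A N"
proof -
  interpret M: gmod K A M by fact
  interpret N: gmod K A N by fact
  have "positive_part_mult A M \<subseteq> {x \<in> carrier M. f x \<in> positive_part_mult A N}"
  proof (rule positive_part_mult_least[OF M])
    show "additive_subgroup {x \<in> carrier M. f x \<in> positive_part_mult A N} M"
      by (rule vimage_additive_subgroup[OF M.abelian_group_axioms N.abelian_group_axioms
        hom_additive[OF f] positive_part_mult_subgroup[OF N]])
    fix a x assume a: "a \<in> positive_part A" and x: "x \<in> carrier M"
    then have "a \<in> carrier A" by (simp add: positive_part_iff)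
    then show "a \<odot>\<^bsub>M\<^esub> x \<in> {x \<in> carrier M. f x \<in> positive_part_mult A N}"
      using positive_part_mult_incl[OF N a hom_closed[OF f x]] x by (simp add: hom_smult[OF f])
  qed
  then show ?thesis using x by blast
qed

text \<open>
  Graded Nakayama: by induction on the degree \<^term>\<open>n\<close>, the component of degree \<^term>\<open>n\<close> of an
  element of \<^term>\<open>positive_part_mult A M\<close> only involves elements of \<^term>\<open>M\<close> of smaller degree.
\<close>

lemma graded_nakayama:
  assumes M: "gmod K A M" and bound: "\<And>n. n < n0 \<Longrightarrow> grade M n = {\<zero>\<^bsub>M\<^esub>}"
    and H: "additive_subgroup H M"
    and smult: "\<And>a x. \<lbrakk>a \<in> carrier A; x \<in> H\<rbrakk> \<Longrightarrow> a \<odot>\<^bsub>M\<^esub> x \<in> H"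
    and hom: "\<And>n x. x \<in> H \<Longrightarrow> hcomp M n x \<in> H"
    and gen: "\<And>x. x \<in> carrier M \<Longrightarrow> \<exists>h\<in>H. \<exists>y\<in>positive_part_mult A M. x = h \<oplus>\<^bsub>M\<^esub> y"
  shows "carrier M \<subseteq> H"
proof -
  interpret M: gmod K A M by fact
  have Hc: "x \<in> H \<Longrightarrow> x \<in> carrier M" for x by (rule additive_subgroup.a_Hcarr[OF H])
  have grade: "grade M n \<subseteq> H" for n
  proof (induction "nat (n - n0)" arbitrary: n rule: less_induct)
    case less
    show ?case
    proof (cases "n < n0")
      case True
      then show ?thesis using bound additive_subgroup.zero_closed[OF H] by auto
    next
      case False
      have IH: "grade M k \<subseteq> H" if "k < n" for k
      proof (cases "k < n0")
        case True
        then show ?thesis using bound additive_subgroup.zero_closed[OF H] by auto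
      next
        case False
        then show ?thesis using less[of k] that by simp
      qed
      have "positive_part_mult A M \<subseteq> {y \<in> carrier M. hcomp M n y \<in> H}"
      proof (rule positive_part_mult_least[OF M])
        show "additive_subgroup {y \<in> carrier M. hcomp M n y \<in> H} M"
          by (rule vimage_additive_subgroup[OF M.abelian_group_axioms M.abelian_group_axioms
            M.additive_map_hcomp H])
        fix a x assume a: "a \<in> positive_part A" and x: "x \<in> carrier M"
        have m: "additive_map A M (\<lambda>a. hcomp M n (a \<odot>\<^bsub>M\<^esub> x))"
          using x by (auto simp: additive_map_def M.smult_l_distr M.hcomp_add)
        have "positive_part A \<subseteq> {a \<in> carrier A. hcomp M n (a \<odot>\<^bsub>M\<^esub> x) \<in> H}"
        proof (rule positive_part_least)
          show "additive_subgroup {a \<in> carrier A. hcomp M n (a \<odot>\<^bsub>M\<^esub> x) \<in> H} A"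
            by (rule vimage_additive_subgroup[OF A.abelian_group_axioms M.abelian_group_axioms m H])
          show "grade A k \<subseteq> {a \<in> carrier A. hcomp M n (a \<odot>\<^bsub>M\<^esub> x) \<in> H}" if "k > 0" for k
            using IH[of "n - k"] that M.hcomp_grade[OF x, of "n - k"] A.grade_closed x
            by (auto simp: M.hcomp_smult intro!: smult)
        qed
        then show "a \<odot>\<^bsub>M\<^esub> x \<in> {y \<in> carrier M. hcomp M n y \<in> H}"
          using a x by (auto simp: positive_part_iff)
      qed
      note P = this
      show ?thesis
      proof
        fix x assume x: "x \<in> grade M n"
        obtain h y where hy: "h \<in> H" "y \<in> positive_part_mult A M" "x = h \<oplus>\<^bsub>M\<^esub> y"
          using gen[OF M.grade_closed[OF x]] by blast
        have "x = hcomp M n x" using M.hcomp_homogeneous[OF x] by simp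
        also have "\<dots> = hcomp M n h \<oplus>\<^bsub>M\<^esub> hcomp M n y"
          using hy positive_part_mult_closed[OF M] Hc by (simp add: M.hcomp_add)
        finally show "x \<in> H"
          using additive_subgroup.a_closed[OF H] hom[OF hy(1)] P hy(2) by auto
      qed
    qed
  qed
  show ?thesis
  proof
    fix x assume "x \<in> carrier M"
    then show "x \<in> H"
    proof (induction rule: M.homogeneous_induct)
      case (homogeneous n y)
      then show ?case using grade by blast
    next
      case (add y z)
      then show ?case using additive_subgroup.a_closed[OF H] by blast
    qed
  qed
qed

end

definition graded_submodule :: "('k, 'a) gmodule \<Rightarrow> ('a, 'm) gmodule \<Rightarrow> 'm set \<Rightarrow> bool" where
  "graded_submodule A M Z \<longleftrightarrow> additive_subgroup Z M \<and>
     (\<forall>a\<in>carrier A. \<forall>x\<in>Z. a \<odot>\<^bsub>M\<^esub> x \<in> Z) \<and> (\<forall>x\<in>Z. \<forall>n. hcomp M n x \<in> Z)"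

definition restrict_module :: "('a, 'm) gmodule \<Rightarrow> 'm set \<Rightarrow> ('a, 'm) gmodule" where
  "restrict_module M Z = M\<lparr>carrier := Z, grade := (\<lambda>n. grade M n \<inter> Z)\<rparr>"

lemma restrict_module_simps [simp]:
  "carrier (restrict_module M Z) = Z" "grade (restrict_module M Z) n = grade M n \<inter> Z"
  "x \<oplus>\<^bsub>restrict_module M Z\<^esub> y = x \<oplus>\<^bsub>M\<^esub> y" "\<zero>\<^bsub>restrict_module M Z\<^esub> = \<zero>\<^bsub>M\<^esub>"
  "a \<odot>\<^bsub>restrict_module M Z\<^esub> x = a \<odot>\<^bsub>M\<^esub> x"
  by (simp_all add: restrict_module_def)

context graded_algebra
begin

lemma graded_submodule_image:
  assumes M: "gmod K A M" and N: "gmod K A N" and f: "f \<in> gmodule_hom A M N"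
  shows "graded_submodule A N (f ` carrier M)"
proof -
  interpret M: gmod K A M by fact
  interpret N: gmod K A N by fact
  have "a \<odot>\<^bsub>N\<^esub> f x \<in> f ` carrier M" if "a \<in> carrier A" "x \<in> carrier M" for a x
    using that hom_smult[OF f that, symmetric] by auto
  moreover have "hcomp N n (f x) \<in> f ` carrier M" if "x \<in> carrier M" for n x
    using that hom_hcomp[OF M N f that] by auto
  ultimately show ?thesis
    using image_additive_subgroup[OF M.abelian_group_axioms N.abelian_group_axioms
      hom_additive[OF f]] by (auto simp: graded_submodule_def)
qed

lemma graded_submodule_kernel:
  assumes M: "gmod K A M" and N: "gmod K A N" and f: "f \<in> gmodule_hom A M N"
  shows "graded_submodule A M {x \<in> carrier M. f x = \<zero>\<^bsub>N\<^esub>}"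
proof -
  interpret M: gmod K A M by fact
  interpret N: gmod K A N by fact
  have "f (hcomp M n x) = \<zero>\<^bsub>N\<^esub>" if "x \<in> carrier M" "f x = \<zero>\<^bsub>N\<^esub>" for n x
    using that hom_hcomp[OF M N f that(1), symmetric] by simp
  then show ?thesis
    using kernel_additive_subgroup[OF M.abelian_group_axioms N.abelian_group_axioms
      hom_additive[OF f]] by (auto simp: graded_submodule_def hom_smult[OF f])
qed

lemma restrict_module_gmod:
  assumes M: "gmod K A M" and Z: "graded_submodule A M Z"
  shows "gmod K A (restrict_module M Z)"
    and "x \<in> Z \<Longrightarrow> hcomp (restrict_module M Z) n x = hcomp M n x"
proof -
  interpret M: gmod K A M by fact
  let ?Z = "restrict_module M Z"
  have sub: "additive_subgroup Z M" and sm: "\<And>a x. a \<in> carrier A \<Longrightarrow> x \<in> Z \<Longrightarrow> a \<odot>\<^bsub>M\<^esub> x \<in> Z"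
    and hc: "\<And>n x. x \<in> Z \<Longrightarrow> hcomp M n x \<in> Z"
    using Z by (auto simp: graded_submodule_def)
  have Zc: "x \<in> carrier M" if "x \<in> Z" for x using that by (rule additive_subgroup.a_Hcarr[OF sub])
  note Zops = additive_subgroup.zero_closed[OF sub] additive_subgroup.a_closed[OF sub]
    additive_subgroup.a_inv_closed[OF sub]
  have ab: "abelian_group ?Z"
  proof (rule abelian_groupI)
    show "\<exists>y\<in>carrier ?Z. y \<oplus>\<^bsub>?Z\<^esub> x = \<zero>\<^bsub>?Z\<^esub>" if "x \<in> carrier ?Z" for x
      using that Zops Zc by (intro bexI[of _ "\<ominus>\<^bsub>M\<^esub> x"]) (auto simp: M.l_neg)
  qed (use Zops Zc in \<open>auto simp: M.a_ac\<close>)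
  interpret Z: abelian_group ?Z by (rule ab)
  have incl: "additive_map ?Z M (\<lambda>x. x)" using Zc by (auto simp: additive_map_def)
  have sum: "finsum ?Z f T = finsum M f T" if "finite T" "f \<in> T \<rightarrow> Z" for f :: "int \<Rightarrow> _" and T
    using additive_map_finsum[OF incl ab M.abelian_group_axioms, of f T] that by simp
  have neg: "\<ominus>\<^bsub>?Z\<^esub> x = \<ominus>\<^bsub>M\<^esub> x" if "x \<in> Z" for x
    using additive_map_uminus[OF incl ab M.abelian_group_axioms, of x] that by simp
  have sub': "additive_subgroup (grade ?Z n) ?Z" for n
    by (rule Z.additive_subgroupI)
      (use Zops neg in \<open>auto simp: M.grade_add M.grade_uminus\<close>)
  have add: "additive_map ?Z ?Z (hcomp M n)" for n
    using hc Zc by (auto simp: additive_map_def M.hcomp_add)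
  have img: "hcomp M n x \<in> grade ?Z n" if "x \<in> carrier ?Z" for n x
    using that hc Zc M.hcomp_grade by simp
  have hom: "hcomp M n x = (if n = m then x else \<zero>\<^bsub>?Z\<^esub>)" if "x \<in> grade ?Z m" for n m x
    using that M.hcomp_homogeneous[of x m n] by simp
  have fin: "finite {n. hcomp M n x \<noteq> \<zero>\<^bsub>?Z\<^esub>}" if "x \<in> carrier ?Z" for x
    using that M.hcomp_finite Zc by simp
  have dec: "x = (\<Oplus>\<^bsub>?Z\<^esub>n\<in>{n. hcomp M n x \<noteq> \<zero>\<^bsub>?Z\<^esub>}. hcomp M n x)" if x: "x \<in> carrier ?Z" for x
  proof -
    have "(\<Oplus>\<^bsub>?Z\<^esub>n\<in>{n. hcomp M n x \<noteq> \<zero>\<^bsub>M\<^esub>}. hcomp M n x) = (\<Oplus>\<^bsub>M\<^esub>n\<in>{n. hcomp M n x \<noteq> \<zero>\<^bsub>M\<^esub>}. hcomp M n x)"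
      using x hc M.hcomp_finite Zc by (intro sum) auto
    then show ?thesis using M.hcomp_sum[of x] Zc x by simp
  qed
  note gp = graded_group_by_projections[where p = "hcomp M", OF ab sub' add img hom fin dec]
  show "gmod K A ?Z"
  proof (rule gmodI)
    show "left_module A ?Z"
      by (rule left_module.intro[OF ring ab])
        (use sm Zc in \<open>auto simp: M.smult_l_distr M.smult_r_distr M.smult_assoc\<close>)
    show "graded_group ?Z" by (rule graded_grp.graded) (rule gp(1))
    show "a \<odot>\<^bsub>?Z\<^esub> x \<in> grade ?Z (m + n)" if "a \<in> grade A m" "x \<in> grade ?Z n" for m n a x
      using that M.grade_smult sm A.grade_closed by simp
  qed
  show "x \<in> Z \<Longrightarrow> hcomp ?Z n x = hcomp M n x" using gp(2)[of x n] by simp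
qed

end

text \<open>
  The generators span \<open>F\<close> over \<open>A\<close>, and \<open>J\<close> is a two-sided ideal; hence \<open>J F\<close> is described by its
  coordinates.
\<close>

lemma (in principal_family) positive_part_mult_FS:
  "x \<in> positive_part_mult A F \<longleftrightarrow> x \<in> carrier F \<and> (\<forall>s\<in>I. hcomp A 0 (x s) = \<zero>\<^bsub>A\<^esub>)"
proof
  interpret F: gmod K A F by (rule FS_gmod)
  have inv: "(\<ominus>\<^bsub>F\<^esub> x) s = \<ominus>\<^bsub>A\<^esub> x s" if "x \<in> carrier F" "s \<in> I" for x s
    using additive_map_uminus[OF FS_coordinate_additive FS_abelian_group A.abelian_group_axioms]
      that by blast
  have "positive_part_mult A F \<subseteq> {x \<in> carrier F. \<forall>s\<in>I. hcomp A 0 (x s) = \<zero>\<^bsub>A\<^esub>}"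
  proof (rule positive_part_mult_least[OF FS_gmod])
    show "additive_subgroup {x \<in> carrier F. \<forall>s\<in>I. hcomp A 0 (x s) = \<zero>\<^bsub>A\<^esub>} F"
    proof (rule F.additive_subgroupI)
      show "\<zero>\<^bsub>F\<^esub> \<in> {x \<in> carrier F. \<forall>s\<in>I. hcomp A 0 (x s) = \<zero>\<^bsub>A\<^esub>}"
        using F.zero_closed by (simp add: FS_zero)
      fix x y assume "x \<in> {x \<in> carrier F. \<forall>s\<in>I. hcomp A 0 (x s) = \<zero>\<^bsub>A\<^esub>}"
        "y \<in> {x \<in> carrier F. \<forall>s\<in>I. hcomp A 0 (x s) = \<zero>\<^bsub>A\<^esub>}"
      then show "x \<oplus>\<^bsub>F\<^esub> y \<in> {x \<in> carrier F. \<forall>s\<in>I. hcomp A 0 (x s) = \<zero>\<^bsub>A\<^esub>}"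
        using FS_add_closed[of x y] by (simp add: FS_add A.hcomp_add)
    qed (simp_all add: inv A.hcomp_uminus)
    fix a x assume "a \<in> positive_part A" "x \<in> carrier F"
    then show "a \<odot>\<^bsub>F\<^esub> x \<in> {x \<in> carrier F. \<forall>s\<in>I. hcomp A 0 (x s) = \<zero>\<^bsub>A\<^esub>}"
      by (auto simp: positive_part_iff intro!: FS_smult_closed) (simp add: FS_smult hcomp_0_mult positive_part_iff)
  qed
  then show "x \<in> positive_part_mult A F \<Longrightarrow> x \<in> carrier F \<and> (\<forall>s\<in>I. hcomp A 0 (x s) = \<zero>\<^bsub>A\<^esub>)"
    by blast
  assume x: "x \<in> carrier F \<and> (\<forall>s\<in>I. hcomp A 0 (x s) = \<zero>\<^bsub>A\<^esub>)"
  then have xc: "x \<in> carrier F" by simp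
  let ?T = "{s\<in>I. x s \<noteq> \<zero>\<^bsub>A\<^esub>}"
  have "(\<Oplus>\<^bsub>F\<^esub>s\<in>?T. x s \<odot>\<^bsub>F\<^esub> \<iota> s) \<in> positive_part_mult A F"
    by (rule F.subgroup_finsum[OF positive_part_mult_subgroup[OF FS_gmod] FS_finite[OF xc]],
        rule positive_part_mult_incl[OF FS_gmod])
      (use x in \<open>auto simp: positive_part_iff\<close>)
  moreover have "x = (\<Oplus>\<^bsub>F\<^esub>s\<in>?T. x s \<odot>\<^bsub>F\<^esub> \<iota> s)"
    by (rule FS_decompose[OF xc FS_finite[OF xc]]) auto
  ultimately show "x \<in> positive_part_mult A F" by simp
qed

section \<open>Vertices and minimal covers\<close>

context vertex_graded_algebra
begin

lemma vertex_closed [simp]: "e i \<in> carrier A"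
  and vertex_idem [simp]: "e i \<otimes>\<^bsub>A\<^esub> e i = e i"
  and vertex_nonzero: "e i \<noteq> \<zero>\<^bsub>A\<^esub>"
  using primitive[of i] by (auto simp: primitive_idempotent_def)

lemma one_nonzero: "\<one>\<^bsub>A\<^esub> \<noteq> \<zero>\<^bsub>A\<^esub>"
  using vertex_nonzero vertex_closed A.l_one A.l_null by metis

lemma A_smult_closed [simp]: "c \<in> carrier K \<Longrightarrow> a \<in> carrier A \<Longrightarrow> c \<odot>\<^bsub>A\<^esub> a \<in> carrier A"
  using module by (rule module.smult_closed)

lemma A_smult_one [simp]: "a \<in> carrier A \<Longrightarrow> \<one>\<^bsub>K\<^esub> \<odot>\<^bsub>A\<^esub> a = a"
  using module by (rule module.smult_one)

lemma A_smult_assoc: "\<lbrakk>c \<in> carrier K; b \<in> carrier K; a \<in> carrier A\<rbrakk> \<Longrightarrow>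
    (c \<otimes>\<^bsub>K\<^esub> b) \<odot>\<^bsub>A\<^esub> a = c \<odot>\<^bsub>A\<^esub> (b \<odot>\<^bsub>A\<^esub> a)"
  using module by (rule module.smult_assoc1)

lemma A_smult_zero [simp]: "a \<in> carrier A \<Longrightarrow> \<zero>\<^bsub>K\<^esub> \<odot>\<^bsub>A\<^esub> a = \<zero>\<^bsub>A\<^esub>"
  using module.smult_l_null[OF module] .

lemma scalar_closed [simp]: "c \<in> carrier K \<Longrightarrow> c \<odot>\<^bsub>A\<^esub> \<one>\<^bsub>A\<^esub> \<in> carrier A"
  by simp

lemma scalar_mult: "c \<in> carrier K \<Longrightarrow> a \<in> carrier A \<Longrightarrow> (c \<odot>\<^bsub>A\<^esub> \<one>\<^bsub>A\<^esub>) \<otimes>\<^bsub>A\<^esub> a = c \<odot>\<^bsub>A\<^esub> a"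
  by (simp add: smult_mult_left)

lemma grade_A_smult: "c \<in> carrier K \<Longrightarrow> a \<in> grade A n \<Longrightarrow> c \<odot>\<^bsub>A\<^esub> a \<in> grade A n"
  using graded_space by (simp add: graded_space_def)

lemma grade_0_expand:
  assumes "x \<in> grade A 0"
  obtains c where "\<And>i. c i \<in> carrier K" "x = (\<Oplus>\<^bsub>A\<^esub> i\<in>UNIV. c i \<odot>\<^bsub>A\<^esub> e i)"
  using grade_0_direct_sum[OF assms] by blast

lemma expand_mult_vertex:
  assumes c: "\<And>i. c i \<in> carrier K"
  shows "(\<Oplus>\<^bsub>A\<^esub> i\<in>UNIV. c i \<odot>\<^bsub>A\<^esub> e i) \<otimes>\<^bsub>A\<^esub> e j = c j \<odot>\<^bsub>A\<^esub> e j"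
    and "e j \<otimes>\<^bsub>A\<^esub> (\<Oplus>\<^bsub>A\<^esub> i\<in>UNIV. c i \<odot>\<^bsub>A\<^esub> e i) = c j \<odot>\<^bsub>A\<^esub> e j"
proof -
  have r: "additive_map A A (\<lambda>a. a \<otimes>\<^bsub>A\<^esub> e j)" and l: "additive_map A A (\<lambda>a. e j \<otimes>\<^bsub>A\<^esub> a)"
    by (auto simp: additive_map_def A.l_distr A.r_distr)
  have cc: "(\<lambda>i. c i \<odot>\<^bsub>A\<^esub> e i) \<in> UNIV \<rightarrow> carrier A" using c by simp
  have *: "(c i \<odot>\<^bsub>A\<^esub> e i) \<otimes>\<^bsub>A\<^esub> e j = (if i = j then c j \<odot>\<^bsub>A\<^esub> e j else \<zero>\<^bsub>A\<^esub>)"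
    "e j \<otimes>\<^bsub>A\<^esub> (c i \<odot>\<^bsub>A\<^esub> e i) = (if i = j then c j \<odot>\<^bsub>A\<^esub> e j else \<zero>\<^bsub>A\<^esub>)" for i
    using c orthogonal module.smult_r_null[OF module c]
    by (auto simp: smult_mult_left smult_mult_right)
  have "(\<Oplus>\<^bsub>A\<^esub> i\<in>UNIV. c i \<odot>\<^bsub>A\<^esub> e i) \<otimes>\<^bsub>A\<^esub> e j = (\<Oplus>\<^bsub>A\<^esub> i\<in>UNIV. if i = j then c j \<odot>\<^bsub>A\<^esub> e j else \<zero>\<^bsub>A\<^esub>)"
    using additive_map_finsum[OF r A.abelian_group_axioms A.abelian_group_axioms cc] * by simp
  then show "(\<Oplus>\<^bsub>A\<^esub> i\<in>UNIV. c i \<odot>\<^bsub>A\<^esub> e i) \<otimes>\<^bsub>A\<^esub> e j = c j \<odot>\<^bsub>A\<^esub> e j"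
    using A.finsum_single[of UNIV j "\<lambda>i. if i = j then c j \<odot>\<^bsub>A\<^esub> e j else \<zero>\<^bsub>A\<^esub>"] c by simp
  have "e j \<otimes>\<^bsub>A\<^esub> (\<Oplus>\<^bsub>A\<^esub> i\<in>UNIV. c i \<odot>\<^bsub>A\<^esub> e i) = (\<Oplus>\<^bsub>A\<^esub> i\<in>UNIV. if i = j then c j \<odot>\<^bsub>A\<^esub> e j else \<zero>\<^bsub>A\<^esub>)"
    using additive_map_finsum[OF l A.abelian_group_axioms A.abelian_group_axioms cc] * by simp
  then show "e j \<otimes>\<^bsub>A\<^esub> (\<Oplus>\<^bsub>A\<^esub> i\<in>UNIV. c i \<odot>\<^bsub>A\<^esub> e i) = c j \<odot>\<^bsub>A\<^esub> e j"
    using A.finsum_single[of UNIV j "\<lambda>i. if i = j then c j \<odot>\<^bsub>A\<^esub> e j else \<zero>\<^bsub>A\<^esub>"] c by simp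
qed

lemma sum_vertices: "(\<Oplus>\<^bsub>A\<^esub> i\<in>UNIV. e i) = \<one>\<^bsub>A\<^esub>"
proof -
  obtain c where c: "\<And>i. c i \<in> carrier K" "\<one>\<^bsub>A\<^esub> = (\<Oplus>\<^bsub>A\<^esub> i\<in>UNIV. c i \<odot>\<^bsub>A\<^esub> e i)"
    using grade_0_expand[OF grade_one] by blast
  have "\<one>\<^bsub>A\<^esub> \<otimes>\<^bsub>A\<^esub> e j = c j \<odot>\<^bsub>A\<^esub> e j" for j
    unfolding c(2) using c(1) by (rule expand_mult_vertex(1))
  then have "c j \<odot>\<^bsub>A\<^esub> e j = e j" for j by simp
  then show ?thesis unfolding c(2) by simp
qed

lemma grade_0_vertex:
  assumes z: "z \<in> grade A 0" and ze: "z \<otimes>\<^bsub>A\<^esub> e j = z"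
  obtains c where "c \<in> carrier K" "z = c \<odot>\<^bsub>A\<^esub> e j"
proof -
  obtain c where c: "\<And>i. c i \<in> carrier K" "z = (\<Oplus>\<^bsub>A\<^esub> i\<in>UNIV. c i \<odot>\<^bsub>A\<^esub> e i)"
    using grade_0_expand[OF z] by blast
  have "z = c j \<odot>\<^bsub>A\<^esub> e j" using expand_mult_vertex(1)[where c = c and j = j, OF c(1)] c(2) ze by simp
  then show thesis using that c(1) by blast
qed

lemma std_family: "principal_family K A I (\<lambda>s. e (c s))"
  by unfold_locales (simp_all add: vertex_in_grade_0)

lemma module_vertex_decompose:
  assumes M: "gmod K A M" and x: "x \<in> carrier M"
  shows "x = (\<Oplus>\<^bsub>M\<^esub> i\<in>UNIV. e i \<odot>\<^bsub>M\<^esub> x)"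
proof -
  interpret M: gmod K A M by fact
  have "x = (\<Oplus>\<^bsub>A\<^esub> i\<in>UNIV. e i) \<odot>\<^bsub>M\<^esub> x" using sum_vertices x by simp
  also have "\<dots> = (\<Oplus>\<^bsub>M\<^esub> i\<in>UNIV. e i \<odot>\<^bsub>M\<^esub> x)"
    by (rule additive_map_finsum[OF M.additive_map_scalar[OF x] A.abelian_group_axioms
      M.abelian_group_axioms]) simp_all
  finally show ?thesis .
qed

text \<open>
  A finite generating set can be refined to one that consists of the nonzero components of its
  elements, multiplied by the vertices; no element is lost since the vertices add up to one.
\<close>

lemma finitely_generated_cover:
  assumes M: "gmod K A M" and fg: "finitely_generated A M"
  shows "\<exists>(I :: nat set) c d. \<exists>h\<in>gmodule_hom A (FS A I (\<lambda>s. e (c s)) d) M. finite I \<and>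
    h ` carrier (FS A I (\<lambda>s. e (c s)) d) = carrier M"
proof -
  interpret M: gmod K A M by fact
  obtain S where S: "finite S" "S \<subseteq> carrier M"
    "carrier M = generate (add_monoid M) {a \<odot>\<^bsub>M\<^esub> s | a s. a \<in> carrier A \<and> s \<in> S}"
    using fg unfolding finitely_generated_def by blast
  define T where "T = (SIGMA s:S. {n. hcomp M n s \<noteq> \<zero>\<^bsub>M\<^esub>} \<times> (UNIV :: 'r set))"
  have T: "finite T"
    unfolding T_def using S M.hcomp_finite by (intro finite_SigmaI finite_cartesian_product) auto
  then obtain b where b: "bij_betw b {0..<card T} T" using ex_bij_betw_nat_finite by blast
  define I where "I = {0..<card T}"
  define c d where "c t = snd (snd (b t))" and "d t = fst (snd (b t))" for t
  define m where "m t = e (c t) \<odot>\<^bsub>M\<^esub> hcomp M (d t) (fst (b t))" for t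
  have bT: "b t \<in> T" "fst (b t) \<in> S" if "t \<in> I" for t
  proof -
    show "b t \<in> T" using b that unfolding I_def by (meson bij_betwE)
    then show "fst (b t) \<in> S" unfolding T_def by auto
  qed
  interpret F: principal_family K A I "\<lambda>s. e (c s)" d by (rule std_family)
  have mg: "m t \<in> grade M (d t)" if "t \<in> I" for t
    using M.grade_smult[OF vertex_in_grade_0 M.hcomp_grade[OF subsetD[OF S(2) bT(2)[OF that]]],
      of "c t" "d t"] by (simp add: m_def)
  have em: "e (c t) \<odot>\<^bsub>M\<^esub> m t = m t" if "t \<in> I" for t
    using M.smult_assoc[of "e (c t)" "e (c t)"] bT(2)[OF that] S(2)
    unfolding m_def by (simp add: subset_iff)
  obtain h where h: "h \<in> gmodule_hom A F.F M" "\<forall>t\<in>I. h (unit_vec A I t (e (c t))) = m t"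
    using F.FS_universal[OF M mg em] by blast
  let ?H = "h ` carrier F.F"
  have H: "additive_subgroup ?H M" and Hs: "\<And>a x. a \<in> carrier A \<Longrightarrow> x \<in> ?H \<Longrightarrow> a \<odot>\<^bsub>M\<^esub> x \<in> ?H"
    using graded_submodule_image[OF F.FS_gmod M h(1)] by (auto simp: graded_submodule_def)
  have gen: "e i \<odot>\<^bsub>M\<^esub> hcomp M n s \<in> ?H" if s: "s \<in> S" and nz: "hcomp M n s \<noteq> \<zero>\<^bsub>M\<^esub>" for s n i
  proof -
    have "(s, n, i) \<in> T" using s nz by (simp add: T_def)
    then obtain t where t: "t \<in> I" "b t = (s, n, i)"
      using b unfolding I_def bij_betw_def by (metis imageE)
    then have "m t = e i \<odot>\<^bsub>M\<^esub> hcomp M n s" by (simp add: m_def c_def d_def)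
    then show ?thesis using h(2) t(1) F.unit_vec_unit_closed[OF t(1)] by (metis imageI)
  qed
  have "s \<in> ?H" if s: "s \<in> S" for s
  proof -
    have sc: "s \<in> carrier M" using s S by blast
    have "hcomp M n s \<in> ?H" if "hcomp M n s \<noteq> \<zero>\<^bsub>M\<^esub>" for n
      using module_vertex_decompose[OF M M.hcomp_closed[OF sc]]
        M.subgroup_finsum[OF H, of UNIV "\<lambda>i. e i \<odot>\<^bsub>M\<^esub> hcomp M n s"] gen[OF s that] by simp
    then show ?thesis
      using M.hcomp_sum[OF sc] M.subgroup_finsum[OF H M.hcomp_finite[OF sc], of "\<lambda>n. hcomp M n s"]
      by simp
  qed
  then have "generate (add_monoid M) {a \<odot>\<^bsub>M\<^esub> s | a s. a \<in> carrier A \<and> s \<in> S} \<subseteq> ?H"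
    using Hs by (intro M.generate_subset[OF _ H]) auto
  then have "?H = carrier M" using S(3) hom_closed[OF h(1)] by blast
  moreover have "finite I" by (simp add: I_def)
  ultimately show ?thesis using h(1) by blast
qed

text \<open>
  A cover with the least number of generators is minimal: a kernel element outside
  \<^term>\<open>positive_part_mult A F\<close> has, after cutting down to a suitable degree, a coordinate which
  is a nonzero multiple of a vertex, and so expresses one generator through the others.
\<close>

lemma minimal_cover:
  assumes M: "gmod K A M"
    and ex: "\<exists>(I :: nat set) c d. \<exists>h\<in>gmodule_hom A (FS A I (\<lambda>s. e (c s)) d) M. finite I \<and>
      h ` carrier (FS A I (\<lambda>s. e (c s)) d) = carrier M"
  shows "\<exists>(I :: nat set) c d. \<exists>h\<in>gmodule_hom A (FS A I (\<lambda>s. e (c s)) d) M. finite I \<and>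
      h ` carrier (FS A I (\<lambda>s. e (c s)) d) = carrier M \<and>
      (\<forall>x\<in>carrier (FS A I (\<lambda>s. e (c s)) d). h x = \<zero>\<^bsub>M\<^esub> \<longrightarrow>
         x \<in> positive_part_mult A (FS A I (\<lambda>s. e (c s)) d))"
proof -
  interpret M: gmod K A M by fact
  define cov where "cov I \<longleftrightarrow> finite I \<and> (\<exists>c d. \<exists>h\<in>gmodule_hom A (FS A I (\<lambda>s. e (c s)) d) M.
      h ` carrier (FS A I (\<lambda>s. e (c s)) d) = carrier M)" for I :: "nat set"
  have "\<exists>I. cov I" using ex unfolding cov_def by blast
  then obtain I where I: "cov I" and least: "\<And>J. cov J \<Longrightarrow> card I \<le> card J"
    using ex_has_least_nat[of cov _ card] by blast
  then have finI: "finite I" by (simp add: cov_def)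
  obtain c d h where h: "h \<in> gmodule_hom A (FS A I (\<lambda>s. e (c s)) d) M"
    "h ` carrier (FS A I (\<lambda>s. e (c s)) d) = carrier M"
    using I unfolding cov_def by blast
  interpret F: principal_family K A I "\<lambda>s. e (c s)" d by (rule std_family)
  interpret FM: gmod K A F.F by (rule F.FS_gmod)
  have "x \<in> positive_part_mult A F.F" if x: "x \<in> carrier F.F" and hx: "h x = \<zero>\<^bsub>M\<^esub>" for x
  proof (rule ccontr)
    assume "x \<notin> positive_part_mult A F.F"
    then obtain s0 where s0: "s0 \<in> I" "hcomp A 0 (x s0) \<noteq> \<zero>\<^bsub>A\<^esub>"
      using F.positive_part_mult_FS x by blast
    have "hcomp A 0 (x s0) \<otimes>\<^bsub>A\<^esub> e (c s0) = hcomp A 0 (x s0)"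
      by (rule F.unit_hcomp) (use x s0 in simp_all)
    then obtain l where l: "l \<in> carrier K" "hcomp A 0 (x s0) = l \<odot>\<^bsub>A\<^esub> e (c s0)"
      using grade_0_vertex[OF A.hcomp_grade] x s0 by (metis F.FS_closed)
    have "l \<noteq> \<zero>\<^bsub>K\<^esub>" using l s0(2) by auto
    then have l': "inv\<^bsub>K\<^esub> l \<in> carrier K" "l \<otimes>\<^bsub>K\<^esub> inv\<^bsub>K\<^esub> l = \<one>\<^bsub>K\<^esub>"
      using l(1) K.field_Units by auto
    \<comment> \<open>Cut \<^term>\<open>x\<close> down to the degree of the generator at \<^term>\<open>s0\<close> and normalise its coordinate there.\<close>
    define y where "y = (inv\<^bsub>K\<^esub> l \<odot>\<^bsub>A\<^esub> e (c s0)) \<odot>\<^bsub>F.F\<^esub> hcomp F.F (d s0) x"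
    have yc: "y \<in> carrier F.F" unfolding y_def using l' x by simp
    have "y s0 = (inv\<^bsub>K\<^esub> l \<odot>\<^bsub>A\<^esub> e (c s0)) \<otimes>\<^bsub>A\<^esub> (l \<odot>\<^bsub>A\<^esub> e (c s0))"
      unfolding y_def using s0 l(2) by (simp add: F.FS_smult F.FS_hcomp[OF x])
    also have "\<dots> = e (c s0)"
      using l l' by (simp add: smult_mult_left smult_mult_right A_smult_assoc[symmetric])
    finally have ys0: "y s0 = e (c s0)" .
    have "h y = \<zero>\<^bsub>M\<^esub>"
      unfolding y_def using l' x hx by (simp add: hom_smult[OF h(1)] hom_hcomp[OF F.FS_gmod M h(1), symmetric])
    let ?J = "I - {s0}"
    interpret F': principal_family K A ?J "\<lambda>s. e (c s)" d by (rule std_family)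
    let ?m = "\<lambda>s. h (unit_vec A I s (e (c s)))"
    have mc: "?m s \<in> carrier M" if "s \<in> I" for s using hom_closed[OF h(1)] that by simp
    have em: "e (c s) \<odot>\<^bsub>M\<^esub> ?m s = ?m s" if "s \<in> I" for s
      using F.unit_vec_idem[OF that] hom_smult[OF h(1), of "e (c s)" "unit_vec A I s (e (c s))"] that
      by simp
    obtain h' where h': "h' \<in> gmodule_hom A F'.F M"
      "\<forall>s\<in>?J. h' (unit_vec A ?J s (e (c s))) = ?m s"
      using F'.FS_universal[OF M, of ?m] hom_grade[OF h(1) F.unit_vec_grade] em by blast
    let ?H = "h' ` carrier F'.F"
    have H: "additive_subgroup ?H M" and Hs: "\<And>a x. a \<in> carrier A \<Longrightarrow> x \<in> ?H \<Longrightarrow> a \<odot>\<^bsub>M\<^esub> x \<in> ?H"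
      using graded_submodule_image[OF F'.FS_gmod M h'(1)] by (auto simp: graded_submodule_def)
    have mJ: "?m s \<in> ?H" if "s \<in> ?J" for s
      using h'(2) that F'.unit_vec_unit_closed[OF that] by (metis imageI)
    have sumH: "(\<Oplus>\<^bsub>M\<^esub>s\<in>?J. y s \<odot>\<^bsub>M\<^esub> ?m s) \<in> ?H"
      using finI yc by (intro M.subgroup_finsum[OF H] Hs mJ) auto
    have "\<zero>\<^bsub>M\<^esub> = (\<Oplus>\<^bsub>M\<^esub>s\<in>I. y s \<odot>\<^bsub>M\<^esub> ?m s)"
      using F.hom_FS_formula[OF M h(1) yc finI] \<open>h y = \<zero>\<^bsub>M\<^esub>\<close> by simp
    also have "\<dots> = (\<Oplus>\<^bsub>M\<^esub>s\<in>insert s0 ?J. y s \<odot>\<^bsub>M\<^esub> ?m s)"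
      using s0(1) by (simp add: insert_absorb)
    also have "\<dots> = y s0 \<odot>\<^bsub>M\<^esub> ?m s0 \<oplus>\<^bsub>M\<^esub> (\<Oplus>\<^bsub>M\<^esub>s\<in>?J. y s \<odot>\<^bsub>M\<^esub> ?m s)"
      by (rule M.finsum_insert) (use finI yc mc s0 in auto)
    also have "y s0 \<odot>\<^bsub>M\<^esub> ?m s0 = ?m s0" using em s0(1) ys0 by simp
    finally have "?m s0 \<oplus>\<^bsub>M\<^esub> (\<Oplus>\<^bsub>M\<^esub>s\<in>?J. y s \<odot>\<^bsub>M\<^esub> ?m s) = \<zero>\<^bsub>M\<^esub>" by simp
    then have "?m s0 = \<ominus>\<^bsub>M\<^esub> (\<Oplus>\<^bsub>M\<^esub>s\<in>?J. y s \<odot>\<^bsub>M\<^esub> ?m s)"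
      using M.minus_equality[of "?m s0"] mc s0(1) sumH additive_subgroup.a_Hcarr[OF H] by simp
    then have "?m s0 \<in> ?H"
      using additive_subgroup.a_inv_closed[OF H sumH] by simp
    with mJ have mI: "?m s \<in> ?H" if "s \<in> I" for s using that by blast
    have "carrier M \<subseteq> ?H"
    proof
      fix z assume "z \<in> carrier M"
      then obtain w where w: "w \<in> carrier F.F" "z = h w" using h(2) by blast
      then have "z = (\<Oplus>\<^bsub>M\<^esub>s\<in>I. w s \<odot>\<^bsub>M\<^esub> ?m s)"
        using F.hom_FS_formula[OF M h(1) w(1) finI] by simp
      moreover have "\<dots> \<in> ?H"
        using finI w(1) by (intro M.subgroup_finsum[OF H] Hs mI) auto
      ultimately show "z \<in> ?H" by simp
    qed
    then have "?H = carrier M" using hom_closed[OF h'(1)] by blast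
    then have "cov ?J" using h'(1) finI unfolding cov_def by blast
    from least[OF this] show False using card_Diff1_less[OF finI s0(1)] by linarith
  qed
  then show ?thesis using h finI by blast
qed

end

section \<open>Quotients and vertex simples\<close>

lemma (in abelian_group) add_diff_cancel_middle:
  "\<lbrakk>x \<in> carrier G; y \<in> carrier G\<rbrakk> \<Longrightarrow> x \<oplus> (y \<oplus> (\<ominus> x)) = y"
  by (simp add: a_lcomm[of x y "\<ominus> x"] r_neg)

text \<open>
  Equational laws pass to the image of a structure-preserving surjection, without any prior
  knowledge of its codomain.
\<close>

lemma left_module_by_surjection:
  assumes M: "left_module A M" and im: "carrier S = f ` carrier M" and zero: "\<zero>\<^bsub>S\<^esub> = f \<zero>\<^bsub>M\<^esub>"
    and add: "\<And>x y. \<lbrakk>x \<in> carrier M; y \<in> carrier M\<rbrakk> \<Longrightarrow> f x \<oplus>\<^bsub>S\<^esub> f y = f (x \<oplus>\<^bsub>M\<^esub> y)"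
    and smult: "\<And>a x. \<lbrakk>a \<in> carrier A; x \<in> carrier M\<rbrakk> \<Longrightarrow> a \<odot>\<^bsub>S\<^esub> f x = f (a \<odot>\<^bsub>M\<^esub> x)"
  shows "left_module A S"
proof -
  interpret left_module A M by fact
  interpret M: abelian_group M by (rule abelian_group)
  interpret A: ring A by (rule ring)
  have *: "\<exists>z\<in>carrier M. f z \<oplus>\<^bsub>S\<^esub> f x = f \<zero>\<^bsub>M\<^esub>" if "x \<in> carrier M" for x
    using that by (intro bexI[of _ "\<ominus>\<^bsub>M\<^esub> x"]) (simp_all add: add M.l_neg)
  have "abelian_group S"
    by (rule abelian_groupI) (use * in \<open>auto simp: im zero add M.a_ac\<close>)
  then show ?thesis
    by (intro left_module.intro ring)
      (auto simp: im add smult smult_closed smult_l_distr smult_r_distr smult_assoc smult_one)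
qed

context graded_algebra
begin

text \<open>
  The grading descends because a graded submodule contains the components of its elements: elements
  of one coset have components in one coset, so the components of a coset are well defined.
\<close>

lemma quotient_module_gmod:
  assumes M: "gmod K A M" and N: "graded_submodule A M N"
  shows "gmod K A (quotient_module M N)"
    and "(\<lambda>x. N +>\<^bsub>M\<^esub> x) \<in> gmodule_hom A M (quotient_module M N)"
    and "carrier (quotient_module M N) = (\<lambda>x. N +>\<^bsub>M\<^esub> x) ` carrier M"
    and "x \<in> carrier M \<Longrightarrow> N +>\<^bsub>M\<^esub> x = \<zero>\<^bsub>quotient_module M N\<^esub> \<longleftrightarrow> x \<in> N"
proof -
  interpret M: gmod K A M by fact
  let ?S = "quotient_module M N"
  let ?\<rho> = "\<lambda>x. N +>\<^bsub>M\<^esub> x"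
  have sub: "additive_subgroup N M" and sm: "\<And>a x. a \<in> carrier A \<Longrightarrow> x \<in> N \<Longrightarrow> a \<odot>\<^bsub>M\<^esub> x \<in> N"
    and hc: "\<And>n x. x \<in> N \<Longrightarrow> hcomp M n x \<in> N"
    using N by (auto simp: graded_submodule_def)
  interpret N: abelian_subgroup N M
    by (rule abelian_subgroupI3[OF sub M.abelian_group_axioms])
  have Nc: "x \<in> N \<Longrightarrow> x \<in> carrier M" for x by (rule N.a_Hcarr)
  have mem: "y \<in> ?\<rho> x \<longleftrightarrow> (\<exists>n\<in>N. y = n \<oplus>\<^bsub>M\<^esub> x)" for x y
    by (auto simp: a_r_coset_def')
  have shift: "?\<rho> (n \<oplus>\<^bsub>M\<^esub> x) = ?\<rho> x" if n: "n \<in> N" and x: "x \<in> carrier M" for n x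
    using N.a_repr_independence'[of "n \<oplus>\<^bsub>M\<^esub> x" x] mem n x by metis
  show car: "carrier ?S = ?\<rho> ` carrier M"
    by (auto simp: quotient_module_def A_RCOSETS_def')
  have zero': "\<zero>\<^bsub>?S\<^esub> = N" by (simp add: quotient_module_def)
  have zero: "\<zero>\<^bsub>?S\<^esub> = ?\<rho> \<zero>\<^bsub>M\<^esub>"
    using N.a_rcos_const[OF N.zero_closed] by (simp add: zero')
  have add: "?\<rho> x \<oplus>\<^bsub>?S\<^esub> ?\<rho> y = ?\<rho> (x \<oplus>\<^bsub>M\<^esub> y)" if "x \<in> carrier M" "y \<in> carrier M" for x y
    using N.a_rcos_sum[OF that] by (simp add: quotient_module_def)
  have smult: "a \<odot>\<^bsub>?S\<^esub> ?\<rho> x = ?\<rho> (a \<odot>\<^bsub>M\<^esub> x)" if a: "a \<in> carrier A" and x: "x \<in> carrier M" for a x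
  proof -
    have *: "?\<rho> (a \<odot>\<^bsub>M\<^esub> y) = ?\<rho> (a \<odot>\<^bsub>M\<^esub> x)" if y: "y \<in> ?\<rho> x" for y
    proof -
      obtain n where n: "n \<in> N" "y = n \<oplus>\<^bsub>M\<^esub> x" using y unfolding mem by blast
      then have "a \<odot>\<^bsub>M\<^esub> y = a \<odot>\<^bsub>M\<^esub> n \<oplus>\<^bsub>M\<^esub> a \<odot>\<^bsub>M\<^esub> x"
        using M.smult_r_distr[OF a Nc[OF n(1)] x] by simp
      then show ?thesis using shift sm[OF a n(1)] a x by simp
    qed
    have "x \<in> ?\<rho> x" using N.a_rcos_self[OF x] .
    then have "?\<rho> x \<noteq> {}" by fastforce
    then have "(\<Union>y\<in>?\<rho> x. ?\<rho> (a \<odot>\<^bsub>M\<^esub> y)) = ?\<rho> (a \<odot>\<^bsub>M\<^esub> x)"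
      using * by (rule SUP_eq_const)
    then show ?thesis by (simp add: quotient_module_def)
  qed
  have lm: "left_module A ?S"
    by (rule left_module_by_surjection[OF M.left_module car zero add smult])
  then have ab: "abelian_group ?S" by (rule left_module.abelian_group)
  interpret S: abelian_group ?S by fact
  have ker: "?\<rho> x = \<zero>\<^bsub>?S\<^esub> \<longleftrightarrow> x \<in> N" if "x \<in> carrier M" for x
    unfolding zero' using N.a_rcos_const N.a_rcos_self[OF that] by blast
  then show "x \<in> carrier M \<Longrightarrow> ?\<rho> x = \<zero>\<^bsub>?S\<^esub> \<longleftrightarrow> x \<in> N" .
  have \<rho>: "additive_map M ?S ?\<rho>" by (auto simp: additive_map_def car add)
  have \<rho>_eq: "?\<rho> (hcomp M n x) = ?\<rho> (hcomp M n y)"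
    if xy: "x \<in> carrier M" "y \<in> carrier M" "?\<rho> x = ?\<rho> y" for x y n
  proof -
    have "x \<in> ?\<rho> y" using N.a_rcos_self[OF xy(1)] xy(3) by simp
    then obtain z where z: "z \<in> N" "x = z \<oplus>\<^bsub>M\<^esub> y" unfolding mem by blast
    then have "hcomp M n x = hcomp M n z \<oplus>\<^bsub>M\<^esub> hcomp M n y" using xy Nc by (simp add: M.hcomp_add)
    then show ?thesis using shift[OF hc[OF z(1)]] xy by simp
  qed
  define p where "p n X = ?\<rho> (hcomp M n (SOME x. x \<in> carrier M \<and> X = ?\<rho> x))" for n X
  have p: "p n (?\<rho> x) = ?\<rho> (hcomp M n x)" if x: "x \<in> carrier M" for n x
  proof -
    let ?y = "SOME y. y \<in> carrier M \<and> ?\<rho> x = ?\<rho> y"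
    have "?y \<in> carrier M \<and> ?\<rho> x = ?\<rho> ?y" by (rule someI[of _ x]) (simp add: x)
    then show ?thesis unfolding p_def using \<rho>_eq[OF _ x, of ?y n] by simp
  qed
  have grade: "grade ?S n = ?\<rho> ` grade M n" for n by (simp add: quotient_module_def)
  have sub': "additive_subgroup (grade ?S n) ?S" for n
  proof (rule S.additive_subgroupI)
    show "X \<in> carrier ?S" if "X \<in> grade ?S n" for X
      using that M.grade_closed unfolding grade car by auto
    show "\<zero>\<^bsub>?S\<^esub> \<in> grade ?S n" unfolding zero grade by (intro imageI M.grade_zero)
    show "X \<oplus>\<^bsub>?S\<^esub> Y \<in> grade ?S n" if X: "X \<in> grade ?S n" and Y: "Y \<in> grade ?S n" for X Y
    proof -
      obtain x where "x \<in> grade M n" "X = ?\<rho> x" using X unfolding grade by (elim imageE)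
      moreover obtain y where "y \<in> grade M n" "Y = ?\<rho> y" using Y unfolding grade by (elim imageE)
      ultimately show ?thesis
        unfolding grade using add M.grade_closed M.grade_add by auto
    qed
    show "\<ominus>\<^bsub>?S\<^esub> X \<in> grade ?S n" if X: "X \<in> grade ?S n" for X
    proof -
      obtain x where x: "x \<in> grade M n" "X = ?\<rho> x" using X unfolding grade by (elim imageE)
      then have "\<ominus>\<^bsub>?S\<^esub> X = ?\<rho> (\<ominus>\<^bsub>M\<^esub> x)"
        using additive_map_uminus[OF \<rho> M.abelian_group_axioms ab M.grade_closed] by simp
      then show ?thesis unfolding grade using M.grade_uminus[OF x(1)] by simp
    qed
  qed
  have padd: "additive_map ?S ?S (p n)" for n
    unfolding additive_map_def car by (auto simp: p add M.hcomp_add)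
  have img: "p n X \<in> grade ?S n" if "X \<in> carrier ?S" for n X
    using that M.hcomp_grade unfolding car grade by (auto simp: p)
  have hom: "p n X = (if n = m then X else \<zero>\<^bsub>?S\<^esub>)" if X: "X \<in> grade ?S m" for n m X
  proof -
    obtain x where x: "x \<in> grade M m" "X = ?\<rho> x" using X unfolding grade by (elim imageE)
    then show ?thesis
      using M.hcomp_homogeneous[OF x(1), of n] p[OF M.grade_closed[OF x(1)], of n] zero by simp
  qed
  have supp: "{n. p n (?\<rho> x) \<noteq> \<zero>\<^bsub>?S\<^esub>} \<subseteq> {n. hcomp M n x \<noteq> \<zero>\<^bsub>M\<^esub>}" if "x \<in> carrier M" for x
    using that by (auto simp: p zero)
  have fin: "finite {n. p n X \<noteq> \<zero>\<^bsub>?S\<^esub>}" if X: "X \<in> carrier ?S" for X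
  proof -
    obtain x where "x \<in> carrier M" "X = ?\<rho> x" using X unfolding car by (elim imageE)
    then show ?thesis using finite_subset[OF supp M.hcomp_finite] by simp
  qed
  have dec: "X = (\<Oplus>\<^bsub>?S\<^esub>n\<in>{n. p n X \<noteq> \<zero>\<^bsub>?S\<^esub>}. p n X)" if X: "X \<in> carrier ?S" for X
  proof -
    obtain x where x: "x \<in> carrier M" "X = ?\<rho> x" using X unfolding car by (elim imageE)
    let ?T = "{n. hcomp M n x \<noteq> \<zero>\<^bsub>M\<^esub>}"
    have pc: "p n X \<in> carrier ?S" for n using x by (simp add: p car)
    have "X = (\<Oplus>\<^bsub>?S\<^esub>n\<in>?T. ?\<rho> (hcomp M n x))"
      unfolding x(2)
      by (rule M.additive_map_graded_finsum[OF \<rho> ab x(1) M.hcomp_finite[OF x(1)]]) simp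
    also have "\<dots> = (\<Oplus>\<^bsub>?S\<^esub>n\<in>?T. p n X)" using x by (simp add: p)
    also have "\<dots> = (\<Oplus>\<^bsub>?S\<^esub>n\<in>{n. p n X \<noteq> \<zero>\<^bsub>?S\<^esub>}. p n X)"
      by (rule S.finsum_support[symmetric, OF M.hcomp_finite[OF x(1)] _ pc])
        (use supp[OF x(1)] x(2) in blast)
    finally show ?thesis .
  qed
  show g: "gmod K A ?S"
  proof (rule gmodI[OF lm])
    show "graded_group ?S"
      by (rule graded_grp.graded)
        (rule graded_group_by_projections(1)[where p = p, OF ab sub' padd img hom fin dec])
    fix m n a X assume a: "a \<in> grade A m" and "X \<in> grade ?S n"
    then obtain x where x: "x \<in> grade M n" "X = ?\<rho> x" unfolding grade by (elim imageE)
    then show "a \<odot>\<^bsub>?S\<^esub> X \<in> grade ?S (m + n)"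
      unfolding grade using smult[OF A.grade_closed[OF a] M.grade_closed[OF x(1)]]
        M.grade_smult[OF a x(1)] by simp
  qed
  show "?\<rho> \<in> gmodule_hom A M ?S"
    by (rule gmodule_homI) (simp_all add: car add smult grade)
qed

lemma regular_module: "gmod K A (left_ideal_module A (carrier A))" (is "gmod K A ?L")
proof (rule gmodI)
  have simps: "carrier ?L = carrier A" "\<And>x y. x \<oplus>\<^bsub>?L\<^esub> y = x \<oplus>\<^bsub>A\<^esub> y" "\<zero>\<^bsub>?L\<^esub> = \<zero>\<^bsub>A\<^esub>"
    "\<And>a x. a \<odot>\<^bsub>?L\<^esub> x = a \<otimes>\<^bsub>A\<^esub> x" "\<And>n. grade ?L n = grade A n \<inter> carrier A"
    by (simp_all add: left_ideal_module_def)
  have gr: "grade ?L n = grade A n" for n using A.grade_closed by (auto simp: simps)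
  have ab: "abelian_group ?L"
  proof (rule abelian_groupI)
    show "\<exists>y\<in>carrier ?L. y \<oplus>\<^bsub>?L\<^esub> x = \<zero>\<^bsub>?L\<^esub>" if "x \<in> carrier ?L" for x
      using that by (intro bexI[of _ "\<ominus>\<^bsub>A\<^esub> x"]) (simp_all add: simps A.l_neg)
  qed (auto simp: simps A.a_ac)
  interpret L: abelian_group ?L by (rule ab)
  show "left_module A ?L"
    by (rule left_module.intro[OF ring ab]) (auto simp: simps A.l_distr A.r_distr A.m_assoc)
  have incl: "additive_map ?L A (\<lambda>x. x)" by (auto simp: additive_map_def simps)
  have sum: "finsum ?L f T = finsum A f T" if "finite T" "f \<in> T \<rightarrow> carrier A" for f :: "int \<Rightarrow> _" and T
    using additive_map_finsum[OF incl ab A.abelian_group_axioms, of f T] that by (simp add: simps)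
  have neg: "\<ominus>\<^bsub>?L\<^esub> x = \<ominus>\<^bsub>A\<^esub> x" if "x \<in> carrier A" for x
    using additive_map_uminus[OF incl ab A.abelian_group_axioms, of x] that by (simp add: simps)
  show "graded_group ?L"
  proof (rule graded_grp.graded, rule graded_group_by_projections(1)[where p = "hcomp A", OF ab])
    show "additive_subgroup (grade ?L n) ?L" for n
      by (rule L.additive_subgroupI)
        (simp_all add: gr, simp_all add: simps A.grade_closed A.grade_add neg A.grade_uminus)
    show "additive_map ?L ?L (hcomp A n)" for n
      by (auto simp: additive_map_def simps A.hcomp_add)
    show "hcomp A n x \<in> grade ?L n" if "x \<in> carrier ?L" for n x
      using that A.hcomp_grade by (simp add: gr simps(1))
    show "hcomp A n x = (if n = m then x else \<zero>\<^bsub>?L\<^esub>)" if "x \<in> grade ?L m" for n m x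
      using that A.hcomp_homogeneous[of x m n] by (simp add: gr simps(3))
    show "finite {n. hcomp A n x \<noteq> \<zero>\<^bsub>?L\<^esub>}" if "x \<in> carrier ?L" for x
      using that A.hcomp_finite by (simp add: simps(1,3))
    show "x = (\<Oplus>\<^bsub>?L\<^esub>n\<in>{n. hcomp A n x \<noteq> \<zero>\<^bsub>?L\<^esub>}. hcomp A n x)" if "x \<in> carrier ?L" for x
    proof -
      have x: "x \<in> carrier A" using that by (simp add: simps(1))
      then have "finsum ?L (\<lambda>n. hcomp A n x) {n. hcomp A n x \<noteq> \<zero>\<^bsub>A\<^esub>} =
          finsum A (\<lambda>n. hcomp A n x) {n. hcomp A n x \<noteq> \<zero>\<^bsub>A\<^esub>}"
        using A.hcomp_finite by (intro sum) auto
      then show ?thesis using A.hcomp_sum[OF x] by (simp add: simps(3))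
    qed
  qed
  show "a \<odot>\<^bsub>?L\<^esub> x \<in> grade ?L (m + n)" if "a \<in> grade A m" "x \<in> grade ?L n" for m n a x
    using that grade_mult by (simp add: gr simps(4))
qed

lemma left_ideal_module_restrict:
  "X \<subseteq> carrier A \<Longrightarrow> left_ideal_module A X = restrict_module (left_ideal_module A (carrier A)) X"
  by (auto simp: left_ideal_module_def restrict_module_def)

end

context vertex_graded_algebra
begin

text \<open>The generators of the standard projective: indices, vertices, degrees.\<close>

definition Q :: "nat set \<times> (nat \<Rightarrow> 'r) \<times> (nat \<Rightarrow> int) \<Rightarrow> ('a, nat \<Rightarrow> 'a) gmodule" where
  "Q g = FS A (fst g) (\<lambda>s. e (fst (snd g) s)) (snd (snd g))"

lemma Q_gmod: "gmod K A (Q g)"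
  unfolding Q_def by (rule principal_family.FS_gmod) (rule std_family)

lemma vertex_projective_gmod:
  "gmod K A (vertex_projective A e j)"
  "x \<in> carrier (vertex_projective A e j) \<Longrightarrow> hcomp (vertex_projective A e j) n x = hcomp A n x"
  "carrier (vertex_projective A e j) = {x \<in> carrier A. x \<otimes>\<^bsub>A\<^esub> e j = x}"
proof -
  interpret principal_family K A "{()}" "\<lambda>_. e j" "\<lambda>_. 0" by (rule std_family)
  let ?L = "left_ideal_module A (carrier A)"
  let ?X = "{a \<otimes>\<^bsub>A\<^esub> e j | a. a \<in> carrier A}"
  have X: "?X = {x \<in> carrier A. x \<otimes>\<^bsub>A\<^esub> e j = x}" by (rule principal_eq) simp
  interpret L: gmod K A ?L by (rule regular_module)
  have L: "carrier ?L = carrier A" "\<And>x y. x \<oplus>\<^bsub>?L\<^esub> y = x \<oplus>\<^bsub>A\<^esub> y" "\<zero>\<^bsub>?L\<^esub> = \<zero>\<^bsub>A\<^esub>"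
    "\<And>a x. a \<odot>\<^bsub>?L\<^esub> x = a \<otimes>\<^bsub>A\<^esub> x"
    by (simp_all add: left_ideal_module_def)
  have LA: "(\<lambda>x. x) \<in> carrier A \<rightarrow> carrier A" by simp
  have hL: "hcomp ?L n x = hcomp A n x" if x: "x \<in> carrier A" for n x
  proof -
    have "hcomp A (n + 0) x = hcomp ?L n x"
      by (rule hcomp_additive_map[OF L.graded_grp_axioms A.graded_grp_axioms])
        (auto simp: additive_map_def L x, auto simp: left_ideal_module_def)
    then show ?thesis by simp
  qed
  have neg: "\<ominus>\<^bsub>?L\<^esub> x = \<ominus>\<^bsub>A\<^esub> x" if "x \<in> carrier A" for x
    using additive_map_uminus[of ?L A "\<lambda>x. x" x] that L.abelian_group_axioms A.abelian_group_axioms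
    by (simp add: additive_map_def L)
  have sub: "graded_submodule A ?L ?X"
    unfolding graded_submodule_def X
  proof (intro conjI ballI allI)
    show "additive_subgroup {x \<in> carrier A. x \<otimes>\<^bsub>A\<^esub> e j = x} ?L"
      by (rule L.additive_subgroupI) (auto simp: L A.l_distr neg A.l_minus)
    show "a \<odot>\<^bsub>?L\<^esub> x \<in> {x \<in> carrier A. x \<otimes>\<^bsub>A\<^esub> e j = x}"
      if "a \<in> carrier A" "x \<in> {x \<in> carrier A. x \<otimes>\<^bsub>A\<^esub> e j = x}" for a x
      using that by (simp add: L A.m_assoc)
    show "hcomp ?L n x \<in> {x \<in> carrier A. x \<otimes>\<^bsub>A\<^esub> e j = x}"
      if "x \<in> {x \<in> carrier A. x \<otimes>\<^bsub>A\<^esub> e j = x}" for n x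
      using that hL unit_hcomp[of x "()" n] by simp
  qed
  have eq: "vertex_projective A e j = restrict_module ?L ?X"
    unfolding vertex_projective_def by (rule left_ideal_module_restrict) (auto simp: X)
  show "gmod K A (vertex_projective A e j)"
    unfolding eq by (rule restrict_module_gmod(1)[OF regular_module sub])
  show "hcomp (vertex_projective A e j) n x = hcomp A n x"
    if "x \<in> carrier (vertex_projective A e j)"
    using that restrict_module_gmod(2)[OF regular_module sub, of x n] hL X
    unfolding eq by simp
  show "carrier (vertex_projective A e j) = {x \<in> carrier A. x \<otimes>\<^bsub>A\<^esub> e j = x}"
    unfolding eq using X by simp
qed

lemma vertex_projective_simps:
  "x \<oplus>\<^bsub>vertex_projective A e j\<^esub> y = x \<oplus>\<^bsub>A\<^esub> y" "\<zero>\<^bsub>vertex_projective A e j\<^esub> = \<zero>\<^bsub>A\<^esub>"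
  "a \<odot>\<^bsub>vertex_projective A e j\<^esub> x = a \<otimes>\<^bsub>A\<^esub> x"
  "grade (vertex_projective A e j) n = grade A n \<inter> carrier (vertex_projective A e j)"
  by (simp_all add: vertex_projective_def left_ideal_module_def)

lemma positive_part_vertex:
  "{a \<otimes>\<^bsub>A\<^esub> e j | a. a \<in> positive_part A} =
     {x \<in> carrier A. x \<otimes>\<^bsub>A\<^esub> e j = x \<and> hcomp A 0 x = \<zero>\<^bsub>A\<^esub>}"
proof (intro Set.equalityI subsetI)
  fix x assume "x \<in> {a \<otimes>\<^bsub>A\<^esub> e j | a. a \<in> positive_part A}"
  then obtain a where a: "a \<in> positive_part A" "x = a \<otimes>\<^bsub>A\<^esub> e j" by (elim CollectE exE conjE)
  then have "a \<in> carrier A" by (simp add: positive_part_iff)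
  then show "x \<in> {x \<in> carrier A. x \<otimes>\<^bsub>A\<^esub> e j = x \<and> hcomp A 0 x = \<zero>\<^bsub>A\<^esub>}"
    using hcomp_0_mult[OF a(1), of "e j"] a(2) by (simp add: A.m_assoc)
next
  fix x assume "x \<in> {x \<in> carrier A. x \<otimes>\<^bsub>A\<^esub> e j = x \<and> hcomp A 0 x = \<zero>\<^bsub>A\<^esub>}"
  then have "x \<in> positive_part A" "x = x \<otimes>\<^bsub>A\<^esub> e j" by (simp_all add: positive_part_iff)
  then show "x \<in> {a \<otimes>\<^bsub>A\<^esub> e j | a. a \<in> positive_part A}" by (intro CollectI exI[of _ x] conjI)
qed

text \<open>
  The vertex simple at \<^term>\<open>j\<close> is the quotient of \<open>A e\<^sub>j\<close> by the elements with vanishing component in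
  degree zero. The cover is phrased with the standard projective on one generator, so that it can be
  the start of a resolution.
\<close>

lemma vertex_simple_cover:
  shows vertex_simple_gmod: "gmod K A (vertex_simple A e j)"
    and "\<exists>\<epsilon>\<in>gmodule_hom A (Q ({0}, (\<lambda>_. j), (\<lambda>_. 0))) (vertex_simple A e j).
      \<epsilon> ` carrier (Q ({0}, (\<lambda>_. j), (\<lambda>_. 0))) = carrier (vertex_simple A e j) \<and>
      (\<forall>x\<in>carrier (Q ({0}, (\<lambda>_. j), (\<lambda>_. 0))).
        \<epsilon> x = \<zero>\<^bsub>vertex_simple A e j\<^esub> \<longleftrightarrow> hcomp A 0 (x 0) = \<zero>\<^bsub>A\<^esub>)"
proof -
  let ?V = "vertex_projective A e j"
  let ?N = "{a \<otimes>\<^bsub>A\<^esub> e j | a. a \<in> positive_part A}"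
  interpret F: principal_family K A "{0::nat}" "\<lambda>s. e ((\<lambda>_. j) s)" "\<lambda>_. 0" by (rule std_family)
  interpret V: gmod K A ?V by (rule vertex_projective_gmod)
  note Vs = vertex_projective_simps
  note N = positive_part_vertex[of j]
  have neg: "\<ominus>\<^bsub>?V\<^esub> x = \<ominus>\<^bsub>A\<^esub> x" if "x \<in> carrier ?V" for x
    using additive_map_uminus[of ?V A "\<lambda>x. x" x] that V.abelian_group_axioms A.abelian_group_axioms
    by (simp add: additive_map_def Vs vertex_projective_gmod(3))
  have sub: "graded_submodule A ?V ?N"
    unfolding graded_submodule_def N
  proof (intro conjI ballI allI)
    show "additive_subgroup {x \<in> carrier A. x \<otimes>\<^bsub>A\<^esub> e j = x \<and> hcomp A 0 x = \<zero>\<^bsub>A\<^esub>} ?V"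
      by (rule V.additive_subgroupI)
        (auto simp: Vs vertex_projective_gmod(3) A.l_distr A.hcomp_add neg A.l_minus A.hcomp_uminus)
    show "a \<odot>\<^bsub>?V\<^esub> x \<in> {x \<in> carrier A. x \<otimes>\<^bsub>A\<^esub> e j = x \<and> hcomp A 0 x = \<zero>\<^bsub>A\<^esub>}"
      if a: "a \<in> carrier A" and x: "x \<in> {x \<in> carrier A. x \<otimes>\<^bsub>A\<^esub> e j = x \<and> hcomp A 0 x = \<zero>\<^bsub>A\<^esub>}" for a x
    proof -
      have xc: "x \<in> carrier A" "x \<otimes>\<^bsub>A\<^esub> e j = x" "hcomp A 0 x = \<zero>\<^bsub>A\<^esub>" using x by simp_all
      have m: "additive_map A A (\<lambda>a. hcomp A 0 (a \<otimes>\<^bsub>A\<^esub> x))"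
        using xc by (auto simp: additive_map_def A.l_distr A.hcomp_add)
      from a have "hcomp A 0 (a \<otimes>\<^bsub>A\<^esub> x) = \<zero>\<^bsub>A\<^esub>"
      proof (induction rule: A.homogeneous_induct)
        case (homogeneous n b)
        then show ?case
          using xc hcomp_mult_left[OF homogeneous xc(1), of 0] hcomp_neg[of "- n" x] grade_neg[of n]
            A.grade_closed[OF homogeneous]
          by (cases "n < 0"; cases "n = 0") simp_all
      next
        case (add y z)
        then show ?case using additive_map_add[OF m, of y z] by simp
      qed
      then show ?thesis using a xc by (simp add: Vs A.m_assoc)
    qed
    show "hcomp ?V n x \<in> {x \<in> carrier A. x \<otimes>\<^bsub>A\<^esub> e j = x \<and> hcomp A 0 x = \<zero>\<^bsub>A\<^esub>}"
      if "x \<in> {x \<in> carrier A. x \<otimes>\<^bsub>A\<^esub> e j = x \<and> hcomp A 0 x = \<zero>\<^bsub>A\<^esub>}" for n x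
      using that F.unit_hcomp[of x 0 n] by (simp add: vertex_projective_gmod(2,3))
  qed
  note qm = quotient_module_gmod[OF vertex_projective_gmod(1) sub, folded vertex_simple_def]
  show "gmod K A (vertex_simple A e j)" by (rule qm)
  let ?F = "Q ({0}, (\<lambda>_. j), (\<lambda>_. 0))"
  have QF: "?F = F.F" by (simp add: Q_def)
  have p: "(\<lambda>x. x 0) \<in> gmodule_hom A F.F ?V"
    by (rule gmodule_homI)
      (simp_all add: vertex_projective_gmod(3) Vs F.FS_add F.FS_smult F.FS_grade)
  have surj: "(\<lambda>x. x 0) ` carrier F.F = carrier ?V"
  proof (intro Set.equalityI subsetI)
    fix y assume y: "y \<in> carrier ?V"
    then have "unit_vec A {0} 0 y \<in> carrier F.F"
      by (intro F.unit_vec_closed) (simp_all add: vertex_projective_gmod(3))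
    then show "y \<in> (\<lambda>x. x 0) ` carrier F.F"
      by (intro image_eqI[of _ _ "unit_vec A {0} 0 y"]) (simp_all add: unit_vec_def)
  qed (use hom_closed[OF p] in auto)
  let ?\<epsilon> = "\<lambda>x. ?N +>\<^bsub>?V\<^esub> (x 0)"
  have "?\<epsilon> \<in> gmodule_hom A F.F (vertex_simple A e j)" by (rule hom_comp[OF p qm(2)])
  moreover have "?\<epsilon> ` carrier F.F = carrier (vertex_simple A e j)"
    unfolding qm(3) surj[symmetric] by (simp add: image_image)
  moreover have "?\<epsilon> x = \<zero>\<^bsub>vertex_simple A e j\<^esub> \<longleftrightarrow> hcomp A 0 (x 0) = \<zero>\<^bsub>A\<^esub>" if "x \<in> carrier F.F" for x
    using qm(4)[OF hom_closed[OF p that]] that unfolding N by simp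
  ultimately show "\<exists>\<epsilon>\<in>gmodule_hom A ?F (vertex_simple A e j).
      \<epsilon> ` carrier ?F = carrier (vertex_simple A e j) \<and>
      (\<forall>x\<in>carrier ?F. \<epsilon> x = \<zero>\<^bsub>vertex_simple A e j\<^esub> \<longleftrightarrow> hcomp A 0 (x 0) = \<zero>\<^bsub>A\<^esub>)"
    unfolding QF by (intro bexI conjI ballI) simp_all
qed

section \<open>Existence of minimal resolutions\<close>

lemma Q_finitely_generated:
  assumes "finite (fst g)"
  shows "finitely_generated A (Q g)"
proof -
  obtain I c d where g: "g = (I, c, d)" by (cases g)
  interpret F: principal_family K A I "\<lambda>s. e (c s)" d by (rule std_family)
  interpret FM: gmod K A F.F by (rule F.FS_gmod)
  have I: "finite I" using assms g by simp
  have QF: "Q g = F.F" by (simp add: Q_def g)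
  let ?S = "(\<lambda>s. unit_vec A I s (e (c s))) ` I"
  let ?X = "{a \<odot>\<^bsub>F.F\<^esub> s | a s. a \<in> carrier A \<and> s \<in> ?S}"
  have X: "?X \<subseteq> carrier F.F"
  proof
    fix y assume "y \<in> ?X"
    then obtain a s where "a \<in> carrier A" "s \<in> I" "y = a \<odot>\<^bsub>F.F\<^esub> unit_vec A I s (e (c s))" by auto
    then show "y \<in> carrier F.F" by simp
  qed
  have sub: "additive_subgroup (generate (add_monoid F.F) ?X) F.F"
    by (rule FM.generate_additive_subgroup[OF X])
  have "carrier F.F \<subseteq> generate (add_monoid F.F) ?X"
  proof
    fix x assume x: "x \<in> carrier F.F"
    have "(\<Oplus>\<^bsub>F.F\<^esub>s\<in>I. x s \<odot>\<^bsub>F.F\<^esub> unit_vec A I s (e (c s))) \<in> generate (add_monoid F.F) ?X"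
    proof (rule FM.subgroup_finsum[OF sub I], rule FM.generate_incl, intro CollectI exI conjI)
      fix s assume s: "s \<in> I"
      show "x s \<odot>\<^bsub>F.F\<^esub> unit_vec A I s (e (c s)) = x s \<odot>\<^bsub>F.F\<^esub> unit_vec A I s (e (c s))" by simp
      show "x s \<in> carrier A" using x s by simp
      show "unit_vec A I s (e (c s)) \<in> ?S" using s by simp
    qed
    then show "x \<in> generate (add_monoid F.F) ?X" using F.FS_decompose[OF x I] by simp
  qed
  then have "carrier F.F = generate (add_monoid F.F) ?X"
    using additive_subgroup.a_Hcarr[OF sub] by blast
  moreover have "finite ?S" "?S \<subseteq> carrier F.F" using I by auto
  ultimately show ?thesis unfolding finitely_generated_def QF by (intro exI[of _ ?S] conjI)
qed

text \<open>
  Each \<open>A e\<^sub>i\<close> is a direct summand of \<open>A\<close>, with right multiplication by \<open>e\<^sub>i\<close> as retraction.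
\<close>

lemma Q_projective: "graded_projective A (Q g)"
proof -
  obtain I c d where g: "g = (I, c, d)" by (cases g)
  interpret F: principal_family K A I "\<lambda>s. e (c s)" d by (rule std_family)
  have QF: "Q g = F.F" by (simp add: Q_def g)
  \<comment> \<open>The free module needs an index set of functions, so the indices are coded as unit vectors.\<close>
  define k where "k s = (\<lambda>n::nat. if n = s then \<one>\<^bsub>A\<^esub> else \<zero>\<^bsub>A\<^esub>)" for s
  have kinj: "inj k" using one_nonzero by (auto simp: inj_def k_def fun_eq_iff)
  define k' where "k' = inv_into UNIV k"
  have k'k [simp]: "k' (k s) = s" for s using kinj by (simp add: k'_def)
  let ?J = "k ` I"
  let ?d = "\<lambda>b. d (k' b)"
  interpret G: principal_family K A ?J "\<lambda>_. \<one>\<^bsub>A\<^esub>" ?d by unfold_locales (simp_all add: grade_one)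
  have "{a \<otimes>\<^bsub>A\<^esub> \<one>\<^bsub>A\<^esub> | a. a \<in> carrier A} = (\<lambda>a. a \<otimes>\<^bsub>A\<^esub> \<one>\<^bsub>A\<^esub>) ` carrier A" by blast
  also have "\<dots> = carrier A" by simp
  finally have G: "direct_sum ?J (\<lambda>b. shift (left_ideal_module A (carrier A)) (?d b)) = G.F"
    by (simp add: FS_def)
  define f where "f x = (\<lambda>b\<in>?J. x (k' b))" for x :: "nat \<Rightarrow> 'a"
  define h where "h y = (\<lambda>s\<in>I. y (k s) \<otimes>\<^bsub>A\<^esub> e (c s))" for y :: "(nat \<Rightarrow> 'a) \<Rightarrow> 'a"
  have fc: "f x \<in> carrier G.F" if x: "x \<in> carrier F.F" for x
    by (rule G.FS_memI[of _ "k ` {s\<in>I. x s \<noteq> \<zero>\<^bsub>A\<^esub>}"])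
      (use x F.FS_finite[OF x] in \<open>auto simp: f_def\<close>)
  have hc: "h y \<in> carrier F.F" if y: "y \<in> carrier G.F" for y
  proof (rule F.FS_memI[of _ "k' ` {b\<in>?J. y b \<noteq> \<zero>\<^bsub>A\<^esub>}"])
    show "finite (k' ` {b\<in>?J. y b \<noteq> \<zero>\<^bsub>A\<^esub>})" using G.FS_finite[OF y] by simp
    show "h y s = \<zero>\<^bsub>A\<^esub>" if "s \<in> I" "s \<notin> k' ` {b\<in>?J. y b \<noteq> \<zero>\<^bsub>A\<^esub>}" for s
    proof -
      have "y (k s) = \<zero>\<^bsub>A\<^esub>" using that by (metis (mono_tags, lifting) imageI k'k mem_Collect_eq)
      then show ?thesis using that by (simp add: h_def)
    qed
  qed (use y in \<open>auto simp: h_def A.m_assoc\<close>)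
  have f: "f \<in> gmodule_hom A F.F G.F"
  proof (rule gmodule_homI)
    show "f (x \<oplus>\<^bsub>F.F\<^esub> y) = f x \<oplus>\<^bsub>G.F\<^esub> f y" for x y
      by (auto simp: f_def F.FS_add G.FS_add intro!: restrict_ext)
    show "f (a \<odot>\<^bsub>F.F\<^esub> x) = a \<odot>\<^bsub>G.F\<^esub> f x" for a x
      by (auto simp: f_def F.FS_smult G.FS_smult intro!: restrict_ext)
    show "f x \<in> grade G.F n" if "x \<in> grade F.F n" for x n
      using that fc[of x] by (auto simp: F.FS_grade G.FS_grade) (auto simp: f_def)
  qed (rule fc)
  have h: "h \<in> gmodule_hom A G.F F.F"
  proof (rule gmodule_homI)
    show "h (x \<oplus>\<^bsub>G.F\<^esub> y) = h x \<oplus>\<^bsub>F.F\<^esub> h y" if "x \<in> carrier G.F" "y \<in> carrier G.F" for x y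
      using that by (auto simp: h_def F.FS_add G.FS_add A.l_distr intro!: restrict_ext)
    show "h (a \<odot>\<^bsub>G.F\<^esub> x) = a \<odot>\<^bsub>F.F\<^esub> h x" if "a \<in> carrier A" "x \<in> carrier G.F" for a x
      using that by (auto simp: h_def F.FS_smult G.FS_smult A.m_assoc intro!: restrict_ext)
    show "h y \<in> grade F.F n" if y: "y \<in> grade G.F n" for y n
    proof -
      have "y (k s) \<otimes>\<^bsub>A\<^esub> e (c s) \<in> grade A (n - d s)" if "s \<in> I" for s
        using grade_mult[OF _ vertex_in_grade_0, of "y (k s)" "n - d s"] y that
        by (simp add: G.FS_grade)
      then show ?thesis using hc[of y] y by (simp add: F.FS_grade G.FS_grade) (simp add: h_def)
    qed
  qed (rule hc)
  have hf: "h (f x) = x" if x: "x \<in> carrier F.F" for x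
    by (rule F.FS_eqI[OF hc[OF fc[OF x]] x]) (use x in \<open>simp add: h_def f_def\<close>)
  show ?thesis
    unfolding graded_projective_def Let_def QF
    by (rule exI[of _ ?J], rule exI[of _ ?d], unfold G)
      (intro bexI[OF _ f] bexI[OF _ h] ballI hf)
qed

lemma Q_bounded_below:
  assumes "finite (fst g)"
  shows "\<exists>n0. \<forall>n<n0. grade (Q g) n = {\<zero>\<^bsub>Q g\<^esub>}"
proof -
  obtain I c d where g: "g = (I, c, d)" by (cases g)
  interpret F: principal_family K A I "\<lambda>s. e (c s)" d by (rule std_family)
  interpret FM: gmod K A F.F by (rule F.FS_gmod)
  have QF: "Q g = F.F" by (simp add: Q_def g)
  obtain n0 where n0: "\<And>s. s \<in> I \<Longrightarrow> n0 \<le> d s"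
  proof (cases "I = {}")
    case False
    then show thesis using that[of "Min (d ` I)"] assms g by simp
  qed (use that in blast)
  have "x = \<zero>\<^bsub>F.F\<^esub>" if n: "n < n0" and x: "x \<in> grade F.F n" for n x
  proof (rule F.FS_eqI)
    show "x \<in> carrier F.F" using x by (simp add: F.FS_grade)
    show "x s = \<zero>\<^bsub>F.F\<^esub> s" if s: "s \<in> I" for s
    proof -
      have "x s \<in> grade A (n - d s)" using x s by (simp add: F.FS_grade)
      then show ?thesis using n n0[OF s] s grade_neg[of "n - d s"] by (simp add: F.FS_zero)
    qed
  qed simp
  then have "\<forall>n<n0. grade F.F n = {\<zero>\<^bsub>F.F\<^esub>}" using FM.grade_zero by blast
  then show ?thesis unfolding QF by (rule exI)
qed


lemma Q_positive_part_mult: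
  "x \<in> positive_part_mult A (Q g) \<longleftrightarrow> x \<in> carrier (Q g) \<and> (\<forall>s\<in>fst g. hcomp A 0 (x s) = \<zero>\<^bsub>A\<^esub>)"
  unfolding Q_def by (rule principal_family.positive_part_mult_FS) (rule std_family)

text \<open>
  The induction hypothesis for the construction of a minimal resolution: \<^term>\<open>Z\<close> is the syzygy
  to be covered next, and \<^term>\<open>L\<close> the corresponding syzygy of a given resolution with term
  \<^term>\<open>R\<close>. The maps \<^term>\<open>\<phi>\<close> and \<^term>\<open>\<psi>\<close> compare the two resolutions, and \<^term>\<open>t\<close> is what
  remains of a homotopy between \<^term>\<open>\<psi> \<circ> \<phi>\<close> and the identity.
\<close>

definition comparable :: "('a, nat \<Rightarrow> 'a) gmodule \<Rightarrow> (nat \<Rightarrow> 'a) set \<Rightarrow>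
    nat set \<times> (nat \<Rightarrow> 'r) \<times> (nat \<Rightarrow> int) \<Rightarrow> (nat \<Rightarrow> 'a) set \<Rightarrow> bool" where
  "comparable R L g Z \<longleftrightarrow> finite (fst g) \<and> graded_submodule A (Q g) Z \<and> Z \<subseteq> positive_part_mult A (Q g) \<and>
     (\<exists>\<phi>\<in>gmodule_hom A (Q g) R. \<exists>\<psi>\<in>gmodule_hom A R (Q g). \<exists>t\<in>gmodule_hom A (Q g) (Q g).
        t ` carrier (Q g) \<subseteq> Z \<and> \<phi> ` Z \<subseteq> L \<and> \<psi> ` L \<subseteq> Z \<and> (\<forall>z\<in>Z. \<psi> (\<phi> z) = z \<oplus>\<^bsub>Q g\<^esub> t z))"

text \<open>
  Since \<open>Z \<subseteq> J Q\<close>, the map \<^term>\<open>t\<close> sends \<^term>\<open>Z\<close> into \<open>J Z\<close>, so modulo \<open>J Z\<close> every element of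
  \<^term>\<open>Z\<close> is in the image of \<^term>\<open>\<psi>\<close>. By Nakayama \<^term>\<open>Z\<close> is equal to this image, which is
  finitely generated if \<^term>\<open>R'\<close> is.
\<close>

lemma syzygy_image:
  fixes R R' :: "('a, nat \<Rightarrow> 'a) gmodule"
  assumes R: "gmod K A R" and R': "gmod K A R'" and \<delta>: "\<delta> \<in> gmodule_hom A R' R"
    and "finite (fst g)" and Z: "graded_submodule A (Q g) Z" and ZJ: "Z \<subseteq> positive_part_mult A (Q g)"
    and \<phi>: "\<phi> \<in> gmodule_hom A (Q g) R" and \<psi>: "\<psi> \<in> gmodule_hom A R (Q g)"
    and t: "t \<in> gmodule_hom A (Q g) (Q g)" "t ` carrier (Q g) \<subseteq> Z"
    and \<phi>Z: "\<phi> ` Z \<subseteq> \<delta> ` carrier R'" and \<psi>L: "\<psi> ` \<delta> ` carrier R' \<subseteq> Z"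
    and id: "\<And>z. z \<in> Z \<Longrightarrow> \<psi> (\<phi> z) = z \<oplus>\<^bsub>Q g\<^esub> t z"
  shows "(\<lambda>x. \<psi> (\<delta> x)) ` carrier R' = Z"
proof -
  let ?M = "restrict_module (Q g) Z"
  note QG = Q_gmod[of g]
  interpret Qg: gmod K A "Q g" by (rule QG)
  note Mg = restrict_module_gmod(1)[OF QG Z]
  interpret M: gmod K A ?M by (rule Mg)
  have Zc: "z \<in> carrier (Q g)" if "z \<in> Z" for z
    by (rule positive_part_mult_closed[OF QG subsetD[OF ZJ that]])
  have into_M: "f \<in> gmodule_hom A X ?M"
    if "f \<in> gmodule_hom A X (Q g)" "f ` carrier X \<subseteq> Z" "gmod K A X" for f and X :: "('a, nat \<Rightarrow> 'a) gmodule"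
  proof -
    interpret X: gmod K A X by fact
    show ?thesis
      by (rule gmodule_homI)
        (use that(2) X.grade_closed hom_grade[OF that(1)] in
          \<open>auto simp: hom_add[OF that(1)] hom_smult[OF that(1)]\<close>)
  qed
  have \<psi>\<delta>: "(\<lambda>x. \<psi> (\<delta> x)) \<in> gmodule_hom A R' ?M"
    using \<psi>L by (intro into_M hom_comp[OF \<delta> \<psi>] R') auto
  have tM: "t \<in> gmodule_hom A (Q g) ?M" by (rule into_M) (fact t QG)+
  let ?H = "(\<lambda>x. \<psi> (\<delta> x)) ` carrier R'"
  have H: "graded_submodule A ?M ?H" by (rule graded_submodule_image[OF R' Mg \<psi>\<delta>])
  obtain n0 where n0: "\<And>n. n < n0 \<Longrightarrow> grade (Q g) n = {\<zero>\<^bsub>Q g\<^esub>}"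
    using Q_bounded_below[OF assms(4)] by blast
  have sub: "additive_subgroup (positive_part_mult A ?M) ?M" by (rule positive_part_mult_subgroup[OF Mg])
  have "carrier ?M \<subseteq> ?H"
  proof (rule graded_nakayama[OF Mg])
    show "grade ?M n = {\<zero>\<^bsub>?M\<^esub>}" if "n < n0" for n
      using n0[OF that] M.zero_closed by auto
    show "additive_subgroup ?H ?M" "\<And>a x. a \<in> carrier A \<Longrightarrow> x \<in> ?H \<Longrightarrow> a \<odot>\<^bsub>?M\<^esub> x \<in> ?H"
      "\<And>n x. x \<in> ?H \<Longrightarrow> hcomp ?M n x \<in> ?H"
      using H unfolding graded_submodule_def by blast+
    fix z assume zM: "z \<in> carrier ?M"
    then have z: "z \<in> Z" by simp
    then have tz: "t z \<in> positive_part_mult A ?M"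
      using ZJ by (intro hom_positive_part_mult[OF QG Mg tM]) auto
    then have tc: "t z \<in> carrier ?M" by (rule positive_part_mult_closed[OF Mg])
    have ptz: "\<ominus>\<^bsub>?M\<^esub> t z \<in> positive_part_mult A ?M" by (rule additive_subgroup.a_inv_closed[OF sub tz])
    have "\<phi> z \<in> \<delta> ` carrier R'" using \<phi>Z z by auto
    then have h: "\<psi> (\<phi> z) \<in> ?H" by auto
    have "(z \<oplus>\<^bsub>?M\<^esub> t z) \<oplus>\<^bsub>?M\<^esub> (\<ominus>\<^bsub>?M\<^esub> t z) = z \<oplus>\<^bsub>?M\<^esub> (t z \<oplus>\<^bsub>?M\<^esub> (\<ominus>\<^bsub>?M\<^esub> t z))"
      by (rule M.a_assoc[OF zM tc M.a_inv_closed[OF tc]])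
    also have "t z \<oplus>\<^bsub>?M\<^esub> (\<ominus>\<^bsub>?M\<^esub> t z) = \<zero>\<^bsub>?M\<^esub>" by (rule M.r_neg[OF tc])
    also have "z \<oplus>\<^bsub>?M\<^esub> \<zero>\<^bsub>?M\<^esub> = z" by (rule M.r_zero[OF zM])
    finally have "z = (z \<oplus>\<^bsub>?M\<^esub> t z) \<oplus>\<^bsub>?M\<^esub> (\<ominus>\<^bsub>?M\<^esub> t z)" by (rule HOL.sym)
    also have "z \<oplus>\<^bsub>?M\<^esub> t z = \<psi> (\<phi> z)" using id[OF z] by simp
    finally have "z = \<psi> (\<phi> z) \<oplus>\<^bsub>?M\<^esub> (\<ominus>\<^bsub>?M\<^esub> t z)" .
    then show "\<exists>h\<in>?H. \<exists>y\<in>positive_part_mult A ?M. z = h \<oplus>\<^bsub>?M\<^esub> y" using h ptz by blast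
  qed
  then show ?thesis using \<psi>L by auto
qed

text \<open>
  The maps \<^term>\<open>\<phi>\<close> and \<^term>\<open>\<psi>\<close> are lifted along the new differentials to \<^term>\<open>\<phi>'\<close> and
  \<^term>\<open>\<psi>'\<close>, and \<^term>\<open>t\<close> to a map \<^term>\<open>T\<close> with \<open>D T = t\<close>. Then \<open>\<psi>' \<phi>' - 1 - T D\<close> is annihilated by
  \<open>D\<close>, so it takes values in the next syzygy; on this syzygy \<open>T D\<close> vanishes, and the difference
  between \<open>\<psi>' \<phi>'\<close> and the identity is again of the required form.
\<close>

lemma comparable_step:
  assumes R: "gmod K A R" and R': "gmod K A R'" and R'': "gmod K A R''"
    and \<delta>: "\<delta> \<in> gmodule_hom A R' R" and \<delta>': "\<delta>' \<in> gmodule_hom A R'' R'"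
    and proj: "graded_projective A R'" and fg: "finitely_generated A R'"
    and exact: "\<delta>' ` carrier R'' = {x \<in> carrier R'. \<delta> x = \<zero>\<^bsub>R\<^esub>}"
    and c: "comparable R (\<delta> ` carrier R') g Z"
  shows "\<exists>g' Z'. comparable R' (\<delta>' ` carrier R'') g' Z' \<and>
    (\<exists>D\<in>gmodule_hom A (Q g') (Q g). D ` carrier (Q g') = Z \<and> Z' = {x \<in> carrier (Q g'). D x = \<zero>\<^bsub>Q g\<^esub>})"
proof -
  have fin: "finite (fst g)" and Z: "graded_submodule A (Q g) Z" and ZJ: "Z \<subseteq> positive_part_mult A (Q g)"
    using c unfolding comparable_def by blast+
  from c have "\<exists>\<phi>\<in>gmodule_hom A (Q g) R. \<exists>\<psi>\<in>gmodule_hom A R (Q g). \<exists>t\<in>gmodule_hom A (Q g) (Q g).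
        t ` carrier (Q g) \<subseteq> Z \<and> \<phi> ` Z \<subseteq> \<delta> ` carrier R' \<and> \<psi> ` \<delta> ` carrier R' \<subseteq> Z \<and>
        (\<forall>z\<in>Z. \<psi> (\<phi> z) = z \<oplus>\<^bsub>Q g\<^esub> t z)"
    unfolding comparable_def by (elim conjE)
  then obtain \<phi> \<psi> t where \<phi>: "\<phi> \<in> gmodule_hom A (Q g) R" and \<psi>: "\<psi> \<in> gmodule_hom A R (Q g)"
    and t1: "t \<in> gmodule_hom A (Q g) (Q g)" and cmp: "t ` carrier (Q g) \<subseteq> Z \<and>
      \<phi> ` Z \<subseteq> \<delta> ` carrier R' \<and> \<psi> ` \<delta> ` carrier R' \<subseteq> Z \<and> (\<forall>z\<in>Z. \<psi> (\<phi> z) = z \<oplus>\<^bsub>Q g\<^esub> t z)"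
    by (elim bexE)
  have t: "t \<in> gmodule_hom A (Q g) (Q g)" "t ` carrier (Q g) \<subseteq> Z"
    and \<phi>Z: "\<phi> ` Z \<subseteq> \<delta> ` carrier R'" and \<psi>L: "\<psi> ` \<delta> ` carrier R' \<subseteq> Z"
    and id: "\<And>z. z \<in> Z \<Longrightarrow> \<psi> (\<phi> z) = z \<oplus>\<^bsub>Q g\<^esub> t z"
    using t1 cmp by simp_all
  note QG = Q_gmod
  interpret Qg: gmod K A "Q g" by (rule QG)
  interpret R: gmod K A R by (rule R)
  interpret R': gmod K A R' by (rule R')
  let ?M = "restrict_module (Q g) Z"
  note Mg = restrict_module_gmod(1)[OF QG Z]
  interpret M: gmod K A ?M by (rule Mg)
  have image: "(\<lambda>x. \<psi> (\<delta> x)) ` carrier R' = Z"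
    by (rule syzygy_image[OF R R' \<delta> fin Z ZJ \<phi> \<psi> t \<phi>Z \<psi>L]) (rule id)
  have \<psi>\<delta>: "(\<lambda>x. \<psi> (\<delta> x)) \<in> gmodule_hom A R' ?M"
    by (rule gmodule_homI)
      (use image hom_comp[OF \<delta> \<psi>] R'.grade_closed in
        \<open>auto simp: hom_add[OF hom_comp[OF \<delta> \<psi>]] hom_smult[OF hom_comp[OF \<delta> \<psi>]]
          hom_grade[OF hom_comp[OF \<delta> \<psi>]]\<close>)
  obtain I0 :: "nat set" and c0 d0 h0 where h0: "h0 \<in> gmodule_hom A (FS A I0 (\<lambda>s. e (c0 s)) d0) R'"
    "finite I0" "h0 ` carrier (FS A I0 (\<lambda>s. e (c0 s)) d0) = carrier R'"
    using finitely_generated_cover[OF R' fg] by blast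
  have h0M: "(\<lambda>x. \<psi> (\<delta> (h0 x))) ` carrier (FS A I0 (\<lambda>s. e (c0 s)) d0) = carrier ?M"
    using image h0(3) by (metis image_image restrict_module_simps(1))
  have "\<exists>(I :: nat set) c d. \<exists>h\<in>gmodule_hom A (FS A I (\<lambda>s. e (c s)) d) ?M. finite I \<and>
      h ` carrier (FS A I (\<lambda>s. e (c s)) d) = carrier ?M"
    using hom_comp[OF h0(1) \<psi>\<delta>] h0(2) h0M by blast
  from minimal_cover[OF Mg this]
  obtain I :: "nat set" and c' d' D where D: "D \<in> gmodule_hom A (FS A I (\<lambda>s. e (c' s)) d') ?M"
    "finite I" "D ` carrier (FS A I (\<lambda>s. e (c' s)) d') = carrier ?M"
    "\<forall>x\<in>carrier (FS A I (\<lambda>s. e (c' s)) d'). D x = \<zero>\<^bsub>?M\<^esub> \<longrightarrow>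
         x \<in> positive_part_mult A (FS A I (\<lambda>s. e (c' s)) d')"
    by blast
  define g' where "g' = (I, c', d')"
  have Qg': "FS A I (\<lambda>s. e (c' s)) d' = Q g'" by (simp add: Q_def g'_def)
  interpret F: principal_family K A I "\<lambda>s. e (c' s)" d' by (rule std_family)
  obtain Ig cg dg where g: "g = (Ig, cg, dg)" by (cases g)
  interpret G: principal_family K A Ig "\<lambda>s. e (cg s)" dg by (rule std_family)
  have Qg: "G.F = Q g" by (simp add: Q_def g)
  interpret Q': gmod K A "Q g'" by (rule QG)
  note D = D[unfolded Qg']
  have Zc: "z \<in> carrier (Q g)" if "z \<in> Z" for z
    by (rule positive_part_mult_closed[OF QG subsetD[OF ZJ that]])
  have D1: "D \<in> gmodule_hom A (Q g') (Q g)"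
    by (rule gmodule_homI)
      (use hom_closed[OF D(1)] hom_grade[OF D(1)] Zc in
        \<open>auto simp: hom_add[OF D(1)] hom_smult[OF D(1)]\<close>)
  have DZ: "D ` carrier (Q g') = Z" using D(3) by simp
  have DZ': "D x \<in> Z" if "x \<in> carrier (Q g')" for x using DZ that by blast
  define Z' where "Z' = {x \<in> carrier (Q g'). D x = \<zero>\<^bsub>Q g\<^esub>}"
  have Z'J: "Z' \<subseteq> positive_part_mult A (Q g')" using D(4) by (auto simp: Z'_def)
  have Z'sub: "graded_submodule A (Q g') Z'"
    unfolding Z'_def by (rule graded_submodule_kernel[OF QG QG D1])
  have "(\<lambda>x. \<phi> (D x)) ` carrier (Q g') \<subseteq> \<delta> ` carrier R'"
    using \<phi>Z DZ' by auto
  from F.FS_lift[OF R' R, unfolded Qg', OF hom_comp[OF D1 \<phi>] \<delta> this]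
  obtain \<phi>' where \<phi>': "\<phi>' \<in> gmodule_hom A (Q g') R'" "\<forall>x\<in>carrier (Q g'). \<delta> (\<phi>' x) = \<phi> (D x)"
    by blast
  have "(\<lambda>x. \<psi> (\<delta> x)) ` carrier R' \<subseteq> D ` carrier (Q g')" using image DZ by simp
  from graded_projective_lift[OF proj QG QG hom_comp[OF \<delta> \<psi>] D1 this]
  obtain \<psi>' where \<psi>': "\<psi>' \<in> gmodule_hom A R' (Q g')" "\<forall>x\<in>carrier R'. D (\<psi>' x) = \<psi> (\<delta> x)"
    by blast
  have "t ` carrier (Q g) \<subseteq> D ` carrier (Q g')" using t(2) DZ by simp
  from G.FS_lift[OF QG QG, unfolded Qg, OF t(1) D1 this]
  obtain T where T: "T \<in> gmodule_hom A (Q g) (Q g')" "\<forall>x\<in>carrier (Q g). D (T x) = t x"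
    by blast
  define t' where "t' x = \<psi>' (\<phi>' x) \<oplus>\<^bsub>Q g'\<^esub> (\<ominus>\<^bsub>Q g'\<^esub> (x \<oplus>\<^bsub>Q g'\<^esub> T (D x)))" for x
  have idh: "(\<lambda>x. x) \<in> gmodule_hom A (Q g') (Q g')" by (rule gmodule_homI) simp_all
  have t'h: "t' \<in> gmodule_hom A (Q g') (Q g')"
    unfolding t'_def[abs_def]
    by (rule hom_add_fun[OF QG hom_comp[OF \<phi>'(1) \<psi>'(1)]
      hom_uminus_fun[OF QG hom_add_fun[OF QG idh hom_comp[OF D1 T(1)]]]])
  have D0: "D \<zero>\<^bsub>Q g'\<^esub> = \<zero>\<^bsub>Q g\<^esub>" and T0: "T \<zero>\<^bsub>Q g\<^esub> = \<zero>\<^bsub>Q g'\<^esub>"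
    using hom_zero[OF QG QG D1] hom_zero[OF QG QG T(1)] .
  have \<phi>0: "\<phi> \<zero>\<^bsub>Q g\<^esub> = \<zero>\<^bsub>R\<^esub>" and \<psi>0: "\<psi> \<zero>\<^bsub>R\<^esub> = \<zero>\<^bsub>Q g\<^esub>"
    using hom_zero[OF QG R \<phi>] hom_zero[OF R QG \<psi>] .
  have "t' x \<in> Z'" if x: "x \<in> carrier (Q g')" for x
  proof -
    have xc: "\<phi>' x \<in> carrier R'" "\<psi>' (\<phi>' x) \<in> carrier (Q g')" "D x \<in> carrier (Q g)"
      "T (D x) \<in> carrier (Q g')"
      using x hom_closed[OF \<phi>'(1)] hom_closed[OF \<psi>'(1)] hom_closed[OF D1] hom_closed[OF T(1)] by auto
    have tc: "t (D x) \<in> carrier (Q g)" using hom_closed[OF t(1)] xc by simp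
    have "D (t' x) = D (\<psi>' (\<phi>' x)) \<oplus>\<^bsub>Q g\<^esub> (\<ominus>\<^bsub>Q g\<^esub> (D x \<oplus>\<^bsub>Q g\<^esub> D (T (D x))))"
      unfolding t'_def using x xc by (simp add: hom_add[OF D1] hom_uminus[OF QG QG D1])
    also have "D (\<psi>' (\<phi>' x)) = D x \<oplus>\<^bsub>Q g\<^esub> t (D x)"
      using \<psi>'(2) \<phi>'(2) x xc(1) id[OF DZ'[OF x]] by simp
    also have "D (T (D x)) = t (D x)" using T(2) xc by simp
    finally have "D (t' x) = \<zero>\<^bsub>Q g\<^esub>" using xc tc by (simp add: Qg.r_neg)
    then show ?thesis using hom_closed[OF t'h x] by (simp add: Z'_def)
  qed
  then have t'Z: "t' ` carrier (Q g') \<subseteq> Z'" by blast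
  have id': "\<psi>' (\<phi>' z) = z \<oplus>\<^bsub>Q g'\<^esub> t' z" if z: "z \<in> Z'" for z
  proof -
    have zc: "z \<in> carrier (Q g')" "D z = \<zero>\<^bsub>Q g\<^esub>" using z by (simp_all add: Z'_def)
    have pc: "\<psi>' (\<phi>' z) \<in> carrier (Q g')" using zc hom_closed[OF \<phi>'(1)] hom_closed[OF \<psi>'(1)] by simp
    have "z \<oplus>\<^bsub>Q g'\<^esub> t' z = z \<oplus>\<^bsub>Q g'\<^esub> (\<psi>' (\<phi>' z) \<oplus>\<^bsub>Q g'\<^esub> (\<ominus>\<^bsub>Q g'\<^esub> z))"
      unfolding t'_def using zc T0 by simp
    also have "\<dots> = \<psi>' (\<phi>' z)" using zc(1) pc by (rule Q'.add_diff_cancel_middle)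
    finally show ?thesis by simp
  qed
  have "\<phi>' ` Z' \<subseteq> \<delta>' ` carrier R''"
    unfolding exact using \<phi>'(2) hom_closed[OF \<phi>'(1)] \<phi>0 by (auto simp: Z'_def)
  moreover have "\<psi>' ` \<delta>' ` carrier R'' \<subseteq> Z'"
    unfolding exact using \<psi>'(2) hom_closed[OF \<psi>'(1)] \<psi>0 by (auto simp: Z'_def)
  ultimately have "comparable R' (\<delta>' ` carrier R'') g' Z'"
    unfolding comparable_def
    by (intro conjI Z'sub Z'J bexI[OF _ \<phi>'(1)] bexI[OF _ \<psi>'(1)] bexI[OF _ t'h] t'Z ballI id')
      (simp_all add: g'_def D(2))
  then show ?thesis using D1 DZ Z'_def by blast
qed

text \<open>
  Both resolutions start with a cover of the same module, and the comparison maps lift its identity.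
\<close>

lemma comparable_base:
  assumes S: "gmod K A S" and R: "gmod K A R" and R': "gmod K A R'"
    and \<epsilon>: "\<epsilon> \<in> gmodule_hom A (Q g) S" "\<epsilon> ` carrier (Q g) = carrier S"
    and ker: "\<And>x. x \<in> carrier (Q g) \<Longrightarrow> \<epsilon> x = \<zero>\<^bsub>S\<^esub> \<Longrightarrow> x \<in> positive_part_mult A (Q g)"
    and fin: "finite (fst g)"
    and \<eta>: "\<eta> \<in> gmodule_hom A R S" "\<eta> ` carrier R = carrier S"
    and proj: "graded_projective A R"
    and exact: "\<delta> ` carrier R' = {x \<in> carrier R. \<eta> x = \<zero>\<^bsub>S\<^esub>}"
  shows "comparable R (\<delta> ` carrier R') g {x \<in> carrier (Q g). \<epsilon> x = \<zero>\<^bsub>S\<^esub>}"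
proof -
  note QG = Q_gmod
  obtain I c d where g: "g = (I, c, d)" by (cases g)
  interpret G: principal_family K A I "\<lambda>s. e (c s)" d by (rule std_family)
  have Qg: "G.F = Q g" by (simp add: Q_def g)
  interpret Qg: gmod K A "Q g" by (rule QG)
  interpret S: gmod K A S by (rule S)
  let ?Z = "{x \<in> carrier (Q g). \<epsilon> x = \<zero>\<^bsub>S\<^esub>}"
  obtain \<phi> where \<phi>: "\<phi> \<in> gmodule_hom A (Q g) R" "\<forall>x\<in>carrier (Q g). \<eta> (\<phi> x) = \<epsilon> x"
    using G.FS_lift[OF R S, unfolded Qg, OF \<epsilon>(1) \<eta>(1)] \<epsilon>(2) \<eta>(2) by blast
  obtain \<psi> where \<psi>: "\<psi> \<in> gmodule_hom A R (Q g)" "\<forall>x\<in>carrier R. \<epsilon> (\<psi> x) = \<eta> x"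
    using graded_projective_lift[OF proj QG S \<eta>(1) \<epsilon>(1)] \<epsilon>(2) \<eta>(2) by blast
  define t where "t x = \<psi> (\<phi> x) \<oplus>\<^bsub>Q g\<^esub> (\<ominus>\<^bsub>Q g\<^esub> x)" for x
  have idh: "(\<lambda>x. x) \<in> gmodule_hom A (Q g) (Q g)" by (rule gmodule_homI) simp_all
  have t: "t \<in> gmodule_hom A (Q g) (Q g)"
    unfolding t_def[abs_def]
    by (rule hom_add_fun[OF QG hom_comp[OF \<phi>(1) \<psi>(1)] hom_uminus_fun[OF QG idh]])
  have pc: "\<phi> x \<in> carrier R" "\<psi> (\<phi> x) \<in> carrier (Q g)" if "x \<in> carrier (Q g)" for x
    using that hom_closed[OF \<phi>(1)] hom_closed[OF \<psi>(1)] by auto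
  have "t x \<in> ?Z" if x: "x \<in> carrier (Q g)" for x
  proof -
    have "\<epsilon> (t x) = \<epsilon> (\<psi> (\<phi> x)) \<oplus>\<^bsub>S\<^esub> (\<ominus>\<^bsub>S\<^esub> \<epsilon> x)"
      unfolding t_def using x pc by (simp add: hom_add[OF \<epsilon>(1)] hom_uminus[OF QG S \<epsilon>(1)])
    also have "\<epsilon> (\<psi> (\<phi> x)) = \<epsilon> x" using \<phi>(2) \<psi>(2) x pc by simp
    finally show ?thesis using hom_closed[OF t x] hom_closed[OF \<epsilon>(1) x] by (simp add: S.r_neg)
  qed
  then have tZ: "t ` carrier (Q g) \<subseteq> ?Z" by blast
  have id: "\<psi> (\<phi> z) = z \<oplus>\<^bsub>Q g\<^esub> t z" if "z \<in> ?Z" for z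
    unfolding t_def using that pc[of z] Qg.add_diff_cancel_middle[of z "\<psi> (\<phi> z)"] by simp
  have 1: "\<phi> ` ?Z \<subseteq> \<delta> ` carrier R'"
    unfolding exact using \<phi>(2) pc by auto
  have 2: "\<psi> ` \<delta> ` carrier R' \<subseteq> ?Z"
    unfolding exact using \<psi>(2) hom_closed[OF \<psi>(1)] by auto
  have 3: "?Z \<subseteq> positive_part_mult A (Q g)" using ker by blast
  show ?thesis
    unfolding comparable_def
    by (intro conjI fin 3 graded_submodule_kernel[OF QG S \<epsilon>(1)] bexI[OF _ \<phi>(1)] bexI[OF _ \<psi>(1)]
      bexI[OF _ t] tZ 1 2 ballI id)
qed

lemma minimal_resolution_exists:
  assumes "FP_infinity A (vertex_simple A e j)"
  shows "\<exists>g d \<epsilon>. (\<forall>p. finite (fst (g p))) \<and>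
    minimal_fg_resolution A (vertex_simple A e j) (\<lambda>p. Q (g p)) d \<epsilon>"
proof -
  let ?S = "vertex_simple A e j"
  obtain R :: "nat \<Rightarrow> ('a, nat \<Rightarrow> 'a) gmodule" and \<delta> \<eta> where res: "fg_projective_resolution A ?S R \<delta> \<eta>"
    using assms unfolding FP_infinity_def by (elim exE)
  have R: "gmod K A (R p)" "graded_projective A (R p)" "finitely_generated A (R p)" for p
    using res by (auto simp: fg_projective_resolution_def gmod_iff)
  have \<delta>: "\<delta> p \<in> gmodule_hom A (R (Suc p)) (R p)" for p
    using res by (auto simp: fg_projective_resolution_def)
  have \<eta>: "\<eta> \<in> gmodule_hom A (R 0) ?S" "\<eta> ` carrier (R 0) = carrier ?S"
    "\<delta> 0 ` carrier (R (Suc 0)) = {x \<in> carrier (R 0). \<eta> x = \<zero>\<^bsub>?S\<^esub>}"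
    using res by (auto simp: fg_projective_resolution_def)
  have exact: "\<delta> (Suc p) ` carrier (R (Suc (Suc p))) = {x \<in> carrier (R (Suc p)). \<delta> p x = \<zero>\<^bsub>R p\<^esub>}" for p
    using res by (simp add: fg_projective_resolution_def)
  let ?g0 = "({0}, (\<lambda>_. j), (\<lambda>_. 0)) :: nat set \<times> (nat \<Rightarrow> 'r) \<times> (nat \<Rightarrow> int)"
  obtain \<epsilon> where \<epsilon>: "\<epsilon> \<in> gmodule_hom A (Q ?g0) ?S" "\<epsilon> ` carrier (Q ?g0) = carrier ?S"
    "\<forall>x\<in>carrier (Q ?g0). \<epsilon> x = \<zero>\<^bsub>?S\<^esub> \<longleftrightarrow> hcomp A 0 (x 0) = \<zero>\<^bsub>A\<^esub>"
    using vertex_simple_cover[of j] by blast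
  define P where "P p X \<longleftrightarrow> comparable (R p) (\<delta> p ` carrier (R (Suc p))) (fst X) (snd X) \<and>
      (p = 0 \<longrightarrow> X = (?g0, {x \<in> carrier (Q ?g0). \<epsilon> x = \<zero>\<^bsub>?S\<^esub>}))" for p X
  define rel where "rel X Y \<longleftrightarrow> (\<exists>D\<in>gmodule_hom A (Q (fst Y)) (Q (fst X)).
      D ` carrier (Q (fst Y)) = snd X \<and> snd Y = {x \<in> carrier (Q (fst Y)). D x = \<zero>\<^bsub>Q (fst X)\<^esub>})" for X Y
  have "\<exists>f. \<forall>p. P p (f p) \<and> rel (f p) (f (Suc p))"
  proof (rule dependent_nat_choice)
    show "\<exists>X. P 0 X"
    proof (rule exI[of _ "(?g0, {x \<in> carrier (Q ?g0). \<epsilon> x = \<zero>\<^bsub>?S\<^esub>})"])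
      have "comparable (R 0) (\<delta> 0 ` carrier (R (Suc 0))) ?g0 {x \<in> carrier (Q ?g0). \<epsilon> x = \<zero>\<^bsub>?S\<^esub>}"
      proof (rule comparable_base[OF vertex_simple_gmod R(1) R(1) \<epsilon>(1,2) _ _ \<eta>(1,2) R(2) \<eta>(3)])
        show "x \<in> positive_part_mult A (Q ?g0)" if "x \<in> carrier (Q ?g0)" "\<epsilon> x = \<zero>\<^bsub>?S\<^esub>" for x
          using that \<epsilon>(3) by (simp add: Q_positive_part_mult)
      qed simp
      then show "P 0 (?g0, {x \<in> carrier (Q ?g0). \<epsilon> x = \<zero>\<^bsub>?S\<^esub>})" by (simp add: P_def)
    qed
    fix X p assume "P p X"
    then have "comparable (R p) (\<delta> p ` carrier (R (Suc p))) (fst X) (snd X)" by (simp add: P_def)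
    from comparable_step[OF R(1) R(1) R(1) \<delta> \<delta> R(2) R(3) exact this]
    obtain g' Z' where "comparable (R (Suc p)) (\<delta> (Suc p) ` carrier (R (Suc (Suc p)))) g' Z'"
      "\<exists>D\<in>gmodule_hom A (Q g') (Q (fst X)). D ` carrier (Q g') = snd X \<and>
         Z' = {x \<in> carrier (Q g'). D x = \<zero>\<^bsub>Q (fst X)\<^esub>}"
      by blast
    then show "\<exists>Y. P (Suc p) Y \<and> rel X Y"
      by (intro exI[of _ "(g', Z')"]) (simp add: P_def rel_def)
  qed
  then obtain f where f: "\<And>p. P p (f p)" "\<And>p. rel (f p) (f (Suc p))" by blast
  define g Z where "g p = fst (f p)" and "Z p = snd (f p)" for p
  have comp: "comparable (R p) (\<delta> p ` carrier (R (Suc p))) (g p) (Z p)" for p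
    using f(1)[of p] by (simp add: P_def g_def Z_def)
  have f0: "g 0 = ?g0" "Z 0 = {x \<in> carrier (Q (g 0)). \<epsilon> x = \<zero>\<^bsub>?S\<^esub>}"
    using f(1)[of 0] by (simp_all add: P_def g_def Z_def)
  have "\<forall>p. \<exists>D. D \<in> gmodule_hom A (Q (g (Suc p))) (Q (g p)) \<and> D ` carrier (Q (g (Suc p))) = Z p \<and>
      Z (Suc p) = {x \<in> carrier (Q (g (Suc p))). D x = \<zero>\<^bsub>Q (g p)\<^esub>}"
    using f(2) unfolding rel_def g_def Z_def by blast
  from choice[OF this] obtain D where "\<forall>p. D p \<in> gmodule_hom A (Q (g (Suc p))) (Q (g p)) \<and>
      D p ` carrier (Q (g (Suc p))) = Z p \<and>
      Z (Suc p) = {x \<in> carrier (Q (g (Suc p))). D p x = \<zero>\<^bsub>Q (g p)\<^esub>}"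
    by (elim exE)
  then have D: "\<And>p. D p \<in> gmodule_hom A (Q (g (Suc p))) (Q (g p))"
    "\<And>p. D p ` carrier (Q (g (Suc p))) = Z p"
    "\<And>p. Z (Suc p) = {x \<in> carrier (Q (g (Suc p))). D p x = \<zero>\<^bsub>Q (g p)\<^esub>}"
    by simp_all
  have fin: "finite (fst (g p))" and ZJ: "Z p \<subseteq> positive_part_mult A (Q (g p))" for p
    using comp[of p] by (simp_all add: comparable_def)
  have "minimal_fg_resolution A ?S (\<lambda>p. Q (g p)) D \<epsilon>"
    unfolding minimal_fg_resolution_def fg_projective_resolution_def
  proof (intro conjI allI)
    show "graded_left_module A (Q (g p))" for p using Q_gmod gmod_iff by blast
    show "\<epsilon> \<in> gmodule_hom A (Q (g 0)) ?S" "\<epsilon> ` carrier (Q (g 0)) = carrier ?S"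
      using \<epsilon> f0(1) by simp_all
    show "D 0 ` carrier (Q (g (Suc 0))) = {x \<in> carrier (Q (g 0)). \<epsilon> x = \<zero>\<^bsub>?S\<^esub>}"
      using D(2) f0(2) by simp
    show "D (Suc p) ` carrier (Q (g (Suc (Suc p)))) = {x \<in> carrier (Q (g (Suc p))). D p x = \<zero>\<^bsub>Q (g p)\<^esub>}" for p
      using D(2,3) by simp
    show "D p ` carrier (Q (g (Suc p))) \<subseteq> positive_part_mult A (Q (g p))" for p
      using D(2) ZJ by simp
  qed (simp_all add: Q_projective Q_finitely_generated fin D(1))
  then show ?thesis using fin by blast
qed

end

section \<open>The ground field as a graded algebra\<close>

text \<open>
  A graded vector space is a graded module over the ground field, regarded as an algebra in degree
  zero with a single vertex. In this way the results above apply to multiplicity spaces as well.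
\<close>

definition ground :: "('k, 'z) ring_scheme \<Rightarrow> ('k, 'k) gmodule" where
  "ground K = \<lparr>carrier = carrier K, monoid.mult = monoid.mult K, one = \<one>\<^bsub>K\<^esub>, zero = \<zero>\<^bsub>K\<^esub>,
     add = add K, smult = monoid.mult K, grade = (\<lambda>n. if n = 0 then carrier K else {\<zero>\<^bsub>K\<^esub>})\<rparr>"

lemma ground_simps [simp]:
  "carrier (ground K) = carrier K" "x \<otimes>\<^bsub>ground K\<^esub> y = x \<otimes>\<^bsub>K\<^esub> y" "\<one>\<^bsub>ground K\<^esub> = \<one>\<^bsub>K\<^esub>"
  "\<zero>\<^bsub>ground K\<^esub> = \<zero>\<^bsub>K\<^esub>" "x \<oplus>\<^bsub>ground K\<^esub> y = x \<oplus>\<^bsub>K\<^esub> y" "x \<odot>\<^bsub>ground K\<^esub> y = x \<otimes>\<^bsub>K\<^esub> y"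
  "grade (ground K) n = (if n = 0 then carrier K else {\<zero>\<^bsub>K\<^esub>})"
  by (simp_all add: ground_def)

lemma (in vectorspace) submodule_finsum:
  assumes N: "LinearCombinations.submodule K N V" and T: "finite T" "\<And>t. t \<in> T \<Longrightarrow> f t \<in> N"
  shows "finsum V f T \<in> N"
  using T
proof (induction T rule: finite_induct)
  case empty
  then show ?case using submodule.zero_closed[OF N] by simp
next
  case (insert t T)
  then show ?case
    using submodule.subset[OF N] submodule.m_closed[OF N] by (subst M.finsum_insert) auto
qed

context
  fixes K :: "('k, 'z) ring_scheme"
  assumes K: "field K"
begin

interpretation field K by (rule K)

lemma ground_ring: "ring (ground K)"
proof (rule ringI)
  show "abelian_group (ground K)"
  proof (rule abelian_groupI)
    show "\<exists>y\<in>carrier (ground K). y \<oplus>\<^bsub>ground K\<^esub> x = \<zero>\<^bsub>ground K\<^esub>" if "x \<in> carrier (ground K)" for x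
      using that by (intro bexI[of _ "\<ominus>\<^bsub>K\<^esub> x"]) (simp_all add: l_neg)
  qed (auto simp: a_ac)
  show "monoid (ground K)" by (rule monoidI) (auto simp: m_assoc)
qed (auto simp: l_distr r_distr)

lemma ground_module: "Module.module K (ground K)"
  by (rule moduleI) (auto simp: ring.is_abelian_group[OF ground_ring] l_distr r_distr m_assoc
    intro: is_cring)

lemma ground_vectorspace: "vectorspace K (ground K)"
  using ground_module K by (rule vectorspace.intro)

lemma ground_graded: "graded_grp (ground K)"
proof -
  interpret G: abelian_group "ground K" by (rule ring.is_abelian_group[OF ground_ring])
  have neg: "\<ominus>\<^bsub>ground K\<^esub> x = \<ominus>\<^bsub>K\<^esub> x" if "x \<in> carrier K" for x
    using that G.minus_equality[of "\<ominus>\<^bsub>K\<^esub> x" x] by (simp add: l_neg)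
  have sum: "(\<Oplus>\<^bsub>ground K\<^esub>n\<in>{n::int. n = 0 \<and> P}. f n) = (if P then f 0 else \<zero>\<^bsub>K\<^esub>)"
    if "f 0 \<in> carrier K" for f P
  proof -
    have "{n::int. n = 0 \<and> P} = (if P then {0} else {})" by auto
    then show ?thesis using that by simp
  qed
  let ?p = "\<lambda>(n::int) x. if n = 0 then x else \<zero>\<^bsub>K\<^esub>"
  have supp: "{n. ?p n x \<noteq> \<zero>\<^bsub>ground K\<^esub>} = {n. n = 0 \<and> x \<noteq> \<zero>\<^bsub>K\<^esub>}" for x by auto
  show ?thesis
  proof (rule graded_group_by_projections(1)[where p = ?p])
    show "additive_subgroup (grade (ground K) n) (ground K)" for n
      by (rule G.additive_subgroupI) (auto simp: neg split: if_splits)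
    show "finite {n. ?p n x \<noteq> \<zero>\<^bsub>ground K\<^esub>}" for x unfolding supp by simp
    show "x = (\<Oplus>\<^bsub>ground K\<^esub>n\<in>{n. ?p n x \<noteq> \<zero>\<^bsub>ground K\<^esub>}. ?p n x)" if "x \<in> carrier (ground K)" for x
      unfolding supp using that sum[of "\<lambda>n. ?p n x" "x \<noteq> \<zero>\<^bsub>K\<^esub>"] by simp
  qed (auto simp: G.abelian_group_axioms additive_map_def split: if_splits)
qed

lemma ground_piece_eq: "(ground K)\<lparr>carrier := carrier K\<rparr> = ground K"
  by (simp add: ground_def)

lemma ground_span_one: "LinearCombinations.module.span K (ground K) {\<one>\<^bsub>K\<^esub>} = carrier K"
proof -
  interpret G: vectorspace K "ground K" by (rule ground_vectorspace)
  have "x \<in> G.module.span {\<one>\<^bsub>K\<^esub>}" if "x \<in> carrier K" for x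
  proof -
    have "G.module.lincomb (\<lambda>_. x) {\<one>\<^bsub>K\<^esub>} = x" using that by (simp add: G.module.lincomb_def)
    then show ?thesis
      unfolding G.module.span_def
      using that by (intro CollectI exI[of _ "\<lambda>_. x"] exI[of _ "{\<one>\<^bsub>K\<^esub>}"] conjI) simp_all
  qed
  moreover have "G.module.span {\<one>\<^bsub>K\<^esub>} \<subseteq> carrier K"
    using G.module.span_is_subset2[of "{\<one>\<^bsub>K\<^esub>}"] by simp
  ultimately show ?thesis by blast
qed

lemma ground_zero_space: "vectorspace K ((ground K)\<lparr>carrier := {\<zero>\<^bsub>K\<^esub>}\<rparr>)"
proof -
  interpret G: vectorspace K "ground K" by (rule ground_vectorspace)
  have "VectorSpace.subspace K {\<zero>\<^bsub>K\<^esub>} (ground K)"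
    using ground_vectorspace ground_module
    by (auto simp: VectorSpace.subspace_def LinearCombinations.submodule_def)
  then show ?thesis by (rule G.subspace_is_vs)
qed

lemma zero_space_dim:
  assumes "vectorspace K V" "carrier V = {\<zero>\<^bsub>V\<^esub>}"
  shows "vectorspace.fin_dim K V" "vectorspace.dim K V = 0"
proof -
  interpret V: vectorspace K V by fact
  have "V.module.span {} = carrier V" using V.span_empty assms(2) by simp
  then show "V.fin_dim" unfolding V.fin_dim_def by (intro exI[of _ "{}"]) simp
  have "V.module.span {\<zero>\<^bsub>V\<^esub>} \<subseteq> carrier V" by (rule V.module.span_is_subset2) simp
  moreover have "\<zero>\<^bsub>V\<^esub> \<in> V.module.span {\<zero>\<^bsub>V\<^esub>}" by (rule V.span_zero)
  ultimately have "V.module.span {\<zero>\<^bsub>V\<^esub>} = carrier V" using assms(2) by auto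
  then show "V.dim = 0" by (rule V.dim0I)
qed

lemma ground_dims:
  "vectorspace.fin_dim K ((ground K)\<lparr>carrier := grade (ground K) n\<rparr>)"
  "vectorspace.dim K ((ground K)\<lparr>carrier := grade (ground K) n\<rparr>) = (if n = 0 then 1 else 0)"
proof -
  interpret G: vectorspace K "ground K" by (rule ground_vectorspace)
  have "G.fin_dim" unfolding G.fin_dim_def
    using ground_span_one by (intro exI[of _ "{\<one>\<^bsub>K\<^esub>}"]) simp
  moreover have "G.dim = 1" by (rule G.dim1I[of "\<one>\<^bsub>K\<^esub>"]) (simp_all add: ground_span_one)
  ultimately show "vectorspace.fin_dim K ((ground K)\<lparr>carrier := grade (ground K) n\<rparr>)"
    "vectorspace.dim K ((ground K)\<lparr>carrier := grade (ground K) n\<rparr>) = (if n = 0 then 1 else 0)"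
    using zero_space_dim[OF ground_zero_space]
    by (cases "n = 0"; simp add: ground_piece_eq)+
qed

lemma ground_vertex_algebra: "vertex_graded_algebra K (ground K) (\<lambda>_::unit. \<one>\<^bsub>K\<^esub>)"
proof (intro vertex_graded_algebra.intro graded_algebra.intro vertex_graded_algebra_axioms.intro)
  show "field K" by (rule K)
  show "ring (ground K)" by (rule ground_ring)
  show "Module.module K (ground K)" by (rule ground_module)
  show "graded_space K (ground K)"
    unfolding graded_space_def using ground_vectorspace graded_grp.graded[OF ground_graded] by auto
  show "vectorspace.fin_dim K ((ground K)\<lparr>carrier := grade (ground K) n\<rparr>)" for n
    by (rule ground_dims)
  show "primitive_idempotent (ground K) \<one>\<^bsub>K\<^esub>"
    unfolding primitive_idempotent_def using integral by auto
  fix x assume x: "x \<in> grade (ground K) 0"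
  interpret G: abelian_group "ground K" by (rule ring.is_abelian_group[OF ground_ring])
  have "(\<Oplus>\<^bsub>ground K\<^esub> i\<in>UNIV. c i \<odot>\<^bsub>ground K\<^esub> \<one>\<^bsub>K\<^esub>) = c ()" if "c () \<in> carrier K" for c :: "unit \<Rightarrow> 'k"
    using that by (simp add: UNIV_unit)
  then show "\<exists>!c. (\<forall>i::unit. c i \<in> carrier K) \<and> x = (\<Oplus>\<^bsub>ground K\<^esub> i\<in>UNIV. c i \<odot>\<^bsub>ground K\<^esub> \<one>\<^bsub>K\<^esub>)"
    using x by (intro ex1I[of _ "\<lambda>_. x"]) (auto simp: fun_eq_iff)
qed (auto simp: m_assoc m_lcomm split: if_splits)

lemma gmod_ground_iff: "gmod K (ground K) W \<longleftrightarrow> graded_space K W"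
proof -
  interpret G: vertex_graded_algebra K "ground K" "\<lambda>_::unit. \<one>\<^bsub>K\<^esub>" by (rule ground_vertex_algebra)
  show ?thesis
  proof
    assume "gmod K (ground K) W"
    then interpret W: gmod K "ground K" W .
    have "Module.module K W"
      by (rule moduleI)
        (use is_cring W.abelian_group_axioms W.smult_closed W.smult_l_distr W.smult_r_distr
          W.smult_assoc W.smult_one in auto)
    then show "graded_space K W"
      unfolding graded_space_def
      using K W.graded W.grade_smult[of _ 0] by (auto intro: vectorspace.intro)
  next
    assume W: "graded_space K W"
    then interpret W: vectorspace K W by (simp add: graded_space_def)
    show "gmod K (ground K) W"
    proof (rule G.gmodI)
      show "left_module (ground K) W"
        by (rule left_module.intro)
          (auto simp: ground_ring W.M.abelian_group_axioms W.smult_l_distr W.smult_r_distr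
            W.smult_assoc1)
      show "graded_group W" using W by (simp add: graded_space_def)
      fix m n a x assume "a \<in> grade (ground K) m" "x \<in> grade W n"
      moreover have g: "additive_subgroup (grade W k) W" for k
        using W by (simp add: graded_space_def graded_group_def)
      moreover note additive_subgroup.zero_closed[OF g] additive_subgroup.a_subset[OF g]
      ultimately show "a \<odot>\<^bsub>W\<^esub> x \<in> grade W (m + n)"
        using W by (auto simp: graded_space_def subset_iff split: if_splits)
    qed
  qed
qed

lemma fin_dim_finitely_generated:
  assumes W: "vectorspace K W" and "vectorspace.fin_dim K W"
  shows "finitely_generated (ground K) W"
proof -
  interpret W: vectorspace K W by fact
  obtain S where S: "finite S" "S \<subseteq> carrier W" "W.module.span S = carrier W"
    using assms(2) unfolding W.fin_dim_def by (elim exE conjE)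
  let ?X = "{a \<odot>\<^bsub>W\<^esub> s | a s. a \<in> carrier (ground K) \<and> s \<in> S}"
  have X: "?X \<subseteq> carrier W" using S(2) by auto
  have sub: "additive_subgroup (generate (add_monoid W) ?X) W"
    by (rule W.M.generate_additive_subgroup[OF X])
  have "carrier W \<subseteq> generate (add_monoid W) ?X"
  proof
    fix x assume "x \<in> carrier W"
    then have "x \<in> W.module.span S" using S(3) by simp
    then obtain a T where "finite T \<and> T \<subseteq> S \<and> a \<in> T \<rightarrow> carrier K" "x = W.module.lincomb a T"
      unfolding W.module.span_def by (elim CollectE exE conjE) simp
    moreover from this have "(\<Oplus>\<^bsub>W\<^esub>v\<in>T. a v \<odot>\<^bsub>W\<^esub> v) \<in> generate (add_monoid W) ?X"
      by (intro W.M.subgroup_finsum[OF sub]) (auto intro!: W.M.generate_incl)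
    ultimately show "x \<in> generate (add_monoid W) ?X" by (simp add: W.module.lincomb_def)
  qed
  then have "carrier W = generate (add_monoid W) ?X"
    using additive_subgroup.a_subset[OF sub] by blast
  then show ?thesis unfolding finitely_generated_def using S by blast
qed

text \<open>
  Over the ground field minimal covers are isomorphisms: their kernels lie in the positive part,
  which is zero for an algebra concentrated in degree zero. This is the existence of homogeneous
  bases.
\<close>

lemma homogeneous_basis:
  assumes W: "graded_space K W" and fd: "vectorspace.fin_dim K W"
  shows "\<exists>(I :: nat set) d. \<exists>h\<in>gmodule_hom (ground K) (FS (ground K) I (\<lambda>_. \<one>\<^bsub>K\<^esub>) d) W.
    finite I \<and> bij_betw h (carrier (FS (ground K) I (\<lambda>_. \<one>\<^bsub>K\<^esub>) d)) (carrier W)"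
proof -
  interpret G: vertex_graded_algebra K "ground K" "\<lambda>_::unit. \<one>\<^bsub>K\<^esub>" by (rule ground_vertex_algebra)
  have Wg: "gmod K (ground K) W" using W gmod_ground_iff by blast
  interpret W: gmod K "ground K" W by (rule Wg)
  have fg: "finitely_generated (ground K) W"
    using W fd by (intro fin_dim_finitely_generated) (simp_all add: graded_space_def)
  obtain I :: "nat set" and d h where
    h: "h \<in> gmodule_hom (ground K) (FS (ground K) I (\<lambda>_. \<one>\<^bsub>K\<^esub>) d) W" and I: "finite I" and
    im: "h ` carrier (FS (ground K) I (\<lambda>_. \<one>\<^bsub>K\<^esub>) d) = carrier W" and
    ker: "\<forall>x\<in>carrier (FS (ground K) I (\<lambda>_. \<one>\<^bsub>K\<^esub>) d). h x = \<zero>\<^bsub>W\<^esub> \<longrightarrow>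
         x \<in> positive_part_mult (ground K) (FS (ground K) I (\<lambda>_. \<one>\<^bsub>K\<^esub>) d)"
    using G.minimal_cover[OF Wg G.finitely_generated_cover[OF Wg fg]] by blast
  interpret F: principal_family K "ground K" I "\<lambda>_. \<one>\<^bsub>K\<^esub>" d by (rule G.std_family)
  interpret FM: gmod K "ground K" F.F by (rule F.FS_gmod)
  have hc0: "hcomp (ground K) 0 x = x" if "x \<in> carrier K" for x
    using G.A.hcomp_homogeneous[of x 0 0] that by simp
  have ker0: "x = \<zero>\<^bsub>F.F\<^esub>" if x: "x \<in> carrier F.F" and hx: "h x = \<zero>\<^bsub>W\<^esub>" for x
  proof (rule F.FS_eqI[OF x FM.zero_closed])
    fix s assume s: "s \<in> I"
    have "x \<in> positive_part_mult (ground K) F.F" using ker x hx by blast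
    then have "hcomp (ground K) 0 (x s) = \<zero>\<^bsub>K\<^esub>" using F.positive_part_mult_FS s by simp
    then show "x s = \<zero>\<^bsub>F.F\<^esub> s" using hc0[of "x s"] F.FS_closed[OF x s] s by (simp add: F.FS_zero)
  qed
  have "inj_on h (carrier F.F)"
  proof (rule inj_onI)
    fix x y assume x: "x \<in> carrier F.F" and y: "y \<in> carrier F.F" and eq: "h x = h y"
    have "h (x \<oplus>\<^bsub>F.F\<^esub> (\<ominus>\<^bsub>F.F\<^esub> y)) = \<zero>\<^bsub>W\<^esub>"
      using x y eq hom_closed[OF h] G.hom_uminus[OF F.FS_gmod Wg h]
      by (simp add: hom_add[OF h] W.r_neg)
    then have "x \<oplus>\<^bsub>F.F\<^esub> (\<ominus>\<^bsub>F.F\<^esub> y) = \<zero>\<^bsub>F.F\<^esub>" using ker0 x y by simp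
    then show "x = y" using x y FM.minus_equality[of x "\<ominus>\<^bsub>F.F\<^esub> y"] by simp
  qed
  then have "bij_betw h (carrier F.F) (carrier W)" using im by (simp add: bij_betw_def)
  then show ?thesis using h I by blast
qed

lemma FS_ground_space:
  "graded_space K (FS (ground K) I (\<lambda>_. \<one>\<^bsub>K\<^esub>) d)"
  "finite I \<Longrightarrow> vectorspace.fin_dim K (FS (ground K) I (\<lambda>_. \<one>\<^bsub>K\<^esub>) d)"
proof -
  interpret G: vertex_graded_algebra K "ground K" "\<lambda>_::unit. \<one>\<^bsub>K\<^esub>" by (rule ground_vertex_algebra)
  interpret F: principal_family K "ground K" I "\<lambda>_. \<one>\<^bsub>K\<^esub>" d by (rule G.std_family)
  show g: "graded_space K F.F" using F.FS_gmod gmod_ground_iff by blast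
  then interpret V: vectorspace K F.F by (simp add: graded_space_def)
  assume I: "finite I"
  let ?S = "(\<lambda>s. unit_vec (ground K) I s \<one>\<^bsub>K\<^esub>) ` I"
  have S: "?S \<subseteq> carrier F.F" by auto
  have sub: "LinearCombinations.submodule K (V.module.span ?S) F.F" by (rule V.module.span_is_submodule[OF S])
  have "carrier F.F \<subseteq> V.module.span ?S"
  proof
    fix x assume x: "x \<in> carrier F.F"
    have "(\<Oplus>\<^bsub>F.F\<^esub>s\<in>I. x s \<odot>\<^bsub>F.F\<^esub> unit_vec (ground K) I s \<one>\<^bsub>K\<^esub>) \<in> V.module.span ?S"
    proof (rule V.submodule_finsum[OF sub I])
      fix s assume s: "s \<in> I"
      then have "unit_vec (ground K) I s \<one>\<^bsub>K\<^esub> \<in> V.module.span ?S"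
        using V.module.in_own_span[OF S] by auto
      then show "x s \<odot>\<^bsub>F.F\<^esub> unit_vec (ground K) I s \<one>\<^bsub>K\<^esub> \<in> V.module.span ?S"
        using submodule.smult_closed[OF sub] F.FS_closed[OF x s] by simp
    qed
    then show "x \<in> V.module.span ?S" using F.FS_decompose[OF x I] by simp
  qed
  then have "V.module.span ?S = carrier F.F" using V.module.span_is_subset2[OF S] by blast
  then show "V.fin_dim" unfolding V.fin_dim_def using I S by blast
qed

end

section \<open>Tensor products with graded vector spaces\<close>

context abelian_group
begin

lemma summset_union:
  assumes "set_mset X \<subseteq> carrier G" "set_mset Y \<subseteq> carrier G"
  shows "summset (X + Y) = summset X \<oplus> summset Y"
  using assms by (induction X) (auto simp: a_assoc summset_carrier)

lemma summset_image_mset_set: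
  assumes "finite J" "\<And>s. s \<in> J \<Longrightarrow> f s \<in> carrier G"
  shows "summset (image_mset f (mset_set J)) = finsum G f J"
  using assms
proof (induction J rule: finite_induct)
  case (insert s J)
  then have "set_mset (image_mset f (mset_set J)) \<subseteq> carrier G" by auto
  then show ?case using insert by (subst finsum_insert) auto
qed simp

end

text \<open>
  The multiplicity spaces \<^term>\<open>W i\<close> have homogeneous bases \<^term>\<open>b s\<close>, where \<^term>\<open>s\<close> ranges over
  the indices with \<^term>\<open>c s = i\<close>, and \<^term>\<open>coord s\<close> are the coordinates with respect to them.
\<close>

locale framed = vertex_graded_algebra K A e
  for K :: "('k, 'z) ring_scheme" and A :: "('k, 'a) gmodule" and e :: "'r::finite \<Rightarrow> 'a" +
  fixes W :: "'r \<Rightarrow> ('k, 'w) gmodule" and I :: "'s set" and c :: "'s \<Rightarrow> 'r" and d :: "'s \<Rightarrow> int"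
    and b :: "'s \<Rightarrow> 'w" and coord :: "'s \<Rightarrow> 'w \<Rightarrow> 'k"
  assumes fin: "finite I"
    and space: "graded_space K (W i)"
    and b_grade: "s \<in> I \<Longrightarrow> b s \<in> grade (W (c s)) (d s)"
    and coord_closed: "\<lbrakk>s \<in> I; w \<in> carrier (W (c s))\<rbrakk> \<Longrightarrow> coord s w \<in> carrier K"
    and coord_add: "\<lbrakk>s \<in> I; w \<in> carrier (W (c s)); w' \<in> carrier (W (c s))\<rbrakk> \<Longrightarrow>
      coord s (w \<oplus>\<^bsub>W (c s)\<^esub> w') = coord s w \<oplus>\<^bsub>K\<^esub> coord s w'"
    and coord_smult: "\<lbrakk>s \<in> I; k \<in> carrier K; w \<in> carrier (W (c s))\<rbrakk> \<Longrightarrow>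
      coord s (k \<odot>\<^bsub>W (c s)\<^esub> w) = k \<otimes>\<^bsub>K\<^esub> coord s w"
    and coord_b: "\<lbrakk>s \<in> I; t \<in> I; c s = c t\<rbrakk> \<Longrightarrow> coord s (b t) = (if s = t then \<one>\<^bsub>K\<^esub> else \<zero>\<^bsub>K\<^esub>)"
    and coord_grade: "\<lbrakk>s \<in> I; w \<in> grade (W (c s)) m; m \<noteq> d s\<rbrakk> \<Longrightarrow> coord s w = \<zero>\<^bsub>K\<^esub>"
    and coord_expand: "w \<in> carrier (W i) \<Longrightarrow> w = (\<Oplus>\<^bsub>W i\<^esub>s\<in>{s\<in>I. c s = i}. coord s w \<odot>\<^bsub>W i\<^esub> b s)"
begin

sublocale F: principal_family K A I "\<lambda>s. e (c s)" d by (rule std_family)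

abbreviation V where "V \<equiv> vertex_projective A e"
abbreviation teq where "teq i \<equiv> tensor_eq K A (V i) (W i)"
abbreviation cls where "cls i X \<equiv> {Y. teq i X Y}"
abbreviation pairs where "pairs i \<equiv> carrier (V i) \<times> carrier (W i)"
abbreviation J where "J i \<equiv> {s\<in>I. c s = i}"

lemma V_gmod: "gmod K A (V i)" by (rule vertex_projective_gmod)

lemma V_carrier: "x \<in> carrier (V i) \<longleftrightarrow> x \<in> carrier A \<and> x \<otimes>\<^bsub>A\<^esub> e i = x"
  by (simp add: vertex_projective_gmod(3))

lemma V_grade: "x \<in> grade (V i) n \<longleftrightarrow> x \<in> grade A n \<and> x \<in> carrier (V i)"
  by (simp add: vertex_projective_simps)

lemmas V_simps = vertex_projective_simps(1-3)

lemma V_smult: "k \<in> carrier K \<Longrightarrow> v \<in> carrier (V i) \<Longrightarrow> k \<odot>\<^bsub>A\<^esub> v \<in> carrier (V i)"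
  by (simp add: V_carrier smult_mult_left)

lemma W_gmod: "gmod K (ground K) (W i)"
  using space gmod_ground_iff[OF field] by blast

lemma b_closed: "s \<in> I \<Longrightarrow> b s \<in> carrier (W (c s))"
  using graded_grp.grade_closed[OF gmod.axioms(2)[OF W_gmod] b_grade] .

lemma b_closed': "s \<in> J i \<Longrightarrow> b s \<in> carrier (W i)"
  using b_closed by auto

lemma tensor_eq_commute: "teq i X Y \<longleftrightarrow> teq i Y X"
  by (rule iffI) (erule tensor_eq.sym)+

lemma teq_pairs: "teq i X Y \<Longrightarrow> set_mset X \<subseteq> pairs i \<and> set_mset Y \<subseteq> pairs i"
proof (induction rule: tensor_eq.induct)
  case (balanced k v w)
  interpret V: gmod K A "V i" by (rule V_gmod)
  interpret W: gmod K "ground K" "W i" by (rule W_gmod)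
  show ?case using balanced W.smult_closed by simp
next
  case (zero w)
  interpret V: gmod K A "V i" by (rule V_gmod)
  show ?case using zero by simp
next
  case (left v v' w)
  interpret V: gmod K A "V i" by (rule V_gmod)
  show ?case using left by simp
next
  case (right v w w')
  interpret W: gmod K "ground K" "W i" by (rule W_gmod)
  show ?case using right by simp
qed auto

lemma cls_eq_iff:
  assumes "set_mset X \<subseteq> pairs i"
  shows "cls i X = cls i Y \<longleftrightarrow> teq i X Y"
proof
  assume "cls i X = cls i Y"
  moreover have "X \<in> cls i X" using tensor_eq.refl[OF assms] by simp
  ultimately have "teq i Y X" by simp
  then show "teq i X Y" by (rule tensor_eq.sym)
next
  assume XY: "teq i X Y"
  show "cls i X = cls i Y"
    using tensor_eq.trans[OF tensor_eq.sym[OF XY]] tensor_eq.trans[OF XY] by blast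
qed

definition act :: "'a \<Rightarrow> ('a \<times> 'w) multiset \<Rightarrow> ('a \<times> 'w) multiset" where
  "act a = image_mset (\<lambda>(v, w). (a \<otimes>\<^bsub>A\<^esub> v, w))"

lemma act_simps [simp]:
  "act a {#} = {#}" "act a (X + Y) = act a X + act a Y" "act a {#(v, w)#} = {#(a \<otimes>\<^bsub>A\<^esub> v, w)#}"
  "act a (add_mset (v, w) X) = add_mset (a \<otimes>\<^bsub>A\<^esub> v, w) (act a X)"
  by (simp_all add: act_def)

lemma act_pairs:
  assumes "a \<in> carrier A" "set_mset X \<subseteq> pairs i"
  shows "set_mset (act a X) \<subseteq> pairs i"
  using assms by (auto simp: act_def V_carrier A.m_assoc subset_iff)

text \<open>
  The scalar action on formal sums respects the balancing relation because multiples of the unit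
  element by scalars of the ground field are central.
\<close>

lemma teq_act: "teq i X Y \<Longrightarrow> a \<in> carrier A \<Longrightarrow> teq i (act a X) (act a Y)"
proof (induction rule: tensor_eq.induct)
  case (refl X)
  then show ?case using act_pairs by (simp add: tensor_eq.refl)
next
  case (sym X Y)
  then show ?case by (simp add: tensor_eq.sym)
next
  case (trans X Y Z)
  from trans.IH(1)[OF trans.prems] trans.IH(2)[OF trans.prems] show ?case by (rule tensor_eq.trans)
next
  case (plus X X' Y Y')
  then show ?case by (simp add: tensor_eq.plus)
next
  case (zero w)
  then show ?case using tensor_eq.zero[of w "W i" K A "V i"] by (simp add: V_simps)
next
  case (left v v' w)
  then show ?case
    using tensor_eq.left[of "a \<otimes>\<^bsub>A\<^esub> v" "V i" "a \<otimes>\<^bsub>A\<^esub> v'" w "W i" K A]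
    by (simp add: V_simps V_carrier A.r_distr A.m_assoc)
next
  case (right v w w')
  then show ?case
    using tensor_eq.right[of "a \<otimes>\<^bsub>A\<^esub> v" "V i" w "W i" w' K A]
    by (simp add: V_carrier A.m_assoc)
next
  case (balanced k v w)
  then have "a \<otimes>\<^bsub>A\<^esub> ((k \<odot>\<^bsub>A\<^esub> \<one>\<^bsub>A\<^esub>) \<otimes>\<^bsub>A\<^esub> v) = (k \<odot>\<^bsub>A\<^esub> \<one>\<^bsub>A\<^esub>) \<otimes>\<^bsub>A\<^esub> (a \<otimes>\<^bsub>A\<^esub> v)"
    by (simp add: V_carrier smult_mult_left smult_mult_right)
  then show ?case
    using tensor_eq.balanced[of k K "a \<otimes>\<^bsub>A\<^esub> v" "V i" w "W i" A] balanced
    by (simp add: V_simps V_carrier A.m_assoc)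
qed

abbreviation T where "T i \<equiv> tensor K A (V i) (W i)"

lemma T_carrier: "carrier (T i) = {cls i X | X. set_mset X \<subseteq> pairs i}"
  by (simp add: tensor_def Let_def)

lemma T_grade: "grade (T i) n =
    {cls i X | X. \<forall>(v, w)\<in>set_mset X. \<exists>m. v \<in> grade (V i) (n - m) \<and> w \<in> grade (W i) m}"
  by (simp add: tensor_def Let_def)

lemma T_add:
  assumes "set_mset X \<subseteq> pairs i" "set_mset Y \<subseteq> pairs i"
  shows "cls i X \<oplus>\<^bsub>T i\<^esub> cls i Y = cls i (X + Y)"
proof -
  have "cls i (X' + Y') = cls i (X + Y)" if "X' \<in> cls i X" "Y' \<in> cls i Y" for X' Y'
  proof -
    have "teq i (X + Y) (X' + Y')" using that by (intro tensor_eq.plus) simp_all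
    then show ?thesis using cls_eq_iff[of "X + Y" i "X' + Y'"] assms by simp
  qed
  moreover have "X \<in> cls i X" "Y \<in> cls i Y" using tensor_eq.refl assms by auto
  ultimately have "(\<Union>X'\<in>cls i X. \<Union>Y'\<in>cls i Y. cls i (X' + Y')) = cls i (X + Y)" by blast
  then show ?thesis by (simp add: tensor_def Let_def)
qed

lemma T_smult:
  assumes "set_mset X \<subseteq> pairs i" "a \<in> carrier A"
  shows "a \<odot>\<^bsub>T i\<^esub> cls i X = cls i (act a X)"
proof -
  have "cls i (act a X') = cls i (act a X)" if "X' \<in> cls i X" for X'
  proof -
    have "teq i (act a X) (act a X')" using that assms by (intro teq_act) simp_all
    then show ?thesis using cls_eq_iff[of "act a X" i "act a X'"] act_pairs assms by simp
  qed
  moreover have "X \<in> cls i X" using tensor_eq.refl assms by auto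
  ultimately have "(\<Union>X'\<in>cls i X. cls i (act a X')) = cls i (act a X)" by blast
  then show ?thesis by (simp add: tensor_def Let_def act_def vertex_projective_simps)
qed

text \<open>
  The coefficient of \<^term>\<open>b s\<close> in a formal sum of tensors. It respects the defining relations of
  the tensor product, which makes the basis elements independent over \<^term>\<open>A\<close>.
\<close>

definition coefficient :: "'s \<Rightarrow> ('a \<times> 'w) multiset \<Rightarrow> 'a" where
  "coefficient s X = A.summset (image_mset (\<lambda>(v, w). coord s w \<odot>\<^bsub>A\<^esub> v) X)"

lemma coefficient_terms:
  assumes s: "s \<in> I" and X: "set_mset X \<subseteq> pairs (c s)"
  shows "set_mset (image_mset (\<lambda>(v, w). coord s w \<odot>\<^bsub>A\<^esub> v) X) \<subseteq> carrier A"
  using X coord_closed[OF s] by (auto simp: V_carrier subset_iff)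

lemma coefficient_union:
  assumes s: "s \<in> I" and "set_mset X \<subseteq> pairs (c s)" "set_mset Y \<subseteq> pairs (c s)"
  shows "coefficient s (X + Y) = coefficient s X \<oplus>\<^bsub>A\<^esub> coefficient s Y"
  unfolding coefficient_def image_mset_union
  by (rule A.summset_union) (rule coefficient_terms[OF s], fact)+

lemma coefficient_pair:
  assumes s: "s \<in> I" and "p \<in> pairs (c s)" "q \<in> pairs (c s)"
  shows "coefficient s {#p, q#} = coefficient s {#p#} \<oplus>\<^bsub>A\<^esub> coefficient s {#q#}"
proof -
  have "{#p, q#} = {#p#} + {#q#}" by simp
  then show ?thesis using coefficient_union[OF s, of "{#p#}" "{#q#}"] assms by (simp only:) simp
qed

lemma coefficient_empty [simp]: "coefficient s {#} = \<zero>\<^bsub>A\<^esub>"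
  by (simp add: coefficient_def)

lemma coefficient_single:
  "s \<in> I \<Longrightarrow> v \<in> carrier (V (c s)) \<Longrightarrow> w \<in> carrier (W (c s)) \<Longrightarrow>
    coefficient s {#(v, w)#} = coord s w \<odot>\<^bsub>A\<^esub> v"
  by (simp add: coefficient_def coord_closed V_carrier)

lemma coefficient_closed:
  assumes s: "s \<in> I" and X: "set_mset X \<subseteq> pairs (c s)"
  shows "coefficient s X \<in> carrier (V (c s))"
  using X
proof (induction X)
  case empty
  interpret V: gmod K A "V (c s)" by (rule V_gmod)
  show ?case using V.zero_closed by (simp add: V_simps)
next
  case (add p X)
  interpret V: gmod K A "V (c s)" by (rule V_gmod)
  obtain v w where p: "p = (v, w)" by (cases p)
  have "coefficient s (add_mset p X) = coord s w \<odot>\<^bsub>A\<^esub> v \<oplus>\<^bsub>A\<^esub> coefficient s X"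
    using coefficient_union[OF s, of "{#p#}" X] coefficient_single[OF s, of v w] add.prems p by simp
  then show ?case
    using add p V.a_closed[of "coord s w \<odot>\<^bsub>A\<^esub> v" "coefficient s X"] V_smult coord_closed[OF s]
    by (simp add: V_simps)
qed

lemma K_distr: "\<lbrakk>k \<in> carrier K; l \<in> carrier K; a \<in> carrier A\<rbrakk> \<Longrightarrow>
    (k \<oplus>\<^bsub>K\<^esub> l) \<odot>\<^bsub>A\<^esub> a = k \<odot>\<^bsub>A\<^esub> a \<oplus>\<^bsub>A\<^esub> l \<odot>\<^bsub>A\<^esub> a"
  "\<lbrakk>k \<in> carrier K; a \<in> carrier A; a' \<in> carrier A\<rbrakk> \<Longrightarrow>
    k \<odot>\<^bsub>A\<^esub> (a \<oplus>\<^bsub>A\<^esub> a') = k \<odot>\<^bsub>A\<^esub> a \<oplus>\<^bsub>A\<^esub> k \<odot>\<^bsub>A\<^esub> a'"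
  using module.smult_l_distr[OF module] module.smult_r_distr[OF module] by blast+

lemma coefficient_teq:
  assumes s: "s \<in> I"
  shows "teq (c s) X Y \<Longrightarrow> coefficient s X = coefficient s Y"
proof (induction rule: tensor_eq.induct)
  case (plus X X' Y Y')
  then show ?case using coefficient_union[OF s] teq_pairs by simp
next
  case (zero w)
  then show ?case
    using gmod.axioms(2)[OF V_gmod] coefficient_single[OF s, of "\<zero>\<^bsub>V (c s)\<^esub>" w]
      module.smult_r_null[OF module coord_closed[OF s zero]]
    by (simp add: V_simps V_carrier)
next
  case (left v v' w)
  interpret V: gmod K A "V (c s)" by (rule V_gmod)
  show ?case
    using left coefficient_pair[OF s, of "(v, w)" "(v', w)"] coord_closed[OF s left(3)]
    by (simp add: coefficient_single[OF s]) (simp add: V_simps V_carrier K_distr)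
next
  case (right v w w')
  interpret W: gmod K "ground K" "W (c s)" by (rule W_gmod)
  show ?case
    using right coefficient_pair[OF s, of "(v, w)" "(v, w')"] coord_closed[OF s]
    by (simp add: coefficient_single[OF s]) (simp add: coord_add[OF s] V_carrier K_distr)
next
  case (balanced k v w)
  interpret V: gmod K A "V (c s)" by (rule V_gmod)
  interpret W: gmod K "ground K" "W (c s)" by (rule W_gmod)
  have kw: "k \<odot>\<^bsub>W (c s)\<^esub> w \<in> carrier (W (c s))" using W.smult_closed balanced by simp
  have kv: "(k \<odot>\<^bsub>A\<^esub> \<one>\<^bsub>A\<^esub>) \<odot>\<^bsub>V (c s)\<^esub> v \<in> carrier (V (c s))" using balanced by simp
  have "coord s w \<odot>\<^bsub>A\<^esub> (k \<odot>\<^bsub>A\<^esub> v) = (k \<otimes>\<^bsub>K\<^esub> coord s w) \<odot>\<^bsub>A\<^esub> v"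
    using balanced coord_closed[OF s] by (simp add: V_carrier A_smult_assoc[symmetric] K.m_comm)
  then show ?case
    using balanced coefficient_single[OF s kv balanced(3)] coefficient_single[OF s balanced(2) kw]
    by (simp add: V_simps V_carrier coord_smult[OF s] smult_mult_left)
qed auto

text \<open>
  The formal sum \<open>\<Sum>\<^sub>s x\<^sub>s \<otimes> b\<^sub>s\<close> over the indices \<open>s\<close> that belong to the vertex \<^term>\<open>i\<close>.
\<close>

definition normal_form :: "'r \<Rightarrow> ('s \<Rightarrow> 'a) \<Rightarrow> ('a \<times> 'w) multiset" where
  "normal_form i x = image_mset (\<lambda>s. (x s, b s)) (mset_set (J i))"

lemma fin_J: "finite (J i)" using fin by simp

lemma normal_form_set: "set_mset (normal_form i x) = (\<lambda>s. (x s, b s)) ` J i"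
  using fin_J by (simp add: normal_form_def)

lemma normal_form_pairs:
  "(\<And>s. s \<in> J i \<Longrightarrow> x s \<in> carrier (V i)) \<Longrightarrow> set_mset (normal_form i x) \<subseteq> pairs i"
  unfolding normal_form_set using b_closed' by blast

lemma normal_form_add:
  assumes "\<And>s. s \<in> J i \<Longrightarrow> x s \<in> carrier (V i)" "\<And>s. s \<in> J i \<Longrightarrow> y s \<in> carrier (V i)"
  shows "teq i (normal_form i (\<lambda>s. x s \<oplus>\<^bsub>A\<^esub> y s)) (normal_form i x + normal_form i y)"
proof -
  have "finite S \<Longrightarrow> S \<subseteq> J i \<Longrightarrow> teq i (image_mset (\<lambda>s. (x s \<oplus>\<^bsub>A\<^esub> y s, b s)) (mset_set S))
     (image_mset (\<lambda>s. (x s, b s)) (mset_set S) + image_mset (\<lambda>s. (y s, b s)) (mset_set S))" for S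
  proof (induction S rule: finite_induct)
    case empty
    show ?case by (simp add: tensor_eq.refl)
  next
    case (insert s S)
    have "teq i {#(x s \<oplus>\<^bsub>A\<^esub> y s, b s)#} {#(x s, b s), (y s, b s)#}"
      using tensor_eq.left[of "x s" "V i" "y s" "b s" "W i" K A] assms[of s] b_closed'[of s i] insert.prems
      by (simp add: V_simps)
    moreover have "teq i (image_mset (\<lambda>s. (x s \<oplus>\<^bsub>A\<^esub> y s, b s)) (mset_set S))
     (image_mset (\<lambda>s. (x s, b s)) (mset_set S) + image_mset (\<lambda>s. (y s, b s)) (mset_set S))"
      using insert by simp
    ultimately have "teq i ({#(x s \<oplus>\<^bsub>A\<^esub> y s, b s)#} + image_mset (\<lambda>s. (x s \<oplus>\<^bsub>A\<^esub> y s, b s)) (mset_set S))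
     ({#(x s, b s), (y s, b s)#} +
       (image_mset (\<lambda>s. (x s, b s)) (mset_set S) + image_mset (\<lambda>s. (y s, b s)) (mset_set S)))"
      by (rule tensor_eq.plus)
    then show ?case using insert by (simp add: add_mset_commute)
  qed
  from this[OF fin_J] show ?thesis by (simp add: normal_form_def)
qed

lemma tensor_zero_right:
  assumes "v \<in> carrier (V i)"
  shows "teq i {#(v, \<zero>\<^bsub>W i\<^esub>)#} {#}"
proof -
  interpret V: gmod K A "V i" by (rule V_gmod)
  interpret W: gmod K "ground K" "W i" by (rule W_gmod)
  have "teq i {#((\<zero>\<^bsub>K\<^esub> \<odot>\<^bsub>A\<^esub> \<one>\<^bsub>A\<^esub>) \<odot>\<^bsub>V i\<^esub> v, \<zero>\<^bsub>W i\<^esub>)#} {#(v, \<zero>\<^bsub>K\<^esub> \<odot>\<^bsub>W i\<^esub> \<zero>\<^bsub>W i\<^esub>)#}"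
    using assms by (intro tensor_eq.balanced) simp_all
  then have "teq i {#(\<zero>\<^bsub>V i\<^esub>, \<zero>\<^bsub>W i\<^esub>)#} {#(v, \<zero>\<^bsub>W i\<^esub>)#}"
    using assms W.smult_zero_right[of "\<zero>\<^bsub>K\<^esub>"] V.smult_zero_left[of v] by simp
  then show ?thesis
    using tensor_eq.zero[of "\<zero>\<^bsub>W i\<^esub>" "W i" K A "V i"] tensor_eq.sym tensor_eq.trans by (metis W.zero_closed)
qed

lemma tensor_normal_form_single:
  assumes v: "v \<in> carrier (V i)" and w: "w \<in> carrier (W i)"
  shows "teq i {#(v, w)#} (normal_form i (\<lambda>s. coord s w \<odot>\<^bsub>A\<^esub> v))"
proof -
  interpret V: gmod K A "V i" by (rule V_gmod)
  interpret W: gmod K "ground K" "W i" by (rule W_gmod)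
  have co: "coord s w \<in> carrier K" if "s \<in> J i" for s using coord_closed that w by auto
  have cb: "coord s w \<odot>\<^bsub>W i\<^esub> b s \<in> carrier (W i)" if "s \<in> J i" for s
    using W.smult_closed[of "coord s w" "b s"] co[OF that] b_closed'[OF that] by simp
  have "finite S \<Longrightarrow> S \<subseteq> J i \<Longrightarrow> teq i {#(v, \<Oplus>\<^bsub>W i\<^esub>s\<in>S. coord s w \<odot>\<^bsub>W i\<^esub> b s)#}
     (image_mset (\<lambda>s. (coord s w \<odot>\<^bsub>A\<^esub> v, b s)) (mset_set S))" for S
  proof (induction S rule: finite_induct)
    case empty
    show ?case using tensor_zero_right[OF v] by simp
  next
    case (insert s S)
    have s: "s \<in> J i" using insert by simp
    have sum: "(\<Oplus>\<^bsub>W i\<^esub>s\<in>S. coord s w \<odot>\<^bsub>W i\<^esub> b s) \<in> carrier (W i)"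
      using insert.prems cb by (intro W.finsum_closed) blast
    have "(\<Oplus>\<^bsub>W i\<^esub>s\<in>insert s S. coord s w \<odot>\<^bsub>W i\<^esub> b s) =
        coord s w \<odot>\<^bsub>W i\<^esub> b s \<oplus>\<^bsub>W i\<^esub> (\<Oplus>\<^bsub>W i\<^esub>s\<in>S. coord s w \<odot>\<^bsub>W i\<^esub> b s)"
      using insert cb by (intro W.finsum_insert) auto
    then have 1: "teq i {#(v, \<Oplus>\<^bsub>W i\<^esub>s\<in>insert s S. coord s w \<odot>\<^bsub>W i\<^esub> b s)#}
        {#(v, coord s w \<odot>\<^bsub>W i\<^esub> b s), (v, \<Oplus>\<^bsub>W i\<^esub>s\<in>S. coord s w \<odot>\<^bsub>W i\<^esub> b s)#}"
      using tensor_eq.right[of v "V i" "coord s w \<odot>\<^bsub>W i\<^esub> b s" "W i" _ K A] v cb[OF s] sum by simp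
    have "teq i {#((coord s w \<odot>\<^bsub>A\<^esub> \<one>\<^bsub>A\<^esub>) \<odot>\<^bsub>V i\<^esub> v, b s)#} {#(v, coord s w \<odot>\<^bsub>W i\<^esub> b s)#}"
      using v co[OF s] b_closed'[OF s] by (intro tensor_eq.balanced)
    then have "teq i {#(v, coord s w \<odot>\<^bsub>W i\<^esub> b s)#} {#(coord s w \<odot>\<^bsub>A\<^esub> v, b s)#}"
      using v co[OF s] by (subst tensor_eq_commute) (simp add: V_simps V_carrier smult_mult_left)
    moreover have "teq i {#(v, \<Oplus>\<^bsub>W i\<^esub>s\<in>S. coord s w \<odot>\<^bsub>W i\<^esub> b s)#}
        (image_mset (\<lambda>s. (coord s w \<odot>\<^bsub>A\<^esub> v, b s)) (mset_set S))"
      using insert by simp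
    ultimately have "teq i ({#(v, coord s w \<odot>\<^bsub>W i\<^esub> b s)#} + {#(v, \<Oplus>\<^bsub>W i\<^esub>s\<in>S. coord s w \<odot>\<^bsub>W i\<^esub> b s)#})
        ({#(coord s w \<odot>\<^bsub>A\<^esub> v, b s)#} + image_mset (\<lambda>s. (coord s w \<odot>\<^bsub>A\<^esub> v, b s)) (mset_set S))"
      by (rule tensor_eq.plus)
    then have "teq i {#(v, coord s w \<odot>\<^bsub>W i\<^esub> b s), (v, \<Oplus>\<^bsub>W i\<^esub>s\<in>S. coord s w \<odot>\<^bsub>W i\<^esub> b s)#}
        (image_mset (\<lambda>s. (coord s w \<odot>\<^bsub>A\<^esub> v, b s)) (mset_set (insert s S)))"
      using insert by (simp add: add_mset_commute)
    with 1 show ?case by (rule tensor_eq.trans)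
  qed
  from this[OF fin_J order_refl] show ?thesis
    unfolding normal_form_def coord_expand[OF w, symmetric] .
qed

text \<open>
  Expand the right factors in the basis, and move the coordinates to the left factors.
\<close>

lemma tensor_normal_form:
  assumes "set_mset X \<subseteq> pairs i"
  shows "teq i X (normal_form i (\<lambda>s. coefficient s X))"
  using assms
proof (induction X)
  case empty
  have "finite S \<Longrightarrow> S \<subseteq> J i \<Longrightarrow> teq i {#} (image_mset (\<lambda>s. (\<zero>\<^bsub>A\<^esub>, b s)) (mset_set S))" for S
  proof (induction S rule: finite_induct)
    case empty
    show ?case by (simp add: tensor_eq.refl)
  next
    case (insert s S)
    have "teq i ({#} + {#}) ({#(\<zero>\<^bsub>A\<^esub>, b s)#} + image_mset (\<lambda>s. (\<zero>\<^bsub>A\<^esub>, b s)) (mset_set S))"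
      using insert b_closed'[of s i] tensor_eq.sym[OF tensor_eq.zero[of "b s" "W i" K A "V i"]]
      by (intro tensor_eq.plus) (simp_all add: V_simps)
    then show ?case using insert by simp
  qed
  from this[OF fin_J] show ?case by (simp add: normal_form_def)
next
  case (add p X)
  obtain v w where p: "p = (v, w)" by (cases p)
  have v: "v \<in> carrier (V i)" and w: "w \<in> carrier (W i)" and X: "set_mset X \<subseteq> pairs i"
    using add.prems p by auto
  let ?x = "\<lambda>s. coord s w \<odot>\<^bsub>A\<^esub> v" and ?y = "\<lambda>s. coefficient s X"
  have xc: "?x s \<in> carrier (V i)" and yc: "?y s \<in> carrier (V i)" if "s \<in> J i" for s
    using that V_smult[OF coord_closed v] w coefficient_closed[of s X] X by auto
  have 1: "teq i ({#(v, w)#} + X) (normal_form i ?x + normal_form i ?y)"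
    using tensor_normal_form_single[OF v w] add.IH[OF X] by (rule tensor_eq.plus)
  have 2: "teq i (normal_form i ?x + normal_form i ?y) (normal_form i (\<lambda>s. ?x s \<oplus>\<^bsub>A\<^esub> ?y s))"
    by (rule tensor_eq.sym[OF normal_form_add]) (simp_all add: xc yc)
  have 3: "normal_form i (\<lambda>s. ?x s \<oplus>\<^bsub>A\<^esub> ?y s) = normal_form i (\<lambda>s. coefficient s (add_mset p X))"
    unfolding normal_form_def
  proof (rule image_mset_cong)
    fix s assume "s \<in># mset_set (J i)"
    then have s: "s \<in> I" "c s = i" using fin_J by auto
    have "coefficient s ({#p#} + X) = ?x s \<oplus>\<^bsub>A\<^esub> ?y s"
      using coefficient_union[OF s(1), of "{#p#}" X] coefficient_single[OF s(1), of v w] v w X s(2) p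
      by simp
    then show "(?x s \<oplus>\<^bsub>A\<^esub> ?y s, b s) = (coefficient s (add_mset p X), b s)" by simp
  qed
  have "teq i ({#(v, w)#} + X) (normal_form i (\<lambda>s. coefficient s (add_mset p X)))"
    using tensor_eq.trans[OF 1 2] unfolding 3 .
  then show ?case using p by simp
qed

lemma coefficient_normal_form:
  assumes s: "s \<in> I" and x: "\<And>t. t \<in> J (c s) \<Longrightarrow> x t \<in> carrier (V (c s))"
  shows "coefficient s (normal_form (c s) x) = x s"
proof -
  have xs: "x t \<in> carrier A" if "t \<in> J (c s)" for t using x[OF that] by (simp add: V_carrier)
  have co: "coord s (b t) = (if s = t then \<one>\<^bsub>K\<^esub> else \<zero>\<^bsub>K\<^esub>)" if "t \<in> J (c s)" for t
    using coord_b[OF s] that by auto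
  have "coefficient s (normal_form (c s) x) = (\<Oplus>\<^bsub>A\<^esub>t\<in>J (c s). coord s (b t) \<odot>\<^bsub>A\<^esub> x t)"
    unfolding coefficient_def normal_form_def
    using A.summset_image_mset_set[OF fin_J, of "c s" "\<lambda>t. coord s (b t) \<odot>\<^bsub>A\<^esub> x t"] co xs
    by (simp add: image_mset.compositionality comp_def)
  also have "\<dots> = coord s (b s) \<odot>\<^bsub>A\<^esub> x s"
    by (rule A.finsum_single[OF fin_J]) (use s co xs in auto)
  also have "\<dots> = x s" using co[of s] xs[of s] s by simp
  finally show ?thesis .
qed

text \<open>
  A term \<open>v \<otimes> w\<close> of total degree \<open>n\<close> contributes to the coefficient of \<open>b\<^sub>s\<close> only if \<open>w\<close> has the degree
  of \<open>b\<^sub>s\<close>.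
\<close>

lemma coefficient_grade:
  assumes s: "s \<in> I"
    and X: "\<forall>(v, w)\<in>set_mset X. \<exists>m. v \<in> grade (V (c s)) (n - m) \<and> w \<in> grade (W (c s)) m"
  shows "set_mset X \<subseteq> pairs (c s) \<and> coefficient s X \<in> grade A (n - d s)"
  using X
proof (induction X)
  case empty
  show ?case by simp
next
  case (add p X)
  interpret V: gmod K A "V (c s)" by (rule V_gmod)
  interpret W: gmod K "ground K" "W (c s)" by (rule W_gmod)
  obtain v w where p: "p = (v, w)" by (cases p)
  obtain m where m: "v \<in> grade (V (c s)) (n - m)" "w \<in> grade (W (c s)) m"
    using add.prems p by auto
  have vw: "v \<in> carrier (V (c s))" "w \<in> carrier (W (c s))"
    using V.grade_closed[OF m(1)] W.grade_closed[OF m(2)] .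
  have IH: "set_mset X \<subseteq> pairs (c s)" "coefficient s X \<in> grade A (n - d s)"
    using add.IH add.prems by auto
  have "coord s w \<odot>\<^bsub>A\<^esub> v \<in> grade A (n - d s)"
  proof (cases "m = d s")
    case True
    then show ?thesis using m(1) grade_A_smult[OF coord_closed[OF s vw(2)]] by (simp add: V_grade)
  next
    case False
    then show ?thesis using coord_grade[OF s m(2)] vw(1) by (simp add: V_carrier)
  qed
  moreover have "coefficient s ({#p#} + X) = coord s w \<odot>\<^bsub>A\<^esub> v \<oplus>\<^bsub>A\<^esub> coefficient s X"
    using coefficient_union[OF s, of "{#p#}" X] coefficient_single[OF s vw] IH(1) vw p by simp
  ultimately show ?case using IH vw p A.grade_add by simp
qed

text \<open>
  Every tensor has a normal form, so the map that sends a family to its normal forms is surjective;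
  the coefficients recover the family, so it is injective. Gradedness of the inverse is stated
  separately, because the codomain is not known to be a graded module beforehand.
\<close>

theorem tensor_sum_isomorphism:
  "\<exists>\<theta>\<in>gmodule_hom A F.F (direct_sum UNIV T).
     bij_betw \<theta> (carrier F.F) (carrier (direct_sum UNIV T)) \<and>
     (\<forall>n. grade (direct_sum UNIV T) n \<subseteq> \<theta> ` grade F.F n)"
proof -
  let ?D = "direct_sum UNIV T"
  have D: "carrier ?D = {f. \<forall>i. f i \<in> carrier (T i)}"
    by (auto simp: direct_sum_def Let_def PiE_def Pi_def)
  have D_add: "f \<oplus>\<^bsub>?D\<^esub> g = (\<lambda>i. f i \<oplus>\<^bsub>T i\<^esub> g i)" for f g
    by (simp add: direct_sum_def Let_def restrict_def)
  have D_smult: "a \<odot>\<^bsub>?D\<^esub> f = (\<lambda>i. a \<odot>\<^bsub>T i\<^esub> f i)" for a f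
    by (simp add: direct_sum_def Let_def restrict_def)
  have D_grade: "f \<in> grade ?D n \<longleftrightarrow> f \<in> carrier ?D \<and> (\<forall>i. f i \<in> grade (T i) n)" for f n
    unfolding D by (auto simp: direct_sum_def Let_def PiE_def Pi_def)
  define \<theta> where "\<theta> x = (\<lambda>i. cls i (normal_form i x))" for x
  have xV: "x s \<in> carrier (V i)" if "x \<in> carrier F.F" "s \<in> J i" for x s i
    using that by (auto simp: V_carrier)
  have nf: "set_mset (normal_form i x) \<subseteq> pairs i" if "x \<in> carrier F.F" for x i
    using xV[OF that] by (rule normal_form_pairs)
  have \<theta>c: "\<theta> x \<in> carrier ?D" if "x \<in> carrier F.F" for x
    using nf[OF that] unfolding D T_carrier \<theta>_def by blast
  have hom: "\<theta> \<in> gmodule_hom A F.F ?D"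
  proof (rule gmodule_homI)
    fix x y assume x: "x \<in> carrier F.F" and y: "y \<in> carrier F.F"
    have "cls i (normal_form i (x \<oplus>\<^bsub>F.F\<^esub> y)) = cls i (normal_form i x + normal_form i y)" for i
    proof -
      have eq: "normal_form i (x \<oplus>\<^bsub>F.F\<^esub> y) = normal_form i (\<lambda>s. x s \<oplus>\<^bsub>A\<^esub> y s)"
        unfolding normal_form_def using fin_J
        by (intro image_mset_cong) (auto simp: F.FS_add)
      show ?thesis
        using cls_eq_iff[OF nf[OF F.FS_add_closed[OF x y]], of i] normal_form_add[OF xV[OF x] xV[OF y], of i]
        by (simp add: eq)
    qed
    then show "\<theta> (x \<oplus>\<^bsub>F.F\<^esub> y) = \<theta> x \<oplus>\<^bsub>?D\<^esub> \<theta> y"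
      unfolding \<theta>_def D_add by (simp add: T_add[OF nf[OF x] nf[OF y]])
  next
    fix a x assume a: "a \<in> carrier A" and x: "x \<in> carrier F.F"
    have "normal_form i (a \<odot>\<^bsub>F.F\<^esub> x) = act a (normal_form i x)" for i
      unfolding normal_form_def act_def image_mset.compositionality using fin_J
      by (intro image_mset_cong) (auto simp: F.FS_smult)
    then show "\<theta> (a \<odot>\<^bsub>F.F\<^esub> x) = a \<odot>\<^bsub>?D\<^esub> \<theta> x"
      unfolding \<theta>_def D_smult by (simp add: T_smult[OF nf[OF x] a])
  next
    fix n x assume x: "x \<in> grade F.F n"
    then have xc: "x \<in> carrier F.F" by (simp add: F.FS_grade)
    have "\<theta> x i \<in> grade (T i) n" for i
    proof -
      have "\<exists>m. v \<in> grade (V i) (n - m) \<and> w \<in> grade (W i) m"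
        if vw: "(v, w) \<in> set_mset (normal_form i x)" for v w
      proof -
        obtain s where s: "s \<in> J i" "v = x s" "w = b s" using vw unfolding normal_form_set by auto
        then show ?thesis
          using x xV[OF xc s(1)] b_grade[of s] by (intro exI[of _ "d s"]) (auto simp: V_grade F.FS_grade)
      qed
      then show ?thesis unfolding \<theta>_def T_grade by blast
    qed
    then show "\<theta> x \<in> grade ?D n" using \<theta>c[OF xc] by (simp add: D_grade)
  qed (rule \<theta>c)
  have coeff: "coefficient s (normal_form (c s) x) = x s" if "x \<in> carrier F.F" "s \<in> I" for x s
    by (rule coefficient_normal_form[OF that(2)]) (rule xV[OF that(1)])
  have inj: "inj_on \<theta> (carrier F.F)"
  proof (rule inj_onI, rule F.FS_eqI)
    fix x y s assume x: "x \<in> carrier F.F" and y: "y \<in> carrier F.F" and eq: "\<theta> x = \<theta> y" and s: "s \<in> I"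
    have "cls (c s) (normal_form (c s) x) = cls (c s) (normal_form (c s) y)"
      using fun_cong[OF eq, of "c s"] by (simp add: \<theta>_def)
    then have "teq (c s) (normal_form (c s) x) (normal_form (c s) y)"
      using cls_eq_iff[OF nf[OF x]] by blast
    from coefficient_teq[OF s this] show "x s = y s" using coeff x y s by simp
  qed
  have surj: "\<exists>x\<in>carrier F.F. f = \<theta> x" if f: "f \<in> carrier ?D" for f
  proof -
    have "\<exists>X. set_mset X \<subseteq> pairs i \<and> f i = cls i X" for i
      using f unfolding D T_carrier by blast
    then obtain X where X: "\<And>i. set_mset (X i) \<subseteq> pairs i" "\<And>i. f i = cls i (X i)" by metis
    define x where "x = (\<lambda>s\<in>I. coefficient s (X (c s)))"
    have xc: "x \<in> carrier F.F"
      by (rule F.FS_memI[OF _ _ _ fin])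
        (use coefficient_closed X(1) in \<open>auto simp: x_def V_carrier\<close>)
    have "f i = \<theta> x i" for i
    proof -
      have "normal_form i x = normal_form i (\<lambda>s. coefficient s (X i))"
        unfolding normal_form_def using fin_J by (intro image_mset_cong) (auto simp: x_def)
      then have "teq i (X i) (normal_form i x)" using tensor_normal_form[OF X(1)] by simp
      then show ?thesis using cls_eq_iff[OF X(1)] X(2) by (simp add: \<theta>_def)
    qed
    then show ?thesis using xc by (intro bexI[of _ x]) auto
  qed
  have "f \<in> \<theta> ` grade F.F n" if f: "f \<in> grade ?D n" for f n
  proof -
    obtain x where x: "x \<in> carrier F.F" "f = \<theta> x" using surj f D_grade by blast
    have "x s \<in> grade A (n - d s)" if s: "s \<in> I" for s
    proof -
      have "f (c s) \<in> grade (T (c s)) n" using f D_grade by blast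
      then obtain X where X: "f (c s) = cls (c s) X"
        "\<forall>(v, w)\<in>set_mset X. \<exists>m. v \<in> grade (V (c s)) (n - m) \<and> w \<in> grade (W (c s)) m"
        unfolding T_grade by blast
      note g = coefficient_grade[OF s X(2)]
      have "teq (c s) X (normal_form (c s) x)"
        using X(1) x(2) by (intro iffD1[OF cls_eq_iff[OF conjunct1[OF g]]]) (simp add: \<theta>_def)
      then have "coefficient s X = x s" using coefficient_teq[OF s] coeff[OF x(1) s] by simp
      then show ?thesis using g by simp
    qed
    then show ?thesis using x by (simp add: F.FS_grade)
  qed
  moreover have "bij_betw \<theta> (carrier F.F) (carrier ?D)"
    using inj surj \<theta>c by (auto simp: bij_betw_def)
  ultimately show ?thesis using hom by blast
qed

end

text \<open>Homogeneous bases of all the multiplicity spaces combine to a frame.\<close>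

lemma (in vertex_graded_algebra) framed_by_bases:
  fixes h :: "'r \<Rightarrow> ('t \<Rightarrow> 'k) \<Rightarrow> 'w" and k :: "'s \<Rightarrow> 't"
  assumes fin: "finite I" and W: "\<And>i. graded_space K (W i)"
    and k: "\<And>i. bij_betw k {s\<in>I. c s = i} (B i)" and d: "\<And>s. s \<in> I \<Longrightarrow> d s = dd (c s) (k s)"
    and h: "\<And>i. h i \<in> gmodule_hom (ground K) (FS (ground K) (B i) (\<lambda>_. \<one>\<^bsub>K\<^esub>) (dd i)) (W i)"
    and bij: "\<And>i. bij_betw (h i) (carrier (FS (ground K) (B i) (\<lambda>_. \<one>\<^bsub>K\<^esub>) (dd i))) (carrier (W i))"
  shows "framed K A e W I c d (\<lambda>s. h (c s) (unit_vec (ground K) (B (c s)) (k s) \<one>\<^bsub>K\<^esub>))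
    (\<lambda>s w. inv_into (carrier (FS (ground K) (B (c s)) (\<lambda>_. \<one>\<^bsub>K\<^esub>) (dd (c s)))) (h (c s)) w (k s))"
proof -
  interpret G: vertex_graded_algebra K "ground K" "\<lambda>_::unit. \<one>\<^bsub>K\<^esub>"
    by (rule ground_vertex_algebra[OF field])
  have fam: "principal_family K (ground K) (B i) (\<lambda>_. \<one>\<^bsub>K\<^esub>)" for i by (rule G.std_family)
  define Fi where "Fi i = FS (ground K) (B i) (\<lambda>_. \<one>\<^bsub>K\<^esub>) (dd i)" for i
  define g where "g i = inv_into (carrier (Fi i)) (h i)" for i
  have Fg: "gmod K (ground K) (Fi i)" for i unfolding Fi_def by (rule principal_family.FS_gmod[OF fam])
  have Wg: "gmod K (ground K) (W i)" for i using W gmod_ground_iff[OF field] by blast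
  note h = h[folded Fi_def] and bij = bij[folded Fi_def]
  have g: "g i \<in> gmodule_hom (ground K) (W i) (Fi i)" for i
    unfolding g_def by (rule G.hom_inverse[OF Fg Wg h bij])
  have hg: "h i (g i w) = w" if "w \<in> carrier (W i)" for i w
    unfolding g_def using bij that by (metis bij_betw_inv_into_right)
  have gh: "g i (h i x) = x" if "x \<in> carrier (Fi i)" for i x
    unfolding g_def using bij that by (metis bij_betw_inv_into_left)
  have kB: "k s \<in> B (c s)" if "s \<in> I" for s using k[of "c s"] that by (auto dest: bij_betwE)
  have kinj: "k s = k t \<longleftrightarrow> s = t" if "s \<in> I" "t \<in> I" "c s = c t" for s t
    using bij_betw_imp_inj_on[OF k[of "c t"]] that by (auto dest: inj_onD)
  let ?b = "\<lambda>s. h (c s) (unit_vec (ground K) (B (c s)) (k s) \<one>\<^bsub>K\<^esub>)"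
  have u: "unit_vec (ground K) (B (c s)) (k s) \<one>\<^bsub>K\<^esub> \<in> carrier (Fi (c s))"
    "unit_vec (ground K) (B (c s)) (k s) \<one>\<^bsub>K\<^esub> \<in> grade (Fi (c s)) (d s)" if "s \<in> I" for s
    using principal_family.unit_vec_unit_closed[OF fam kB[OF that]]
      principal_family.unit_vec_grade[OF fam kB[OF that]] d[OF that] by (simp_all add: Fi_def)
  have gc: "g (c s) w (k s) \<in> carrier K" if "s \<in> I" "w \<in> carrier (W (c s))" for s w
    using principal_family.FS_closed[OF fam hom_closed[OF g that(2), unfolded Fi_def] kB[OF that(1)]]
    by simp
  have "framed K A e W I c d ?b (\<lambda>s w. g (c s) w (k s))"
  proof
    show "finite I" by (rule fin)
    show "graded_space K (W i)" for i by (rule W)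
    fix s assume s: "s \<in> I"
    show "?b s \<in> grade (W (c s)) (d s)" by (rule hom_grade[OF h u(2)[OF s]])
    show "g (c s) w (k s) \<in> carrier K" if "w \<in> carrier (W (c s))" for w by (rule gc[OF s that])
    show "g (c s) (w \<oplus>\<^bsub>W (c s)\<^esub> w') (k s) = g (c s) w (k s) \<oplus>\<^bsub>K\<^esub> g (c s) w' (k s)"
      if "w \<in> carrier (W (c s))" "w' \<in> carrier (W (c s))" for w w'
      using that kB[OF s] by (simp add: hom_add[OF g] Fi_def principal_family.FS_add[OF fam])
    show "g (c s) (l \<odot>\<^bsub>W (c s)\<^esub> w) (k s) = l \<otimes>\<^bsub>K\<^esub> g (c s) w (k s)"
      if "l \<in> carrier K" "w \<in> carrier (W (c s))" for l w
      using that kB[OF s] hom_smult[OF g, of l w "c s"]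
      by (simp add: Fi_def principal_family.FS_smult[OF fam])
    show "g (c s) (?b t) (k s) = (if s = t then \<one>\<^bsub>K\<^esub> else \<zero>\<^bsub>K\<^esub>)" if t: "t \<in> I" "c s = c t" for t
      using gh[OF u(1)[OF t(1)]] kB[OF s] kinj[OF s t] t(2) by (simp add: unit_vec_def)
    show "g (c s) w (k s) = \<zero>\<^bsub>K\<^esub>" if w: "w \<in> grade (W (c s)) m" "m \<noteq> d s" for w m
    proof -
      have "g (c s) w (k s) \<in> grade (ground K) (m - d s)"
        using hom_grade[OF g w(1)] kB[OF s] d[OF s] by (simp only: Fi_def principal_family.FS_grade[OF fam])
      then show ?thesis using w(2) by simp
    qed
  next
    fix w i assume w: "w \<in> carrier (W i)"
    interpret Wi: gmod K "ground K" "W i" by (rule Wg)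
    interpret P: principal_family K "ground K" "B i" "\<lambda>_. \<one>\<^bsub>K\<^esub>" "dd i" by (rule fam)
    have Bf: "finite (B i)" using bij_betw_finite[OF k[of i]] fin by simp
    have gw: "g i w \<in> carrier P.F" using hom_closed[OF g w] by (simp add: Fi_def)
    let ?u = "\<lambda>t. h i (unit_vec (ground K) (B i) t \<one>\<^bsub>K\<^esub>)"
    have uc: "?u t \<in> carrier (W i)" if "t \<in> B i" for t
      using hom_closed[OF h, of "unit_vec (ground K) (B i) t \<one>\<^bsub>K\<^esub>" i] P.unit_vec_unit_closed[OF that]
      by (simp add: Fi_def)
    have img: "k ` {s\<in>I. c s = i} = B i" using k[of i] by (simp add: bij_betw_def)
    have reindex: "(\<Oplus>\<^bsub>W i\<^esub>t\<in>k ` {s\<in>I. c s = i}. g i w t \<odot>\<^bsub>W i\<^esub> ?u t) =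
        (\<Oplus>\<^bsub>W i\<^esub>s\<in>{s\<in>I. c s = i}. g i w (k s) \<odot>\<^bsub>W i\<^esub> ?u (k s))"
    proof (rule Wi.add.finprod_reindex)
      show "inj_on k {s\<in>I. c s = i}" by (rule bij_betw_imp_inj_on[OF k])
      show "(\<lambda>t. g i w t \<odot>\<^bsub>W i\<^esub> ?u t) \<in> k ` {s\<in>I. c s = i} \<rightarrow> carrier (W i)"
        unfolding img using uc P.FS_closed[OF gw] Wi.smult_closed by (intro Pi_I) blast
    qed
    have "w = h i (g i w)" using hg[OF w] by simp
    also have "\<dots> = (\<Oplus>\<^bsub>W i\<^esub>t\<in>B i. g i w t \<odot>\<^bsub>W i\<^esub> ?u t)"
      by (rule P.hom_FS_formula[OF Wg h[unfolded Fi_def] gw Bf]) auto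
    also have "\<dots> = (\<Oplus>\<^bsub>W i\<^esub>s\<in>{s\<in>I. c s = i}. g i w (k s) \<odot>\<^bsub>W i\<^esub> ?u (k s))"
      using reindex unfolding img .
    also have "\<dots> = (\<Oplus>\<^bsub>W i\<^esub>s\<in>{s\<in>I. c s = i}. g (c s) w (k s) \<odot>\<^bsub>W i\<^esub> ?b s)"
    proof (rule Wi.add.finprod_cong'[OF HOL.refl])
      show "(\<lambda>s. g (c s) w (k s) \<odot>\<^bsub>W i\<^esub> ?b s) \<in> {s\<in>I. c s = i} \<rightarrow> carrier (W i)"
      proof
        fix s assume s: "s \<in> {s\<in>I. c s = i}"
        then have ks: "k s \<in> B i" and cs: "c s = i" using kB[of s] by auto
        show "g (c s) w (k s) \<odot>\<^bsub>W i\<^esub> ?b s \<in> carrier (W i)"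
          unfolding cs using P.FS_closed[OF gw ks] uc[OF ks] by (rule Wi.smult_closed)
      qed
    qed simp
    finally show "w = (\<Oplus>\<^bsub>W i\<^esub>s\<in>{s\<in>I. c s = i}. g (c s) w (k s) \<odot>\<^bsub>W i\<^esub> ?b s)" .
  qed
  then show ?thesis by (simp add: g_def Fi_def)
qed

section \<open>Dimensions\<close>

lemma linear_mapI:
  assumes "vectorspace K V" "vectorspace K W"
    and "\<And>v. v \<in> carrier V \<Longrightarrow> T v \<in> carrier W"
    and "\<And>v v'. \<lbrakk>v \<in> carrier V; v' \<in> carrier V\<rbrakk> \<Longrightarrow> T (v \<oplus>\<^bsub>V\<^esub> v') = T v \<oplus>\<^bsub>W\<^esub> T v'"
    and "\<And>c v. \<lbrakk>c \<in> carrier K; v \<in> carrier V\<rbrakk> \<Longrightarrow> T (c \<odot>\<^bsub>V\<^esub> v) = c \<odot>\<^bsub>W\<^esub> T v"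
  shows "linear_map K V W T"
  using assms
  by (intro linear_map.intro mod_hom.intro mod_hom_axioms.intro)
    (auto simp: LinearCombinations.module_hom_def vectorspace_def)

lemma (in linear_map) rank_nullity_sets:
  assumes "V.fin_dim"
  shows "vectorspace.dim K (W\<lparr>carrier := T ` carrier V\<rparr>) +
    vectorspace.dim K (V\<lparr>carrier := {v \<in> carrier V. T v = \<zero>\<^bsub>W\<^esub>}\<rparr>) = V.dim"
  using rank_nullity[OF assms] unfolding im_def ker_def by simp

lemma (in linear_map) dim_of_bij:
  assumes "V.fin_dim" "bij_betw T (carrier V) (carrier W)"
  shows "W.fin_dim" "W.dim = V.dim"
  using surj_fin_dim[OF assms(1)] dim_eq[OF assms(1)] assms(2) by (simp_all add: bij_betw_def)

text \<open>Lifting a spanning set of the image and adding one of the kernel spans the whole space.\<close>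

lemma (in linear_map) fin_dim_extension:
  assumes ker: "vectorspace.fin_dim K (V\<lparr>carrier := {v \<in> carrier V. T v = \<zero>\<^bsub>W\<^esub>}\<rparr>)"
    and surj: "T ` carrier V = carrier W" and W: "W.fin_dim"
  shows "V.fin_dim"
proof -
  let ?N = "{v \<in> carrier V. T v = \<zero>\<^bsub>W\<^esub>}"
  have N: "LinearCombinations.submodule K ?N V"
    using kerT_is_subspace unfolding ker_def by (simp add: VectorSpace.subspace_def)
  have Ns: "VectorSpace.subspace K ?N V" using kerT_is_subspace unfolding ker_def .
  interpret N: vectorspace K "V\<lparr>carrier := ?N\<rparr>" by (rule V.subspace_is_vs[OF Ns])
  obtain X where X: "finite X" "X \<subseteq> ?N" "N.module.span X = ?N"
    using ker unfolding N.fin_dim_def by auto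
  obtain Y where Y: "finite Y" "Y \<subseteq> carrier W" "W.module.span Y = carrier W"
    using W unfolding W.fin_dim_def by (elim exE conjE)
  obtain Y' where Y': "Y' \<subseteq> carrier V" "finite Y'" "Y = T ` Y'"
    using finite_subset_image[OF Y(1), of T "carrier V"] Y(2) surj by blast
  let ?S = "X \<union> Y'"
  have S: "?S \<subseteq> carrier V" using X(2) Y'(1) by blast
  let ?U = "V.module.span ?S"
  have U: "LinearCombinations.submodule K ?U V" by (rule V.module.span_is_submodule[OF S])
  have Us: "VectorSpace.subspace K ?U V" by (rule V.span_is_subspace[OF S])
  have SU: "?S \<subseteq> ?U" by (rule V.module.in_own_span[OF S])
  have Uc: "?U \<subseteq> carrier V" by (rule V.module.span_is_subset2[OF S])
  have "?N = V.module.span X" using V.module.span_li_not_depend(1)[OF X(2) N] X(3) by simp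
  then have NU: "?N \<subseteq> ?U" using V.module.span_is_monotone[of X ?S] by auto
  have TU: "LinearCombinations.submodule K (T ` ?U) W"
  proof -
    interpret U: vectorspace K "V\<lparr>carrier := ?U\<rparr>" by (rule V.subspace_is_vs[OF Us])
    interpret TU: linear_map K "V\<lparr>carrier := ?U\<rparr>" W T
      by (rule linear_mapI) (use U.vectorspace_axioms W.vectorspace_axioms Uc in \<open>auto simp: subset_iff\<close>)
    have "TU.im = T ` ?U" unfolding TU.im_def by simp
    then show ?thesis using TU.im_is_submodule by simp
  qed
  have "Y \<subseteq> T ` ?U" using SU Y'(3) by auto
  then have "carrier W \<subseteq> T ` ?U" using W.module.span_is_subset[OF _ TU] Y(3) by blast
  then have all: "v \<in> ?U" if v: "v \<in> carrier V" for v
  proof -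
    assume *: "carrier W \<subseteq> T ` ?U"
    then obtain u where u: "u \<in> ?U" "T v = T u" using T_im[OF v] by blast
    have uc: "u \<in> carrier V" using u Uc by blast
    have "v \<ominus>\<^bsub>V\<^esub> u \<in> ?N" using v uc u(2) by simp
    then have "v \<ominus>\<^bsub>V\<^esub> u \<in> ?U" using NU by blast
    then have "(v \<ominus>\<^bsub>V\<^esub> u) \<oplus>\<^bsub>V\<^esub> u \<in> ?U" using u(1) by (rule submodule.m_closed[OF U])
    moreover have "(v \<ominus>\<^bsub>V\<^esub> u) \<oplus>\<^bsub>V\<^esub> u = v"
      using v uc by (simp add: a_minus_def V.module.M.a_assoc V.module.M.l_neg)
    ultimately show ?thesis by simp
  qed
  then have "?U = carrier V" using Uc by blast
  then show ?thesis unfolding V.fin_dim_def using S X(1) Y'(2) by (intro exI[of _ ?S]) simp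
qed

definition product_space :: "'s set \<Rightarrow> ('s \<Rightarrow> ('k, 'v, 'x) module_scheme) \<Rightarrow> ('k, 's \<Rightarrow> 'v) module" where
  "product_space I V = \<lparr>carrier = (\<Pi>\<^sub>E s\<in>I. carrier (V s)), monoid.mult = undefined, one = undefined,
     zero = (\<lambda>s\<in>I. \<zero>\<^bsub>V s\<^esub>), add = (\<lambda>f g. \<lambda>s\<in>I. f s \<oplus>\<^bsub>V s\<^esub> g s), smult = (\<lambda>k f. \<lambda>s\<in>I. k \<odot>\<^bsub>V s\<^esub> f s)\<rparr>"

lemma product_space_simps [simp]:
  "carrier (product_space I V) = (\<Pi>\<^sub>E s\<in>I. carrier (V s))"
  "\<zero>\<^bsub>product_space I V\<^esub> = (\<lambda>s\<in>I. \<zero>\<^bsub>V s\<^esub>)"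
  "f \<oplus>\<^bsub>product_space I V\<^esub> g = (\<lambda>s\<in>I. f s \<oplus>\<^bsub>V s\<^esub> g s)"
  "k \<odot>\<^bsub>product_space I V\<^esub> f = (\<lambda>s\<in>I. k \<odot>\<^bsub>V s\<^esub> f s)"
  by (simp_all add: product_space_def)

lemma product_space_vectorspace:
  assumes V: "\<And>s. s \<in> I \<Longrightarrow> vectorspace K (V s)" and K: "field K"
  shows "vectorspace K (product_space I V)"
proof -
  interpret K: field K by fact
  have m: "Module.module K (V s)" if "s \<in> I" for s using V[OF that] by (simp add: vectorspace_def)
  have ab: "abelian_group (V s)" if "s \<in> I" for s using m[OF that] by (rule Module.module.axioms(2))
  note mon = abelian_group.axioms(1)[OF ab]
  have "Module.module K (product_space I V)"
  proof (rule moduleI)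
    show "cring K" by (rule K.is_cring)
    show "abelian_group (product_space I V)"
    proof (rule abelian_groupI)
      fix x assume x: "x \<in> carrier (product_space I V)"
      show "\<exists>y\<in>carrier (product_space I V). y \<oplus>\<^bsub>product_space I V\<^esub> x = \<zero>\<^bsub>product_space I V\<^esub>"
        using x by (intro bexI[of _ "\<lambda>s\<in>I. \<ominus>\<^bsub>V s\<^esub> x s"])
          (auto intro!: restrict_ext abelian_group.l_neg[OF ab] abelian_group.a_inv_closed[OF ab])
      show "\<zero>\<^bsub>product_space I V\<^esub> \<oplus>\<^bsub>product_space I V\<^esub> x = x"
        using x
        by (intro extensionalityI[of _ I]) (auto simp: PiE_iff intro!: abelian_monoid.l_zero[OF mon])
    next
      fix x y assume "x \<in> carrier (product_space I V)" "y \<in> carrier (product_space I V)"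
      then show "x \<oplus>\<^bsub>product_space I V\<^esub> y = y \<oplus>\<^bsub>product_space I V\<^esub> x"
        by (auto intro!: restrict_ext abelian_monoid.a_comm[OF mon])
    next
      fix x y z assume "x \<in> carrier (product_space I V)" "y \<in> carrier (product_space I V)"
        "z \<in> carrier (product_space I V)"
      then show "x \<oplus>\<^bsub>product_space I V\<^esub> y \<oplus>\<^bsub>product_space I V\<^esub> z =
          x \<oplus>\<^bsub>product_space I V\<^esub> (y \<oplus>\<^bsub>product_space I V\<^esub> z)"
        by (auto intro!: restrict_ext abelian_monoid.a_assoc[OF mon])
    qed (auto intro!: abelian_monoid.a_closed[OF mon] abelian_monoid.zero_closed[OF mon])
    fix k assume k: "k \<in> carrier K"
    fix x assume x: "x \<in> carrier (product_space I V)"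
    show "k \<odot>\<^bsub>product_space I V\<^esub> x \<in> carrier (product_space I V)"
      using k x by (auto intro!: module.smult_closed[OF m])
    show "(k \<oplus>\<^bsub>K\<^esub> l) \<odot>\<^bsub>product_space I V\<^esub> x =
        k \<odot>\<^bsub>product_space I V\<^esub> x \<oplus>\<^bsub>product_space I V\<^esub> l \<odot>\<^bsub>product_space I V\<^esub> x"
      if "l \<in> carrier K" for l
      using k x that by (auto intro!: restrict_ext module.smult_l_distr[OF m])
    show "(k \<otimes>\<^bsub>K\<^esub> l) \<odot>\<^bsub>product_space I V\<^esub> x = k \<odot>\<^bsub>product_space I V\<^esub> (l \<odot>\<^bsub>product_space I V\<^esub> x)"
      if "l \<in> carrier K" for l
      using k x that by (auto intro!: restrict_ext module.smult_assoc1[OF m])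
    show "k \<odot>\<^bsub>product_space I V\<^esub> (x \<oplus>\<^bsub>product_space I V\<^esub> y) =
        k \<odot>\<^bsub>product_space I V\<^esub> x \<oplus>\<^bsub>product_space I V\<^esub> k \<odot>\<^bsub>product_space I V\<^esub> y"
      if "y \<in> carrier (product_space I V)" for y
      using k x that by (auto intro!: restrict_ext module.smult_r_distr[OF m])
  next
    fix x assume x: "x \<in> carrier (product_space I V)"
    then show "\<one>\<^bsub>K\<^esub> \<odot>\<^bsub>product_space I V\<^esub> x = x"
      by (intro extensionalityI[of _ I]) (auto simp: PiE_iff intro!: module.smult_one[OF m])
  qed
  then show ?thesis using K by (rule vectorspace.intro)
qed

text \<open>
  Rank and nullity of the projection to one coordinate, whose kernel is the product over the others.
\<close>

lemma product_space_dim: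
  assumes "finite I" and "\<And>s. s \<in> I \<Longrightarrow> vectorspace K (V s)"
    and "\<And>s. s \<in> I \<Longrightarrow> vectorspace.fin_dim K (V s)" and K: "field K"
  shows "vectorspace.fin_dim K (product_space I V) \<and>
    vectorspace.dim K (product_space I V) = (\<Sum>s\<in>I. vectorspace.dim K (V s))"
  using assms(1-3)
proof (induction I rule: finite_induct)
  case empty
  have "vectorspace K (product_space {} V)" by (rule product_space_vectorspace) (simp_all add: K)
  moreover have "carrier (product_space {} V) = {\<zero>\<^bsub>product_space {} V\<^esub>}"
    by (simp add: PiE_empty_domain restrict_def)
  ultimately have "vectorspace.fin_dim K (product_space {} V)"
    "vectorspace.dim K (product_space {} V) = 0"
    by (rule zero_space_dim[OF K])+
  then show ?case by simp
next
  case (insert s I)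
  let ?P = "product_space I V" and ?P' = "product_space (insert s I) V"
  have IH: "vectorspace.fin_dim K ?P" "vectorspace.dim K ?P = (\<Sum>s\<in>I. vectorspace.dim K (V s))"
    using insert by auto
  have P: "vectorspace K ?P" and P': "vectorspace K ?P'"
    by (rule product_space_vectorspace; use insert.prems K in simp)+
  have Vs: "vectorspace K (V s)" using insert.prems by simp
  interpret Vs: vectorspace K "V s" by (rule Vs)
  have zero: "\<zero>\<^bsub>V t\<^esub> \<in> carrier (V t)" if "t \<in> insert s I" for t
    using insert.prems(1)[OF that] by (meson module.axioms(2) abelian_group.axioms(1)
      abelian_monoid.zero_closed vectorspace.axioms(1))
  interpret T: linear_map K ?P' "V s" "\<lambda>f. f s"
    by (rule linear_mapI[OF P' Vs]) auto
  let ?N = "{f \<in> carrier ?P'. f s = \<zero>\<^bsub>V s\<^esub>}"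
  have Ns: "VectorSpace.subspace K ?N ?P'" using T.kerT_is_subspace unfolding T.ker_def .
  have N: "vectorspace K (?P'\<lparr>carrier := ?N\<rparr>)" by (rule vectorspace.subspace_is_vs[OF P' Ns])
  let ?E = "\<lambda>f. \<lambda>t\<in>insert s I. if t = s then \<zero>\<^bsub>V s\<^esub> else f t"
  interpret E: linear_map K ?P "?P'\<lparr>carrier := ?N\<rparr>" ?E
  proof (rule linear_mapI[OF P N])
    show "?E f \<in> carrier (?P'\<lparr>carrier := ?N\<rparr>)" if "f \<in> carrier ?P" for f
      using that by (auto simp: PiE_iff)
    show "?E (f \<oplus>\<^bsub>?P\<^esub> g) = ?E f \<oplus>\<^bsub>?P'\<lparr>carrier := ?N\<rparr>\<^esub> ?E g" for f g
      using insert.hyps(2) by (auto intro!: restrict_ext)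
    show "?E (k \<odot>\<^bsub>?P\<^esub> f) = k \<odot>\<^bsub>?P'\<lparr>carrier := ?N\<rparr>\<^esub> ?E f" if "k \<in> carrier K" for k f
      using insert.hyps(2) that by (auto intro!: restrict_ext)
  qed
  have "bij_betw ?E (carrier ?P) (carrier (?P'\<lparr>carrier := ?N\<rparr>))"
  proof (rule bij_betw_byWitness[where f' = "\<lambda>f. restrict f I"])
    show "\<forall>f\<in>carrier ?P. restrict (?E f) I = f"
      using insert.hyps(2) by (auto intro!: extensionalityI[of _ I] simp: PiE_iff)
    show "\<forall>f\<in>carrier (?P'\<lparr>carrier := ?N\<rparr>). ?E (restrict f I) = f"
      by (auto intro!: extensionalityI[of _ "insert s I"] simp: PiE_iff)
    show "?E ` carrier ?P \<subseteq> carrier (?P'\<lparr>carrier := ?N\<rparr>)" by (auto simp: PiE_iff)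
    show "(\<lambda>f. restrict f I) ` carrier (?P'\<lparr>carrier := ?N\<rparr>) \<subseteq> carrier ?P" by (auto simp: PiE_iff)
  qed
  note ker = E.dim_of_bij[OF IH(1) this]
  have surj: "(\<lambda>f. f s) ` carrier ?P' = carrier (V s)"
  proof (intro Set.equalityI subsetI)
    fix v assume v: "v \<in> carrier (V s)"
    show "v \<in> (\<lambda>f. f s) ` carrier ?P'"
      by (rule image_eqI[of _ _ "\<lambda>t\<in>insert s I. if t = s then v else \<zero>\<^bsub>V t\<^esub>"])
        (use v zero in \<open>auto simp: PiE_iff\<close>)
  qed auto
  have fd: "vectorspace.fin_dim K ?P'"
    by (rule T.fin_dim_extension[OF ker(1) surj]) (use insert.prems in simp)
  have "vectorspace.dim K ?P' = vectorspace.dim K (V s) + vectorspace.dim K ?P"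
    using T.rank_nullity_sets[OF fd] ker(2) surj by simp
  then show ?case using fd IH(2) insert.hyps by simp
qed

text \<open>
  An additive subset \<^term>\<open>U\<close> of an \<open>A\<close>-module as a vector space, on which the ground field acts
  through its multiples of the unit element.
\<close>

definition kspace :: "('k, 'a) gmodule \<Rightarrow> ('a, 'm) gmodule \<Rightarrow> 'm set \<Rightarrow> ('k, 'm) module" where
  "kspace A M U = \<lparr>carrier = U, monoid.mult = undefined, one = undefined, zero = \<zero>\<^bsub>M\<^esub>, add = add M,
     smult = (\<lambda>k x. (k \<odot>\<^bsub>A\<^esub> \<one>\<^bsub>A\<^esub>) \<odot>\<^bsub>M\<^esub> x)\<rparr>"

lemma kspace_simps [simp]:
  "carrier (kspace A M U) = U" "\<zero>\<^bsub>kspace A M U\<^esub> = \<zero>\<^bsub>M\<^esub>"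
  "x \<oplus>\<^bsub>kspace A M U\<^esub> y = x \<oplus>\<^bsub>M\<^esub> y" "k \<odot>\<^bsub>kspace A M U\<^esub> x = (k \<odot>\<^bsub>A\<^esub> \<one>\<^bsub>A\<^esub>) \<odot>\<^bsub>M\<^esub> x"
  "(kspace A M U)\<lparr>carrier := U'\<rparr> = kspace A M U'"
  by (simp_all add: kspace_def)

context vertex_graded_algebra
begin

text \<open>
  The vector spaces \<open>e\<^sub>i M\<^sub>n\<close> and \<open>e\<^sub>i A\<^sub>n e\<^sub>j\<close>. The dimensions of the latter are the coefficients of the matrix
  Hilbert series.
\<close>

definition piece :: "('a, 'm) gmodule \<Rightarrow> 'r \<Rightarrow> int \<Rightarrow> 'm set" where
  "piece M i n = {x \<in> grade M n. e i \<odot>\<^bsub>M\<^esub> x = x}"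

definition apiece :: "'r \<Rightarrow> int \<Rightarrow> 'r \<Rightarrow> 'a set" where
  "apiece i n j = {e i \<otimes>\<^bsub>A\<^esub> a \<otimes>\<^bsub>A\<^esub> e j | a. a \<in> grade A n}"

definition adim :: "'r \<Rightarrow> int \<Rightarrow> 'r \<Rightarrow> nat" where
  "adim i n j = vectorspace.dim K (A\<lparr>carrier := apiece i n j\<rparr>)"

lemma apiece_iff: "x \<in> apiece i n j \<longleftrightarrow> x \<in> grade A n \<and> e i \<otimes>\<^bsub>A\<^esub> x = x \<and> x \<otimes>\<^bsub>A\<^esub> e j = x"
proof
  assume "x \<in> apiece i n j"
  then obtain a where a: "a \<in> grade A n" "x = e i \<otimes>\<^bsub>A\<^esub> a \<otimes>\<^bsub>A\<^esub> e j" unfolding apiece_def by blast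
  have ac: "a \<in> carrier A" using A.grade_closed[OF a(1)] .
  have "x \<in> grade A (0 + n + 0)"
    unfolding a(2) using a(1) vertex_in_grade_0 by (intro grade_mult)
  moreover have "e i \<otimes>\<^bsub>A\<^esub> x = x"
    unfolding a(2) using ac by (simp add: A.m_assoc[symmetric])
  moreover have "x \<otimes>\<^bsub>A\<^esub> e j = x"
    unfolding a(2) using ac by (simp add: A.m_assoc)
  ultimately show "x \<in> grade A n \<and> e i \<otimes>\<^bsub>A\<^esub> x = x \<and> x \<otimes>\<^bsub>A\<^esub> e j = x" by simp
next
  assume "x \<in> grade A n \<and> e i \<otimes>\<^bsub>A\<^esub> x = x \<and> x \<otimes>\<^bsub>A\<^esub> e j = x"
  then show "x \<in> apiece i n j" unfolding apiece_def by (intro CollectI exI[of _ x]) simp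
qed

lemma A_vectorspace: "vectorspace K A"
  using module field by (rule vectorspace.intro)

lemma grade_A_vectorspace: "vectorspace K (A\<lparr>carrier := grade A n\<rparr>)"
proof -
  interpret V: vectorspace K A by (rule A_vectorspace)
  have "VectorSpace.subspace K (grade A n) A"
    unfolding VectorSpace.subspace_def LinearCombinations.submodule_def
    using A_vectorspace module A.grade_closed A.grade_add grade_A_smult by auto
  then show ?thesis by (rule V.subspace_is_vs)
qed

lemma apiece_vectorspace: "vectorspace K (A\<lparr>carrier := apiece i n j\<rparr>)"
proof -
  interpret V: vectorspace K A by (rule A_vectorspace)
  have "VectorSpace.subspace K (apiece i n j) A"
    unfolding VectorSpace.subspace_def LinearCombinations.submodule_def
  proof (intro conjI A_vectorspace module allI impI)
    show "apiece i n j \<subseteq> carrier A" using A.grade_closed by (auto simp: apiece_iff)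
    show "\<zero>\<^bsub>A\<^esub> \<in> apiece i n j" by (simp add: apiece_iff)
    show "x \<oplus>\<^bsub>A\<^esub> y \<in> apiece i n j" if "x \<in> apiece i n j" "y \<in> apiece i n j" for x y
      using that A.grade_closed[of x n] A.grade_closed[of y n]
      by (simp add: apiece_iff A.grade_add A.l_distr A.r_distr)
    show "k \<odot>\<^bsub>A\<^esub> x \<in> apiece i n j" if "k \<in> carrier K" "x \<in> apiece i n j" for k x
      using that A.grade_closed[of x n]
      by (simp add: apiece_iff grade_A_smult smult_mult_left smult_mult_right)
  qed
  then show ?thesis by (rule V.subspace_is_vs)
qed

lemma apiece_fin_dim: "vectorspace.fin_dim K (A\<lparr>carrier := apiece i n j\<rparr>)"
proof -
  interpret T: linear_map K "A\<lparr>carrier := grade A n\<rparr>" "A\<lparr>carrier := apiece i n j\<rparr>"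
    "\<lambda>a. e i \<otimes>\<^bsub>A\<^esub> a \<otimes>\<^bsub>A\<^esub> e j"
    by (rule linear_mapI[OF grade_A_vectorspace apiece_vectorspace])
      (use A.grade_closed in \<open>auto simp: apiece_def A.l_distr A.r_distr smult_mult_left smult_mult_right\<close>)
  show ?thesis by (rule T.surj_fin_dim) (use locally_finite in \<open>auto simp: apiece_def\<close>)
qed

lemma adim_trivial:
  assumes "grade A n = {\<zero>\<^bsub>A\<^esub>}"
  shows "adim i n j = 0"
proof -
  have "apiece i n j = {\<zero>\<^bsub>A\<^esub>}"
  proof (intro Set.equalityI subsetI)
    fix x assume "x \<in> apiece i n j"
    then have "x \<in> grade A n" by (simp add: apiece_iff)
    then show "x \<in> {\<zero>\<^bsub>A\<^esub>}" unfolding assms .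
  qed (simp add: apiece_iff)
  then show ?thesis
    unfolding adim_def using zero_space_dim(2)[OF field apiece_vectorspace[of i n j]] by simp
qed

lemma adim_zero: "adim i 0 j = (if i = j then 1 else 0)"
proof (cases "i = j")
  case True
  interpret V: vectorspace K "A\<lparr>carrier := apiece j 0 j\<rparr>" by (rule apiece_vectorspace)
  have ej: "e j \<in> apiece j 0 j" by (simp add: apiece_iff vertex_in_grade_0)
  have "V.module.span {e j} = carrier (A\<lparr>carrier := apiece j 0 j\<rparr>)"
  proof
    show "V.module.span {e j} \<subseteq> carrier (A\<lparr>carrier := apiece j 0 j\<rparr>)"
      by (rule V.module.span_is_subset2) (simp add: ej)
    show "carrier (A\<lparr>carrier := apiece j 0 j\<rparr>) \<subseteq> V.module.span {e j}"
    proof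
      fix x assume "x \<in> carrier (A\<lparr>carrier := apiece j 0 j\<rparr>)"
      then have "x \<in> grade A 0" "x \<otimes>\<^bsub>A\<^esub> e j = x" by (simp_all add: apiece_iff)
      then obtain k where k: "k \<in> carrier K" "x = k \<odot>\<^bsub>A\<^esub> e j" by (rule grade_0_vertex)
      have "e j \<in> V.module.span {e j}" using V.module.in_own_span[of "{e j}"] ej by simp
      moreover have "LinearCombinations.submodule K (V.module.span {e j}) (A\<lparr>carrier := apiece j 0 j\<rparr>)"
        by (rule V.module.span_is_submodule) (simp add: ej)
      ultimately show "x \<in> V.module.span {e j}"
        using submodule.smult_closed[of K "V.module.span {e j}" "A\<lparr>carrier := apiece j 0 j\<rparr>" k "e j"] k
        by simp
    qed
  qed
  then have "V.dim = 1" by (rule V.dim1I) (simp_all add: ej vertex_nonzero)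
  then show ?thesis using True by (simp add: adim_def)
next
  case False
  have "apiece i 0 j = {\<zero>\<^bsub>A\<^esub>}"
  proof (intro Set.equalityI subsetI)
    fix x assume "x \<in> apiece i 0 j"
    then have x: "x \<in> grade A 0" "e i \<otimes>\<^bsub>A\<^esub> x = x" "x \<otimes>\<^bsub>A\<^esub> e j = x" by (simp_all add: apiece_iff)
    obtain k where k: "k \<in> carrier K" "x = k \<odot>\<^bsub>A\<^esub> e j" using x(1,3) by (rule grade_0_vertex)
    have "x = e i \<otimes>\<^bsub>A\<^esub> (k \<odot>\<^bsub>A\<^esub> e j)" using x(2) k(2) by simp
    also have "\<dots> = \<zero>\<^bsub>A\<^esub>"
      using k(1) orthogonal[OF False] module.smult_r_null[OF module k(1)] by (simp add: smult_mult_right)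
    finally show "x \<in> {\<zero>\<^bsub>A\<^esub>}" by simp
  qed (simp add: apiece_iff)
  then show ?thesis
    unfolding adim_def using zero_space_dim(2)[OF field apiece_vectorspace[of i 0 j]] False by simp
qed

lemma scalar_grade: "k \<in> carrier K \<Longrightarrow> k \<odot>\<^bsub>A\<^esub> \<one>\<^bsub>A\<^esub> \<in> grade A 0"
  using grade_A_smult grade_one by blast

lemma piece_closed: "gmod K A M \<Longrightarrow> x \<in> piece M i n \<Longrightarrow> x \<in> carrier M"
  using graded_grp.grade_closed[OF gmod.axioms(2)] by (auto simp: piece_def)

lemma piece_vectorspace:
  assumes M: "gmod K A M"
  shows "vectorspace K (kspace A M (piece M i n))"
proof -
  interpret M: gmod K A M by fact
  have pc: "x \<in> carrier M" if "x \<in> piece M i n" for x using piece_closed[OF M that] .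
  have pa: "x \<oplus>\<^bsub>M\<^esub> y \<in> piece M i n" if "x \<in> piece M i n" "y \<in> piece M i n" for x y
    using that pc[OF that(1)] pc[OF that(2)] by (simp add: piece_def M.grade_add M.smult_r_distr)
  have pn: "\<ominus>\<^bsub>M\<^esub> x \<in> piece M i n" if "x \<in> piece M i n" for x
    using that pc[OF that] by (simp add: piece_def M.grade_uminus M.smult_uminus_right)
  have pz: "\<zero>\<^bsub>M\<^esub> \<in> piece M i n" by (simp add: piece_def)
  have ps: "(k \<odot>\<^bsub>A\<^esub> \<one>\<^bsub>A\<^esub>) \<odot>\<^bsub>M\<^esub> x \<in> piece M i n" if k: "k \<in> carrier K" and x: "x \<in> piece M i n" for k x
  proof -
    have "e i \<odot>\<^bsub>M\<^esub> ((k \<odot>\<^bsub>A\<^esub> \<one>\<^bsub>A\<^esub>) \<odot>\<^bsub>M\<^esub> x) = (e i \<otimes>\<^bsub>A\<^esub> (k \<odot>\<^bsub>A\<^esub> \<one>\<^bsub>A\<^esub>)) \<odot>\<^bsub>M\<^esub> x"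
      using k pc[OF x] by (simp add: M.smult_assoc)
    also have "e i \<otimes>\<^bsub>A\<^esub> (k \<odot>\<^bsub>A\<^esub> \<one>\<^bsub>A\<^esub>) = (k \<odot>\<^bsub>A\<^esub> \<one>\<^bsub>A\<^esub>) \<otimes>\<^bsub>A\<^esub> e i"
      using k by (simp add: smult_mult_left smult_mult_right)
    also have "\<dots> \<odot>\<^bsub>M\<^esub> x = (k \<odot>\<^bsub>A\<^esub> \<one>\<^bsub>A\<^esub>) \<odot>\<^bsub>M\<^esub> (e i \<odot>\<^bsub>M\<^esub> x)"
      using k pc[OF x] by (simp add: M.smult_assoc)
    finally show ?thesis
      using x M.grade_smult[OF scalar_grade[OF k], of x n] by (simp add: piece_def)
  qed
  have "Module.module K (kspace A M (piece M i n))"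
  proof (rule moduleI)
    show "cring K" by (rule K.is_cring)
    show "abelian_group (kspace A M (piece M i n))"
    proof (rule abelian_groupI)
      show "\<exists>y\<in>carrier (kspace A M (piece M i n)). y \<oplus>\<^bsub>kspace A M (piece M i n)\<^esub> x =
          \<zero>\<^bsub>kspace A M (piece M i n)\<^esub>" if "x \<in> carrier (kspace A M (piece M i n))" for x
        using that pn pc by (intro bexI[of _ "\<ominus>\<^bsub>M\<^esub> x"]) (simp_all add: M.l_neg)
    qed (use pa pz pc in \<open>simp_all add: M.a_ac\<close>)
    fix k l x assume k: "k \<in> carrier K" and l: "l \<in> carrier K"
      and x: "x \<in> carrier (kspace A M (piece M i n))"
    have kl: "(k \<otimes>\<^bsub>K\<^esub> l) \<odot>\<^bsub>A\<^esub> \<one>\<^bsub>A\<^esub> = (k \<odot>\<^bsub>A\<^esub> \<one>\<^bsub>A\<^esub>) \<otimes>\<^bsub>A\<^esub> (l \<odot>\<^bsub>A\<^esub> \<one>\<^bsub>A\<^esub>)"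
      using k l by (simp add: A_smult_assoc scalar_mult)
    show "(k \<oplus>\<^bsub>K\<^esub> l) \<odot>\<^bsub>kspace A M (piece M i n)\<^esub> x = k \<odot>\<^bsub>kspace A M (piece M i n)\<^esub> x
        \<oplus>\<^bsub>kspace A M (piece M i n)\<^esub> l \<odot>\<^bsub>kspace A M (piece M i n)\<^esub> x"
      using k l x pc by (simp add: module.smult_l_distr[OF module] M.smult_l_distr)
    show "(k \<otimes>\<^bsub>K\<^esub> l) \<odot>\<^bsub>kspace A M (piece M i n)\<^esub> x =
        k \<odot>\<^bsub>kspace A M (piece M i n)\<^esub> (l \<odot>\<^bsub>kspace A M (piece M i n)\<^esub> x)"
      using k l x pc by (simp add: kl M.smult_assoc)
  qed (use ps pc in \<open>simp_all add: M.smult_r_distr\<close>)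
  then show ?thesis using field by (rule vectorspace.intro)
qed

definition pdim :: "('a, 'm) gmodule \<Rightarrow> 'r \<Rightarrow> int \<Rightarrow> nat" where
  "pdim M i n = vectorspace.dim K (kspace A M (piece M i n))"

definition pfin :: "('a, 'm) gmodule \<Rightarrow> 'r \<Rightarrow> int \<Rightarrow> bool" where
  "pfin M i n \<longleftrightarrow> vectorspace.fin_dim K (kspace A M (piece M i n))"

lemma piece_hom: "f \<in> gmodule_hom A M N \<Longrightarrow> gmod K A M \<Longrightarrow> x \<in> piece M i n \<Longrightarrow> f x \<in> piece N i n"
  using hom_grade[of f A M N] hom_smult[of f A M N "e i" x] piece_closed[of M x i n]
  by (simp add: piece_def)

lemma piece_linear_map:
  assumes M: "gmod K A M" and N: "gmod K A N" and f: "f \<in> gmodule_hom A M N"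
  shows "linear_map K (kspace A M (piece M i n)) (kspace A N (piece N i n)) f"
  by (rule linear_mapI[OF piece_vectorspace[OF M] piece_vectorspace[OF N]])
    (use piece_hom[OF f M] piece_closed[OF M] in \<open>simp_all add: hom_add[OF f] hom_smult[OF f]\<close>)

lemma piece_rank_nullity:
  assumes M: "gmod K A M" and N: "gmod K A N" and f: "f \<in> gmodule_hom A M N" and fd: "pfin M i n"
  shows "vectorspace.dim K (kspace A N (f ` piece M i n)) +
    vectorspace.dim K (kspace A M {x \<in> piece M i n. f x = \<zero>\<^bsub>N\<^esub>}) = pdim M i n"
  using linear_map.rank_nullity_sets[OF piece_linear_map[OF M N f], of i n] fd
  by (simp add: pdim_def pfin_def)

text \<open>Components commute with homomorphisms, so exactness can be checked on each piece.\<close>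

lemma piece_image:
  assumes M: "gmod K A M" and N: "gmod K A N" and f: "f \<in> gmodule_hom A M N"
  shows "f ` piece M i n = f ` carrier M \<inter> piece N i n"
proof (intro Set.equalityI subsetI)
  fix y assume "y \<in> f ` piece M i n"
  then show "y \<in> f ` carrier M \<inter> piece N i n" using piece_hom[OF f M] piece_closed[OF M] by auto
next
  interpret M: gmod K A M by fact
  interpret N: gmod K A N by fact
  fix y assume "y \<in> f ` carrier M \<inter> piece N i n"
  then obtain x where x: "x \<in> carrier M" "y = f x" and y: "y \<in> grade N n" "e i \<odot>\<^bsub>N\<^esub> y = y"
    unfolding piece_def by blast
  let ?x = "e i \<odot>\<^bsub>M\<^esub> hcomp M n x"
  have "?x \<in> grade M n"
    using M.grade_smult[OF vertex_in_grade_0 M.hcomp_grade[OF x(1)], of i n] by simp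
  moreover have "e i \<odot>\<^bsub>M\<^esub> ?x = ?x" using M.smult_assoc[of "e i" "e i" "hcomp M n x"] x(1) by simp
  ultimately have "?x \<in> piece M i n" by (simp add: piece_def)
  moreover have "f ?x = y"
    using x y N.hcomp_homogeneous[OF y(1), of n]
    by (simp add: hom_smult[OF f] hom_hcomp[OF M N f, symmetric])
  ultimately show "y \<in> f ` piece M i n" by blast
qed

lemma pdim_iso:
  assumes M: "gmod K A M" and N: "gmod K A N" and f: "f \<in> gmodule_hom A M N"
    and bij: "bij_betw f (carrier M) (carrier N)" and fd: "pfin M i n"
  shows "pfin N i n" "pdim N i n = pdim M i n"
proof -
  have "f ` piece M i n = piece N i n"
    using piece_image[OF M N f] bij piece_closed[OF N] by (auto simp: bij_betw_def)
  moreover have "inj_on f (piece M i n)"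
    using bij piece_closed[OF M] by (auto simp: bij_betw_def intro: inj_on_subset)
  ultimately have b: "bij_betw f (carrier (kspace A M (piece M i n))) (carrier (kspace A N (piece N i n)))"
    by (simp add: bij_betw_def)
  show "pfin N i n" "pdim N i n = pdim M i n"
    using linear_map.dim_of_bij[OF piece_linear_map[OF M N f] _ b] fd
    by (simp_all add: pfin_def pdim_def)
qed

text \<open>
  As a vector space the piece is the product of the spaces \<open>e\<^sub>i A\<^sub>m e\<^sub>k\<close> over the generators, where
  \<open>k\<close> is the vertex of the generator and \<open>m\<close> is \<open>n\<close> minus its degree.
\<close>

lemma pdim_FS:
  assumes I: "finite I"
  shows "pfin (FS A I (\<lambda>s. e (c s)) d) i n \<and>
    pdim (FS A I (\<lambda>s. e (c s)) d) i n = (\<Sum>s\<in>I. adim i (n - d s) (c s))"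
proof -
  interpret F: principal_family K A I "\<lambda>s. e (c s)" d by (rule std_family)
  let ?V = "\<lambda>s. A\<lparr>carrier := apiece i (n - d s) (c s)\<rparr>"
  let ?P = "product_space I ?V" and ?Q = "kspace A F.F (piece F.F i n)"
  have P: "vectorspace K ?P" by (rule product_space_vectorspace[OF apiece_vectorspace field])
  note dim = product_space_dim[OF I apiece_vectorspace apiece_fin_dim field,
    of "\<lambda>s. i" "\<lambda>s. n - d s" c]
  have car: "carrier ?P = carrier ?Q"
  proof (intro Set.equalityI subsetI)
    fix x assume x: "x \<in> carrier ?P"
    have xs: "x s \<in> grade A (n - d s)" "e i \<otimes>\<^bsub>A\<^esub> x s = x s" "x s \<otimes>\<^bsub>A\<^esub> e (c s) = x s" if "s \<in> I" for s
      using x that by (auto simp: apiece_iff PiE_iff)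
    have ext: "x \<in> extensional I" using x by (simp add: PiE_iff)
    have xc: "x \<in> carrier F.F"
      by (rule F.FS_memI[OF ext _ _ I]) (use xs A.grade_closed[OF xs(1)] in auto)
    have "e i \<odot>\<^bsub>F.F\<^esub> x = x"
      by (rule F.FS_eqI[OF F.FS_smult_closed[OF vertex_closed xc] xc]) (simp add: F.FS_smult xs)
    then show "x \<in> carrier ?Q" using xc xs by (simp add: piece_def F.FS_grade)
  next
    fix x assume "x \<in> carrier ?Q"
    then have xc: "x \<in> carrier F.F" and xg: "\<And>s. s \<in> I \<Longrightarrow> x s \<in> grade A (n - d s)"
      and ex: "e i \<odot>\<^bsub>F.F\<^esub> x = x"
      by (auto simp: piece_def F.FS_grade)
    have "e i \<otimes>\<^bsub>A\<^esub> x s = x s" if "s \<in> I" for s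
      using fun_cong[OF ex, of s] that by (simp add: F.FS_smult)
    then show "x \<in> carrier ?P"
      using xg xc F.FS_extensional[OF xc] by (auto simp: PiE_iff apiece_iff)
  qed
  have PA: "x s \<in> carrier A" if "x \<in> carrier ?P" "s \<in> I" for x s
    using that by (auto simp: PiE_iff apiece_iff intro: A.grade_closed)
  interpret L: linear_map K ?P ?Q "\<lambda>x. x"
  proof (rule linear_mapI[OF P piece_vectorspace[OF F.FS_gmod]])
    show "x \<in> carrier ?Q" if "x \<in> carrier ?P" for x using that car by simp
    show "x \<oplus>\<^bsub>?P\<^esub> y = x \<oplus>\<^bsub>?Q\<^esub> y" for x y by (simp add: F.FS_add)
    show "k \<odot>\<^bsub>?P\<^esub> x = k \<odot>\<^bsub>?Q\<^esub> x" if "k \<in> carrier K" "x \<in> carrier ?P" for k x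
      using that PA[OF that(2)] by (auto simp: F.FS_smult scalar_mult intro!: restrict_ext)
  qed
  have "bij_betw (\<lambda>x. x) (carrier ?P) (carrier ?Q)" using car by (simp add: bij_betw_def)
  then show ?thesis
    using L.dim_of_bij dim by (simp add: pfin_def pdim_def adim_def)
qed

end

section \<open>Multiplicity spaces\<close>

context vertex_graded_algebra
begin

text \<open>
  The multiplicity space at \<^term>\<open>i\<close> has one basis vector for each generator of a minimal
  resolution at this vertex; it is realised as a sum of copies of the ground field.
\<close>

lemma multiplicity_exists:
  assumes "FP_infinity A (vertex_simple A e j)"
  shows "\<exists>W. is_multiplicity K A e j W"
proof -
  obtain g D \<epsilon> where fin: "\<forall>p. finite (fst (g p))"
    and res: "minimal_fg_resolution A (vertex_simple A e j) (\<lambda>p. Q (g p)) D \<epsilon>"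
    using minimal_resolution_exists[OF assms] by (elim exE conjE)
  define c d where "c p = fst (snd (g p))" and "d p = snd (snd (g p))" for p
  define B where "B p i = {s \<in> fst (g p). c p s = i}" for p i
  define W where "W p i = FS (ground K) (B p i) (\<lambda>_. \<one>\<^bsub>K\<^esub>) (d p)" for p i
  have W: "graded_space K (W p i)" "vectorspace.fin_dim K (W p i)" for p i
    unfolding W_def using fin by (auto simp: B_def intro: FS_ground_space[OF field])
  have "gmodule_isomorphic A (Q (g p))
      (direct_sum UNIV (\<lambda>i. tensor K A (vertex_projective A e i) (W p i)))" for p
  proof -
    have "framed K A e (W p) (fst (g p)) (c p) (d p)
      (\<lambda>s. (\<lambda>x. x) (unit_vec (ground K) (B p (c p s)) s \<one>\<^bsub>K\<^esub>))
      (\<lambda>s w. inv_into (carrier (FS (ground K) (B p (c p s)) (\<lambda>_. \<one>\<^bsub>K\<^esub>) (d p))) (\<lambda>x. x) w s)"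
    proof (rule framed_by_bases[where h = "\<lambda>i x. x" and k = "\<lambda>s. s" and dd = "\<lambda>i. d p" and W = "W p"])
      show "finite (fst (g p))" using fin by blast
      show "graded_space K (W p i)" for i by (rule W)
      show "bij_betw (\<lambda>s. s) {s \<in> fst (g p). c p s = i} (B p i)" for i
        by (simp add: bij_betw_def B_def)
      show "(\<lambda>x. x) \<in> gmodule_hom (ground K) (FS (ground K) (B p i) (\<lambda>_. \<one>\<^bsub>K\<^esub>) (d p)) (W p i)" for i
        unfolding W_def by (rule gmodule_homI) simp_all
      show "bij_betw (\<lambda>x. x) (carrier (FS (ground K) (B p i) (\<lambda>_. \<one>\<^bsub>K\<^esub>) (d p))) (carrier (W p i))" for i
        by (simp add: bij_betw_def W_def)
    qed simp
    from framed.tensor_sum_isomorphism[OF this] show ?thesis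
      unfolding gmodule_isomorphic_def Q_def c_def d_def by (elim bexE conjE) (rule bexI)
  qed
  then have "is_multiplicity K A e j W"
    unfolding is_multiplicity_def using res W by blast
  then show ?thesis by blast
qed

lemma inverse_hom_graded:
  assumes F: "gmod K A F" and \<theta>: "\<theta> \<in> gmodule_hom A F D" and bij: "bij_betw \<theta> (carrier F) (carrier D)"
    and surj: "\<And>n. grade D n \<subseteq> \<theta> ` grade F n"
  shows "inv_into (carrier F) \<theta> \<in> gmodule_hom A D F"
proof -
  interpret F: gmod K A F by fact
  let ?\<eta> = "inv_into (carrier F) \<theta>"
  have \<eta>: "?\<eta> (\<theta> x) = x" if "x \<in> carrier F" for x
    using bij_betw_inv_into_left[OF bij that] .
  have D: "\<exists>x\<in>carrier F. y = \<theta> x" if "y \<in> carrier D" for y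
    using bij that by (auto simp: bij_betw_def)
  show ?thesis
  proof (rule gmodule_homI)
    fix y assume "y \<in> carrier D"
    then obtain x where "x \<in> carrier F" "y = \<theta> x" using D by blast
    then show "?\<eta> y \<in> carrier F" using \<eta> by simp
  next
    fix y y' assume "y \<in> carrier D" "y' \<in> carrier D"
    then obtain x x' where "x \<in> carrier F" "x' \<in> carrier F" "y = \<theta> x" "y' = \<theta> x'" using D by meson
    then show "?\<eta> (y \<oplus>\<^bsub>D\<^esub> y') = ?\<eta> y \<oplus>\<^bsub>F\<^esub> ?\<eta> y'"
      using \<eta>[of "x \<oplus>\<^bsub>F\<^esub> x'"] by (simp add: hom_add[OF \<theta>] \<eta>)
  next
    fix a y assume a: "a \<in> carrier A" and "y \<in> carrier D"
    then obtain x where "x \<in> carrier F" "y = \<theta> x" using D by blast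
    then show "?\<eta> (a \<odot>\<^bsub>D\<^esub> y) = a \<odot>\<^bsub>F\<^esub> ?\<eta> y"
      using \<eta>[of "a \<odot>\<^bsub>F\<^esub> x"] a by (simp add: hom_smult[OF \<theta>] \<eta>)
  next
    fix n y assume "y \<in> grade D n"
    then obtain x where "x \<in> grade F n" "y = \<theta> x" using surj by blast
    then show "?\<eta> y \<in> grade F n" using \<eta>[OF F.grade_closed] by simp
  qed
qed

text \<open>
  Counting a homogeneous basis by degrees: this is the dimension formula for sums of principal
  projectives, applied to the ground field.
\<close>

lemma homogeneous_basis_card:
  assumes W: "graded_space K W" and B: "finite B"
    and h: "h \<in> gmodule_hom (ground K) (FS (ground K) B (\<lambda>_. \<one>\<^bsub>K\<^esub>) d) W"
    and bij: "bij_betw h (carrier (FS (ground K) B (\<lambda>_. \<one>\<^bsub>K\<^esub>) d)) (carrier W)"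
  shows "vectorspace.dim K (W\<lparr>carrier := grade W m\<rparr>) = card {s\<in>B. d s = m}"
proof -
  interpret G: vertex_graded_algebra K "ground K" "\<lambda>_::unit. \<one>\<^bsub>K\<^esub>"
    by (rule ground_vertex_algebra[OF field])
  interpret F: principal_family K "ground K" B "\<lambda>_. \<one>\<^bsub>K\<^esub>" d by (rule G.std_family)
  have Wg: "gmod K (ground K) W" using W gmod_ground_iff[OF field] by blast
  interpret W: gmod K "ground K" W by (rule Wg)
  have Wv: "vectorspace K W" using W by (simp add: graded_space_def)
  interpret Wv: vectorspace K W by (rule Wv)
  have ad: "G.adim () n () = (if n = 0 then 1 else 0)" for n
    using G.adim_zero[of "()" "()"] G.adim_trivial[of n "()" "()"] by simp
  note FS = G.pdim_FS[OF B, where c = "\<lambda>_. ()" and d = d and i = "()" and n = m]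
  note iso = G.pdim_iso[OF F.FS_gmod Wg h bij, of "()" m]
  have "G.pdim W () m = (\<Sum>s\<in>B. G.adim () (m - d s) ())" using iso FS by simp
  also have "\<dots> = (\<Sum>s\<in>B. if d s = m then 1 else 0)" by (rule sum.cong) (auto simp: ad)
  also have "\<dots> = card {s\<in>B. d s = m}" using B by (simp add: sum.If_cases Int_def)
  finally have 1: "G.pdim W () m = card {s\<in>B. d s = m}" .
  have Ws: "VectorSpace.subspace K (grade W m) W"
    unfolding VectorSpace.subspace_def LinearCombinations.submodule_def
    using Wv Wv.module.module_axioms W.grade_closed W.grade_add W
    by (auto simp: graded_space_def vectorspace_def)
  have piece: "G.piece W () m = grade W m"
    unfolding G.piece_def using W.smult_one W.grade_closed by auto
  interpret L: linear_map K "kspace (ground K) W (G.piece W () m)" "W\<lparr>carrier := grade W m\<rparr>" "\<lambda>x. x"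
    by (rule linear_mapI[OF G.piece_vectorspace[OF Wg] Wv.subspace_is_vs[OF Ws]])
      (simp_all add: piece)
  have "bij_betw (\<lambda>x. x) (carrier (kspace (ground K) W (G.piece W () m))) (carrier (W\<lparr>carrier := grade W m\<rparr>))"
    by (simp add: piece bij_betw_def)
  then show ?thesis
    using L.dim_of_bij(2) iso(1) FS 1 by (simp add: G.pdim_def G.pfin_def)
qed

text \<open>
  Homogeneous bases of arbitrary multiplicity spaces turn the given decomposition into a sum of
  shifted principal projectives, in which the number of generators with a given vertex and degree is
  the dimension of the corresponding component.
\<close>

lemma standard_form:
  fixes P :: "('a, 'm) gmodule" and W :: "'r \<Rightarrow> ('k, 'w) gmodule"
  assumes P: "gmod K A P" and W: "\<And>i. graded_space K (W i)" "\<And>i. vectorspace.fin_dim K (W i)"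
    and iso: "gmodule_isomorphic A P (direct_sum UNIV (\<lambda>i. tensor K A (vertex_projective A e i) (W i)))"
  shows "\<exists>(I :: ('r \<times> nat) set) d. finite I \<and>
    (\<forall>k m. vectorspace.dim K (W k\<lparr>carrier := grade (W k) m\<rparr>) = card {s\<in>I. fst s = k \<and> d s = m}) \<and>
    (\<exists>u\<in>gmodule_hom A P (FS A I (\<lambda>s. e (fst s)) d).
       bij_betw u (carrier P) (carrier (FS A I (\<lambda>s. e (fst s)) d)))"
proof -
  let ?D = "direct_sum UNIV (\<lambda>i. tensor K A (vertex_projective A e i) (W i))"
  have "\<forall>i. \<exists>x :: nat set \<times> (nat \<Rightarrow> int) \<times> ((nat \<Rightarrow> 'k) \<Rightarrow> 'w). finite (fst x) \<and>
      snd (snd x) \<in> gmodule_hom (ground K) (FS (ground K) (fst x) (\<lambda>_. \<one>\<^bsub>K\<^esub>) (fst (snd x))) (W i) \<and>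
      bij_betw (snd (snd x)) (carrier (FS (ground K) (fst x) (\<lambda>_. \<one>\<^bsub>K\<^esub>) (fst (snd x)))) (carrier (W i))"
  proof
    fix i
    obtain B :: "nat set" and d h where "finite B"
      "h \<in> gmodule_hom (ground K) (FS (ground K) B (\<lambda>_. \<one>\<^bsub>K\<^esub>) d) (W i)"
      "bij_betw h (carrier (FS (ground K) B (\<lambda>_. \<one>\<^bsub>K\<^esub>) d)) (carrier (W i))"
      using homogeneous_basis[OF field W] by blast
    then show "\<exists>x :: nat set \<times> (nat \<Rightarrow> int) \<times> ((nat \<Rightarrow> 'k) \<Rightarrow> 'w). finite (fst x) \<and>
      snd (snd x) \<in> gmodule_hom (ground K) (FS (ground K) (fst x) (\<lambda>_. \<one>\<^bsub>K\<^esub>) (fst (snd x))) (W i) \<and>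
      bij_betw (snd (snd x)) (carrier (FS (ground K) (fst x) (\<lambda>_. \<one>\<^bsub>K\<^esub>) (fst (snd x)))) (carrier (W i))"
      by (intro exI[of _ "(B, d, h)"]) simp
  qed
  from choice[OF this] obtain x :: "'r \<Rightarrow> nat set \<times> (nat \<Rightarrow> int) \<times> ((nat \<Rightarrow> 'k) \<Rightarrow> 'w)"
    where x: "\<forall>i. finite (fst (x i)) \<and>
      snd (snd (x i)) \<in> gmodule_hom (ground K) (FS (ground K) (fst (x i)) (\<lambda>_. \<one>\<^bsub>K\<^esub>) (fst (snd (x i)))) (W i) \<and>
      bij_betw (snd (snd (x i))) (carrier (FS (ground K) (fst (x i)) (\<lambda>_. \<one>\<^bsub>K\<^esub>) (fst (snd (x i))))) (carrier (W i))"
    by (elim exE)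
  define B dd h where "B i = fst (x i)" and "dd i = fst (snd (x i))" and "h i = snd (snd (x i))" for i
  have fB: "finite (B i)"
    and h: "h i \<in> gmodule_hom (ground K) (FS (ground K) (B i) (\<lambda>_. \<one>\<^bsub>K\<^esub>) (dd i)) (W i)"
    and hb: "bij_betw (h i) (carrier (FS (ground K) (B i) (\<lambda>_. \<one>\<^bsub>K\<^esub>) (dd i))) (carrier (W i))" for i
    using x by (simp_all add: B_def dd_def h_def)
  define I where "I = (SIGMA i:UNIV. B i)"
  define d where "d s = dd (fst s) (snd s)" for s
  have fI: "finite I" unfolding I_def using fB by simp
  have Ik: "{s\<in>I. fst s = k} = Pair k ` B k" for k by (auto simp: I_def)
  have kb: "bij_betw snd {s\<in>I. fst s = k} (B k)" for k
    unfolding Ik by (auto simp: bij_betw_def inj_on_def image_image)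
  have "framed K A e W I fst d
      (\<lambda>s. h (fst s) (unit_vec (ground K) (B (fst s)) (snd s) \<one>\<^bsub>K\<^esub>))
      (\<lambda>s w. inv_into (carrier (FS (ground K) (B (fst s)) (\<lambda>_. \<one>\<^bsub>K\<^esub>) (dd (fst s)))) (h (fst s)) w (snd s))"
    by (rule framed_by_bases[OF fI W(1) kb _ h hb]) (simp add: d_def)
  from framed.tensor_sum_isomorphism[OF this]
  obtain \<theta> where \<theta>: "\<theta> \<in> gmodule_hom A (FS A I (\<lambda>s. e (fst s)) d) ?D"
    "bij_betw \<theta> (carrier (FS A I (\<lambda>s. e (fst s)) d)) (carrier ?D)"
    "\<forall>n. grade ?D n \<subseteq> \<theta> ` grade (FS A I (\<lambda>s. e (fst s)) d) n"
    by (elim bexE conjE)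
  obtain f where f: "f \<in> gmodule_hom A P ?D" "bij_betw f (carrier P) (carrier ?D)"
    using iso unfolding gmodule_isomorphic_def by (elim bexE)
  interpret F: principal_family K A I "\<lambda>s. e (fst s)" d by (rule std_family)
  let ?\<eta> = "inv_into (carrier F.F) \<theta>"
  have \<eta>: "?\<eta> \<in> gmodule_hom A ?D F.F"
    by (rule inverse_hom_graded[OF F.FS_gmod \<theta>(1,2)]) (use \<theta>(3) in blast)
  have "bij_betw ?\<eta> (carrier ?D) (carrier F.F)" by (rule bij_betw_inv_into[OF \<theta>(2)])
  then have bij: "bij_betw (\<lambda>x. ?\<eta> (f x)) (carrier P) (carrier F.F)"
    using bij_betw_trans[OF f(2)] by (simp add: comp_def)
  have "vectorspace.dim K (W k\<lparr>carrier := grade (W k) m\<rparr>) = card {s\<in>I. fst s = k \<and> d s = m}" for k m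
  proof -
    have "{s\<in>I. fst s = k \<and> d s = m} = Pair k ` {t\<in>B k. dd k t = m}" by (auto simp: I_def d_def)
    then have "card {s\<in>I. fst s = k \<and> d s = m} = card {t\<in>B k. dd k t = m}"
      by (simp add: card_image inj_on_def)
    then show ?thesis using homogeneous_basis_card[OF W(1) fB h hb] by simp
  qed
  then show ?thesis using fI hom_comp[OF f(1) \<eta>] bij by blast
qed

section \<open>Counting dimensions along a minimal resolution\<close>

lemma vertex_simple_grade_neg:
  assumes "n < 0"
  shows "grade (vertex_simple A e j) n = {\<zero>\<^bsub>vertex_simple A e j\<^esub>}"
proof -
  let ?S = "vertex_simple A e j" and ?g = "({0}, (\<lambda>_. j), (\<lambda>_. 0)) :: nat set \<times> (nat \<Rightarrow> 'r) \<times> (nat \<Rightarrow> int)"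
  interpret S: gmod K A ?S by (rule vertex_simple_gmod)
  interpret F: principal_family K A "{0::nat}" "\<lambda>s. e ((\<lambda>_. j) s)" "\<lambda>_. 0" by (rule std_family)
  have QF: "Q ?g = F.F" by (simp add: Q_def)
  obtain \<epsilon> where \<epsilon>: "\<epsilon> \<in> gmodule_hom A (Q ?g) ?S" "\<epsilon> ` carrier (Q ?g) = carrier ?S"
    using vertex_simple_cover[of j] by blast
  have "y = \<zero>\<^bsub>?S\<^esub>" if y: "y \<in> grade ?S n" for y
  proof -
    obtain x where x: "x \<in> carrier F.F" "y = \<epsilon> x"
      using \<epsilon>(2) S.grade_closed[OF y] unfolding QF by blast
    have "hcomp F.F n x = \<zero>\<^bsub>F.F\<^esub>"
      using x(1) assms by (auto simp: F.FS_hcomp F.FS_zero intro!: restrict_ext hcomp_neg F.FS_closed)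
    then have "hcomp ?S n y = \<zero>\<^bsub>?S\<^esub>"
      using hom_hcomp[OF F.FS_gmod vertex_simple_gmod \<epsilon>(1)[unfolded QF] x(1), of n] x(2)
        hom_zero[OF F.FS_gmod vertex_simple_gmod \<epsilon>(1)[unfolded QF]] by simp
    then show ?thesis using S.hcomp_homogeneous[OF y, of n] by simp
  qed
  then show ?thesis using S.grade_zero by blast
qed

lemma zero_kspace_dim:
  assumes M: "gmod K A M"
  shows "vectorspace.dim K (kspace A M {\<zero>\<^bsub>M\<^esub>}) = 0"
proof -
  interpret M: gmod K A M by fact
  let ?V = "kspace A M (piece M undefined 0)"
  interpret V: vectorspace K ?V by (rule piece_vectorspace[OF M])
  have "VectorSpace.subspace K {\<zero>\<^bsub>M\<^esub>} ?V"
    unfolding VectorSpace.subspace_def LinearCombinations.submodule_def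
    using V.vectorspace_axioms V.module.module_axioms by (simp add: piece_def)
  then have "vectorspace K (kspace A M {\<zero>\<^bsub>M\<^esub>})" using V.subspace_is_vs by fastforce
  then show ?thesis by (rule zero_space_dim(2)[OF field]) simp
qed

end

text \<open>
  A minimal resolution of a vertex simple, together with isomorphisms \<^term>\<open>u p\<close> of its terms to
  sums of principal projectives that are generated in the degrees \<^term>\<open>d p s\<close>.
\<close>

locale minimal_standard_resolution = vertex_graded_algebra K A e
  for K :: "('k, 'z) ring_scheme" and A :: "('k, 'a) gmodule" and e :: "'r::finite \<Rightarrow> 'a" +
  fixes j :: 'r and P :: "nat \<Rightarrow> ('a, 'm) gmodule" and D :: "nat \<Rightarrow> 'm \<Rightarrow> 'm"
    and \<epsilon> :: "'m \<Rightarrow> 'a set"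
    and I :: "nat \<Rightarrow> 's set" and c :: "nat \<Rightarrow> 's \<Rightarrow> 'r" and d :: "nat \<Rightarrow> 's \<Rightarrow> int"
    and u :: "nat \<Rightarrow> 'm \<Rightarrow> 's \<Rightarrow> 'a"
  assumes minimal: "minimal_fg_resolution A (vertex_simple A e j) P D \<epsilon>"
    and finite_index: "finite (I p)"
    and u_hom: "u p \<in> gmodule_hom A (P p) (FS A (I p) (\<lambda>s. e (c p s)) (d p))"
    and u_bij: "bij_betw (u p) (carrier (P p)) (carrier (FS A (I p) (\<lambda>s. e (c p s)) (d p)))"
begin

abbreviation S where "S \<equiv> vertex_simple A e j"
abbreviation F where "F p \<equiv> FS A (I p) (\<lambda>s. e (c p s)) (d p)"

lemma P_gmod: "gmod K A (P p)"
  and D_hom: "D p \<in> gmodule_hom A (P (Suc p)) (P p)"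
  and \<epsilon>_hom: "\<epsilon> \<in> gmodule_hom A (P 0) S"
  and \<epsilon>_surj: "\<epsilon> ` carrier (P 0) = carrier S"
  and exact_0: "D 0 ` carrier (P (Suc 0)) = {x \<in> carrier (P 0). \<epsilon> x = \<zero>\<^bsub>S\<^esub>}"
  and exact_Suc: "D (Suc p) ` carrier (P (Suc (Suc p))) = {x \<in> carrier (P (Suc p)). D p x = \<zero>\<^bsub>P p\<^esub>}"
  and D_positive: "D p ` carrier (P (Suc p)) \<subseteq> positive_part_mult A (P p)"
  using minimal unfolding minimal_fg_resolution_def fg_projective_resolution_def gmod_iff by simp_all

lemma F_family: "principal_family K A (I p) (\<lambda>s. e (c p s))"
  by (rule std_family)

lemma F_gmod: "gmod K A (F p)"
  by (rule principal_family.FS_gmod[OF F_family])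

lemma u_zero:
  assumes x: "x \<in> carrier (P p)" and ux: "u p x = \<zero>\<^bsub>F p\<^esub>"
  shows "x = \<zero>\<^bsub>P p\<^esub>"
proof -
  interpret P: gmod K A "P p" by (rule P_gmod)
  have "u p x = u p \<zero>\<^bsub>P p\<^esub>" using ux hom_zero[OF P_gmod F_gmod u_hom] by simp
  then show ?thesis using u_bij[of p] x P.zero_closed by (auto simp: bij_betw_def dest: inj_onD)
qed

lemma P_dimensions:
  shows P_fin: "pfin (P p) i n"
    and P_dim: "pdim (P p) i n = (\<Sum>s\<in>I p. adim i (n - d p s) (c p s))"
proof -
  note inv = hom_inverse[OF P_gmod F_gmod u_hom u_bij]
  note FS = pdim_FS[OF finite_index, where c = "c p" and d = "d p" and i = i and n = n]
  note iso = pdim_iso[OF F_gmod P_gmod inv bij_betw_inv_into[OF u_bij], of p i n]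
  show "pfin (P p) i n" "pdim (P p) i n = (\<Sum>s\<in>I p. adim i (n - d p s) (c p s))"
    using iso FS by simp_all
qed

lemma generator:
  assumes s: "s \<in> I p"
  obtains b where "b \<in> grade (P p) (d p s)" "b \<notin> positive_part_mult A (P p)"
proof -
  interpret F: principal_family K A "I p" "\<lambda>s. e (c p s)" "d p" by (rule F_family)
  interpret P: gmod K A "P p" by (rule P_gmod)
  let ?\<iota> = "unit_vec A (I p) s (e (c p s))"
  let ?b = "inv_into (carrier (P p)) (u p) ?\<iota>"
  have "?b \<in> grade (P p) (d p s)"
    by (rule hom_grade[OF hom_inverse[OF P_gmod F_gmod u_hom u_bij] F.unit_vec_grade[OF s]])
  moreover have "?b \<notin> positive_part_mult A (P p)"
  proof
    assume "?b \<in> positive_part_mult A (P p)"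
    from hom_positive_part_mult[OF P_gmod F_gmod u_hom this]
    have "?\<iota> \<in> positive_part_mult A (F p)"
      using bij_betw_inv_into_right[OF u_bij F.unit_vec_unit_closed[OF s]] by simp
    then have "hcomp A 0 (?\<iota> s) = \<zero>\<^bsub>A\<^esub>" using F.positive_part_mult_FS s by blast
    then show False
      using A.hcomp_homogeneous[OF vertex_in_grade_0, of 0 "c p s"] vertex_nonzero s
      by (simp add: unit_vec_def)
  qed
  ultimately show thesis by (rule that)
qed

lemma positive_part_vanishes:
  assumes deg: "\<And>s. s \<in> I p \<Longrightarrow> int p \<le> d p s"
    and x: "x \<in> positive_part_mult A (P p)" "x \<in> grade (P p) m" and m: "m < int (Suc p)"
  shows "x = \<zero>\<^bsub>P p\<^esub>"
proof (rule u_zero)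
  interpret F: principal_family K A "I p" "\<lambda>s. e (c p s)" "d p" by (rule F_family)
  interpret FM: gmod K A "F p" by (rule F_gmod)
  interpret P: gmod K A "P p" by (rule P_gmod)
  show xc: "x \<in> carrier (P p)" using P.grade_closed[OF x(2)] .
  have ux: "u p x \<in> carrier (F p)" using hom_closed[OF u_hom xc] .
  show "u p x = \<zero>\<^bsub>F p\<^esub>"
  proof (rule F.FS_eqI[OF ux FM.zero_closed])
    fix s assume s: "s \<in> I p"
    have g: "u p x s \<in> grade A (m - d p s)"
      using hom_grade[OF u_hom x(2)] s by (simp add: F.FS_grade)
    have h: "hcomp A 0 (u p x s) = \<zero>\<^bsub>A\<^esub>"
      using hom_positive_part_mult[OF P_gmod F_gmod u_hom x(1)] F.positive_part_mult_FS s by blast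
    have "u p x s = \<zero>\<^bsub>A\<^esub>"
    proof (cases "m = d p s")
      case True
      then show ?thesis using A.hcomp_homogeneous[OF g, of 0] h by simp
    next
      case False
      then have "m - d p s < 0" using deg[OF s] m by simp
      then show ?thesis using g grade_neg by blast
    qed
    then show "u p x s = \<zero>\<^bsub>F p\<^esub> s" using s by (simp add: F.FS_zero)
  qed
qed

text \<open>
  A generator of too small a degree would be a cycle, hence a boundary, and so lie in the positive
  part by minimality.
\<close>

lemma degree_bound: "s \<in> I p \<Longrightarrow> int p \<le> d p s"
proof (induction p arbitrary: s)
  case 0
  show ?case
  proof (rule ccontr)
    assume "\<not> int 0 \<le> d 0 s"
    then have neg: "d 0 s < 0" by simp
    obtain b where b: "b \<in> grade (P 0) (d 0 s)" "b \<notin> positive_part_mult A (P 0)"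
      using generator[OF 0] .
    interpret P: gmod K A "P 0" by (rule P_gmod)
    have "\<epsilon> b \<in> {\<zero>\<^bsub>S\<^esub>}"
      using hom_grade[OF \<epsilon>_hom b(1)] unfolding vertex_simple_grade_neg[OF neg] .
    then have "b \<in> D 0 ` carrier (P (Suc 0))" unfolding exact_0 using P.grade_closed[OF b(1)] by simp
    then show False using D_positive[of 0] b(2) by blast
  qed
next
  case (Suc p)
  show ?case
  proof (rule ccontr)
    assume "\<not> int (Suc p) \<le> d (Suc p) s"
    then have small: "d (Suc p) s < int (Suc p)" by simp
    obtain b where b: "b \<in> grade (P (Suc p)) (d (Suc p) s)" "b \<notin> positive_part_mult A (P (Suc p))"
      using generator[OF Suc.prems] .
    interpret P: gmod K A "P (Suc p)" by (rule P_gmod)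
    have bc: "b \<in> carrier (P (Suc p))" using P.grade_closed[OF b(1)] .
    have "D p b = \<zero>\<^bsub>P p\<^esub>"
      using Suc.IH D_positive[of p] bc hom_grade[OF D_hom b(1)] small
      by (intro positive_part_vanishes[of p "D p b" "d (Suc p) s"]) auto
    then have "b \<in> D (Suc p) ` carrier (P (Suc (Suc p)))" unfolding exact_Suc using bc by simp
    then show False using D_positive[of "Suc p"] b(2) by blast
  qed
qed

definition cycles :: "nat \<Rightarrow> 'm set" where
  "cycles p = (case p of 0 \<Rightarrow> {x \<in> carrier (P 0). \<epsilon> x = \<zero>\<^bsub>S\<^esub>}
     | Suc q \<Rightarrow> {x \<in> carrier (P (Suc q)). D q x = \<zero>\<^bsub>P q\<^esub>})"

definition cdim :: "nat \<Rightarrow> 'r \<Rightarrow> int \<Rightarrow> nat" where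
  "cdim p i n = vectorspace.dim K (kspace A (P p) (cycles p \<inter> piece (P p) i n))"

lemma boundaries: "D p ` carrier (P (Suc p)) = cycles p"
  by (cases p) (simp_all add: cycles_def exact_0 exact_Suc)

lemma dim_Suc: "pdim (P (Suc p)) i n = cdim p i n + cdim (Suc p) i n"
proof -
  have "D p ` piece (P (Suc p)) i n = cycles p \<inter> piece (P p) i n"
    by (simp only: piece_image[OF P_gmod P_gmod D_hom] boundaries)
  moreover have "{x \<in> piece (P (Suc p)) i n. D p x = \<zero>\<^bsub>P p\<^esub>} = cycles (Suc p) \<inter> piece (P (Suc p)) i n"
    using piece_closed[OF P_gmod] by (auto simp: cycles_def)
  ultimately show ?thesis
    using piece_rank_nullity[OF P_gmod P_gmod D_hom P_fin, of p i n] by (simp add: cdim_def)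
qed

text \<open>
  The image of the augmentation is the piece of the vertex simple itself. Its dimension is found
  from the cover by \<open>A e\<^sub>j\<close>, whose kernel is everything in positive degrees and zero in degree zero.
\<close>

lemma dim_0: "pdim (P 0) i (int N) = (if i = j \<and> N = 0 then 1 else 0) + cdim 0 i (int N)"
proof -
  let ?g = "({0}, (\<lambda>_. j), (\<lambda>_. 0)) :: nat set \<times> (nat \<Rightarrow> 'r) \<times> (nat \<Rightarrow> int)"
  interpret Q: principal_family K A "{0::nat}" "\<lambda>s. e ((\<lambda>_. j) s)" "\<lambda>_. 0" by (rule std_family)
  interpret QM: gmod K A Q.F by (rule Q.FS_gmod)
  have QF: "Q ?g = Q.F" by (simp add: Q_def)
  obtain \<eta> where "\<eta> \<in> gmodule_hom A (Q ?g) S" "\<eta> ` carrier (Q ?g) = carrier S"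
    "\<forall>x\<in>carrier (Q ?g). \<eta> x = \<zero>\<^bsub>S\<^esub> \<longleftrightarrow> hcomp A 0 (x 0) = \<zero>\<^bsub>A\<^esub>"
    using vertex_simple_cover[of j] by blast
  note \<eta> = this[unfolded QF]
  let ?\<sigma> = "vectorspace.dim K (kspace A S (carrier S \<inter> piece S i (int N)))"
  have fd: "pfin Q.F i (int N)" and Qd: "pdim Q.F i (int N) = adim i (int N) j"
    using pdim_FS[where I = "{0::nat}" and c = "\<lambda>_. j" and d = "\<lambda>_. 0" and i = i and n = "int N"]
    by simp_all
  let ?Z = "{x \<in> piece Q.F i (int N). \<eta> x = \<zero>\<^bsub>S\<^esub>}"
  have rn: "?\<sigma> + vectorspace.dim K (kspace A Q.F ?Z) = pdim Q.F i (int N)"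
    using piece_rank_nullity[OF Q.FS_gmod vertex_simple_gmod \<eta>(1) fd]
    by (simp only: piece_image[OF Q.FS_gmod vertex_simple_gmod \<eta>(1)] \<eta>(2))
  have x0: "x \<in> carrier Q.F" "x 0 \<in> grade A (int N)" if "x \<in> piece Q.F i (int N)" for x
    using that by (simp_all add: piece_def Q.FS_grade)
  have "?\<sigma> = (if i = j \<and> N = 0 then 1 else 0)"
  proof (cases "N = 0")
    case True
    have "?Z \<subseteq> {\<zero>\<^bsub>Q.F\<^esub>}"
    proof
      fix x assume "x \<in> ?Z"
      then have x: "x \<in> piece Q.F i (int N)" "\<eta> x = \<zero>\<^bsub>S\<^esub>" by simp_all
      have "hcomp A 0 (x 0) = \<zero>\<^bsub>A\<^esub>" using \<eta>(3) x0[OF x(1)] x(2) by blast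
      then have "x 0 = \<zero>\<^bsub>A\<^esub>" using A.hcomp_homogeneous[OF x0(2)[OF x(1)], of 0] True by simp
      then have "x = \<zero>\<^bsub>Q.F\<^esub>"
        by (intro Q.FS_eqI[OF x0(1)[OF x(1)] QM.zero_closed]) (simp add: Q.FS_zero)
      then show "x \<in> {\<zero>\<^bsub>Q.F\<^esub>}" by simp
    qed
    moreover have "\<zero>\<^bsub>Q.F\<^esub> \<in> ?Z"
      using hom_zero[OF Q.FS_gmod vertex_simple_gmod \<eta>(1)] by (simp add: piece_def)
    ultimately have "?Z = {\<zero>\<^bsub>Q.F\<^esub>}" by blast
    then have "?\<sigma> = adim i 0 j" using rn Qd zero_kspace_dim[OF Q.FS_gmod] True by simp
    then show ?thesis using True by (simp add: adim_zero)
  next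
    case False
    have "\<eta> x = \<zero>\<^bsub>S\<^esub>" if x: "x \<in> piece Q.F i (int N)" for x
      using \<eta>(3) x0[OF x] A.hcomp_homogeneous[OF x0(2)[OF x], of 0] False by simp
    then have "?Z = piece Q.F i (int N)" by blast
    then show ?thesis using rn False by (simp add: pdim_def)
  qed
  moreover have "{x \<in> piece (P 0) i (int N). \<epsilon> x = \<zero>\<^bsub>S\<^esub>} = cycles 0 \<inter> piece (P 0) i (int N)"
    using piece_closed[OF P_gmod] by (auto simp: cycles_def)
  ultimately show ?thesis
    using piece_rank_nullity[OF P_gmod vertex_simple_gmod \<epsilon>_hom P_fin, of i "int N"]
    by (simp add: cdim_def piece_image[OF P_gmod vertex_simple_gmod \<epsilon>_hom] \<epsilon>_surj)
qed

lemma dim_vanishes: "N < p \<Longrightarrow> pdim (P p) i (int N) = 0"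
  using degree_bound[of _ p] by (force simp: P_dim intro!: sum.neutral adim_trivial grade_neg)

text \<open>
  By exactness the alternating sum telescopes to the dimension of the piece of the vertex simple, up
  to the dimension of the last space of cycles. The latter is zero because the next term of the
  resolution vanishes in degree \<^term>\<open>N\<close>.
\<close>

theorem euler_characteristic:
  "(\<Sum>p\<le>N. (-1) ^ p * int (pdim (P p) i (int N))) = (if i = j \<and> N = 0 then 1 else 0)"
proof -
  have "(\<Sum>p\<le>M. (-1) ^ p * int (pdim (P p) i (int N))) =
      (if i = j \<and> N = 0 then 1 else 0) + (-1) ^ M * int (cdim M i (int N))" for M
  proof (induction M)
    case 0
    show ?case by (simp add: dim_0)
  next
    case (Suc M)
    then show ?case by (simp add: dim_Suc algebra_simps)
  qed
  moreover have "cdim N i (int N) = 0" using dim_vanishes[of N "Suc N" i] dim_Suc[of N i "int N"] by simp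
  ultimately show ?thesis by simp
qed

end

section \<open>The matrix identity\<close>

text \<open>
  Each coefficient of the partial sums is eventually constant.
\<close>

lemma fps_sums_coefficientwise:
  fixes f :: "nat \<Rightarrow> int fps"
  assumes "\<And>n p. n < p \<Longrightarrow> fps_nth (f p) n = 0"
  shows "f sums Abs_fps (\<lambda>n. \<Sum>p\<le>n. fps_nth (f p) n)"
  unfolding sums_def
proof (rule tendsto_fpsI)
  fix n
  have "fps_nth (\<Sum>p<m. f p) n = fps_nth (Abs_fps (\<lambda>n. \<Sum>p\<le>n. fps_nth (f p) n)) n" if "m > n" for m
  proof -
    have "fps_nth (\<Sum>p<m. f p) n = (\<Sum>p<m. fps_nth (f p) n)" by (rule fps_sum_nth)
    also have "\<dots> = (\<Sum>p\<le>n. fps_nth (f p) n)"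
      by (rule sum.mono_neutral_right) (use that assms in auto)
    finally show ?thesis by simp
  qed
  then show "eventually (\<lambda>m. fps_nth (\<Sum>p<m. f p) n = fps_nth (Abs_fps (\<lambda>n. \<Sum>p\<le>n. fps_nth (f p) n)) n) sequentially"
    by (intro eventually_sequentiallyI[of "Suc n"]) simp
qed

lemma sum_by_degree:
  fixes f :: "int \<Rightarrow> int" and d :: "'s \<Rightarrow> int"
  assumes fin: "finite J" and neg: "\<And>n. n < 0 \<Longrightarrow> f n = 0" and d: "\<And>s. s \<in> J \<Longrightarrow> 0 \<le> d s"
  shows "(\<Sum>s\<in>J. f (int N - d s)) = (\<Sum>l\<le>N. f (int l) * int (card {s\<in>J. d s = int (N - l)}))"
proof -
  have "f (int N - d s) = (\<Sum>l\<le>N. if d s = int (N - l) then f (int l) else 0)" if s: "s \<in> J" for s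
  proof (cases "d s \<le> int N")
    case True
    define l where "l = N - nat (d s)"
    have l: "l \<le> N" "int l = int N - d s" using True d[OF s] by (auto simp: l_def)
    have "(d s = int (N - l')) = (l' = l)" if "l' \<le> N" for l' using that l by auto
    then have "(\<Sum>l'\<le>N. if d s = int (N - l') then f (int l') else 0) = (\<Sum>l'\<le>N. if l' = l then f (int l') else 0)"
      by (intro sum.cong) auto
    then show ?thesis using l by simp
  next
    case False
    then have "(\<Sum>l\<le>N. if d s = int (N - l) then f (int l) else 0) = 0" by (intro sum.neutral) auto
    then show ?thesis using False neg by simp
  qed
  then have "(\<Sum>s\<in>J. f (int N - d s)) = (\<Sum>s\<in>J. \<Sum>l\<le>N. if d s = int (N - l) then f (int l) else 0)"
    by (rule sum.cong[OF HOL.refl])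
  also have "\<dots> = (\<Sum>l\<le>N. \<Sum>s\<in>J. if d s = int (N - l) then f (int l) else 0)" by (rule sum.swap)
  also have "\<dots> = (\<Sum>l\<le>N. f (int l) * int (card {s\<in>J. d s = int (N - l)}))"
    using fin by (intro sum.cong) (simp_all add: sum.If_cases Int_def)
  finally show ?thesis .
qed

lemma sum_over_vertices:
  fixes c :: "'s \<Rightarrow> 'r::finite"
  assumes "finite I"
  shows "(\<Sum>s\<in>I. g s) = (\<Sum>k\<in>UNIV. \<Sum>s\<in>{s\<in>I. c s = k}. g s)"
  using sum.group[OF assms finite_class.finite_UNIV, of c g] by simp

theorem theorem2p3:
  fixes K :: "('k, 'z) ring_scheme" and A :: "('k, 'a) gmodule" and e :: "'r::finite \<Rightarrow> 'a"
  assumes "vertex_graded_algebra K A e"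
    and "\<And>j. FP_infinity A (vertex_simple A e j)"
  shows "matrix_hilbert_series K A e ** completed_euler_matrix K A e = mat 1"
proof -
  interpret vertex_graded_algebra K A e by fact
  have entry: "fps_nth ((matrix_hilbert_series K A e ** completed_euler_matrix K A e) $ i $ j) N =
      (if i = j \<and> N = 0 then 1 else 0)" for i j N
  proof -
    define W where "W = multiplicity K A e j"
    have "is_multiplicity K A e j W"
      unfolding W_def multiplicity_def using multiplicity_exists[OF assms(2)] by (rule someI_ex)
    then obtain P :: "nat \<Rightarrow> ('a, nat \<Rightarrow> 'a) gmodule" and D \<epsilon> where
      res: "minimal_fg_resolution A (vertex_simple A e j) P D \<epsilon>"
      and W: "\<forall>p. (\<forall>i. graded_space K (W p i) \<and> vectorspace.fin_dim K (W p i)) \<and>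
             gmodule_isomorphic A (P p)
               (direct_sum UNIV (\<lambda>i. tensor K A (vertex_projective A e i) (W p i)))"
      unfolding is_multiplicity_def by (elim exE conjE)
    have P: "gmod K A (P p)" for p
      using res unfolding minimal_fg_resolution_def fg_projective_resolution_def gmod_iff by simp
    have "\<forall>p. \<exists>x :: ('r \<times> nat) set \<times> ('r \<times> nat \<Rightarrow> int) \<times> ((nat \<Rightarrow> 'a) \<Rightarrow> 'r \<times> nat \<Rightarrow> 'a). finite (fst x) \<and>
        (\<forall>k m. vectorspace.dim K (W p k\<lparr>carrier := grade (W p k) m\<rparr>) =
           card {s\<in>fst x. fst s = k \<and> fst (snd x) s = m}) \<and>
        snd (snd x) \<in> gmodule_hom A (P p) (FS A (fst x) (\<lambda>s. e (fst s)) (fst (snd x))) \<and>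
        bij_betw (snd (snd x)) (carrier (P p)) (carrier (FS A (fst x) (\<lambda>s. e (fst s)) (fst (snd x))))"
    proof
      fix p
      obtain I :: "('r \<times> nat) set" and d u where "finite I"
        "\<forall>k m. vectorspace.dim K (W p k\<lparr>carrier := grade (W p k) m\<rparr>) = card {s\<in>I. fst s = k \<and> d s = m}"
        "u \<in> gmodule_hom A (P p) (FS A I (\<lambda>s. e (fst s)) d)"
        "bij_betw u (carrier (P p)) (carrier (FS A I (\<lambda>s. e (fst s)) d))"
        using standard_form[OF P, of "W p" p] W by blast
      then show "\<exists>x :: ('r \<times> nat) set \<times> ('r \<times> nat \<Rightarrow> int) \<times> ((nat \<Rightarrow> 'a) \<Rightarrow> 'r \<times> nat \<Rightarrow> 'a). finite (fst x) \<and>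
        (\<forall>k m. vectorspace.dim K (W p k\<lparr>carrier := grade (W p k) m\<rparr>) =
           card {s\<in>fst x. fst s = k \<and> fst (snd x) s = m}) \<and>
        snd (snd x) \<in> gmodule_hom A (P p) (FS A (fst x) (\<lambda>s. e (fst s)) (fst (snd x))) \<and>
        bij_betw (snd (snd x)) (carrier (P p)) (carrier (FS A (fst x) (\<lambda>s. e (fst s)) (fst (snd x))))"
        by (intro exI[of _ "(I, d, u)"]) simp
    qed
    from choice[OF this] obtain x ::
        "nat \<Rightarrow> ('r \<times> nat) set \<times> ('r \<times> nat \<Rightarrow> int) \<times> ((nat \<Rightarrow> 'a) \<Rightarrow> 'r \<times> nat \<Rightarrow> 'a)"
      where x: "\<forall>p. finite (fst (x p)) \<and>
        (\<forall>k m. vectorspace.dim K (W p k\<lparr>carrier := grade (W p k) m\<rparr>) =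
           card {s\<in>fst (x p). fst s = k \<and> fst (snd (x p)) s = m}) \<and>
        snd (snd (x p)) \<in> gmodule_hom A (P p) (FS A (fst (x p)) (\<lambda>s. e (fst s)) (fst (snd (x p)))) \<and>
        bij_betw (snd (snd (x p))) (carrier (P p)) (carrier (FS A (fst (x p)) (\<lambda>s. e (fst s)) (fst (snd (x p)))))"
      by (elim exE)
    define I d u where "I p = fst (x p)" and "d p = fst (snd (x p))" and "u p = snd (snd (x p))" for p
    have fin: "finite (I p)"
      and card: "vectorspace.dim K (W p k\<lparr>carrier := grade (W p k) m\<rparr>) = card {s\<in>I p. fst s = k \<and> d p s = m}"
      and u: "u p \<in> gmodule_hom A (P p) (FS A (I p) (\<lambda>s. e (fst s)) (d p))"
        "bij_betw (u p) (carrier (P p)) (carrier (FS A (I p) (\<lambda>s. e (fst s)) (d p)))" for p k m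
      using x by (simp_all add: I_def d_def u_def)
    interpret R: minimal_standard_resolution K A e j P D \<epsilon> I "\<lambda>_. fst" d u
      by unfold_locales (fact res fin u)+
    define H where "H p k n = int (card {s\<in>I p. fst s = k \<and> d p s = int n})" for p k n
    have hilb: "fps_nth (hilb K (W p k)) n = H p k n" for p k n
      by (simp add: hilb_def card H_def)
    have H0: "H p k n = 0" if "n < p" for p k n
    proof -
      have "{s\<in>I p. fst s = k \<and> d p s = int n} = {}" using R.degree_bound[of _ p] that by force
      then show ?thesis unfolding H_def by (simp only: card.empty of_nat_0)
    qed
    have sgn: "fps_nth ((-1) ^ p * f :: int fps) n = (-1) ^ p * fps_nth f n" for p n f
      by (cases "even p") simp_all
    have euler: "fps_nth (completed_euler_matrix K A e $ k $ j) n = (\<Sum>p\<le>n. (-1) ^ p * H p k n)" for k n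
    proof -
      have "(\<lambda>p. (-1) ^ p * hilb K (W p k)) sums Abs_fps (\<lambda>n. \<Sum>p\<le>n. fps_nth ((-1) ^ p * hilb K (W p k)) n)"
        by (rule fps_sums_coefficientwise) (simp add: sgn hilb H0)
      note eq = sums_unique[OF this, symmetric]
      show ?thesis
        by (simp add: completed_euler_matrix_def W_def[symmetric] eq) (simp add: sgn hilb)
    qed
    have C: "fps_nth (matrix_hilbert_series K A e $ i $ k) n = int (adim i (int n) k)" for k n
      by (simp add: matrix_hilbert_series_def adim_def apiece_def)
    have dim: "int (pdim (P p) i (int N)) = (\<Sum>k\<in>UNIV. \<Sum>l\<le>N. int (adim i (int l) k) * H p k (N - l))" for p
    proof -
      have "int (pdim (P p) i (int N)) = (\<Sum>s\<in>I p. int (adim i (int N - d p s) (fst s)))"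
        by (simp add: R.P_dim)
      also have "\<dots> = (\<Sum>k\<in>UNIV. \<Sum>s\<in>{s\<in>I p. fst s = k}. int (adim i (int N - d p s) (fst s)))"
        by (rule sum_over_vertices[OF fin])
      also have "\<dots> = (\<Sum>k\<in>UNIV. \<Sum>l\<le>N. int (adim i (int l) k) * H p k (N - l))"
      proof (rule sum.cong[OF HOL.refl])
        fix k :: 'r
        have "(\<Sum>s\<in>{s\<in>I p. fst s = k}. int (adim i (int N - d p s) (fst s))) =
            (\<Sum>s\<in>{s\<in>I p. fst s = k}. int (adim i (int N - d p s) k))"
          by (rule sum.cong) auto
        also have "\<dots> = (\<Sum>l\<le>N. int (adim i (int l) k) *
            int (card {s\<in>{s\<in>I p. fst s = k}. d p s = int (N - l)}))"
        proof (rule sum_by_degree)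
          show "finite {s\<in>I p. fst s = k}" using fin by simp
          show "int (adim i n k) = 0" if "n < 0" for n using adim_trivial[OF grade_neg[OF that]] by simp
          show "0 \<le> d p s" if "s \<in> {s\<in>I p. fst s = k}" for s using R.degree_bound[of s p] that by simp
        qed
        finally show "(\<Sum>s\<in>{s\<in>I p. fst s = k}. int (adim i (int N - d p s) (fst s))) =
            (\<Sum>l\<le>N. int (adim i (int l) k) * H p k (N - l))"
          by (simp add: H_def conj_assoc)
      qed
      finally show ?thesis .
    qed
    have ext: "(\<Sum>p\<le>n. (-1) ^ p * H p k n) = (\<Sum>p\<le>N. (-1) ^ p * H p k n)" if "n \<le> N" for k n
      by (rule sum.mono_neutral_left) (use that H0 in auto)
    have "fps_nth ((matrix_hilbert_series K A e ** completed_euler_matrix K A e) $ i $ j) N =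
        (\<Sum>k\<in>UNIV. \<Sum>l\<le>N. int (adim i (int l) k) * (\<Sum>p\<le>N. (-1) ^ p * H p k (N - l)))"
      by (simp add: matrix_matrix_mult_def fps_sum_nth fps_mult_nth C euler ext atLeast0AtMost)
    also have "\<dots> = (\<Sum>k\<in>UNIV. \<Sum>l\<le>N. \<Sum>p\<le>N. (-1) ^ p * (int (adim i (int l) k) * H p k (N - l)))"
      by (simp add: sum_distrib_left mult_ac)
    also have "\<dots> = (\<Sum>k\<in>UNIV. \<Sum>p\<le>N. \<Sum>l\<le>N. (-1) ^ p * (int (adim i (int l) k) * H p k (N - l)))"
      by (intro sum.cong[OF HOL.refl] sum.swap)
    also have "\<dots> = (\<Sum>p\<le>N. \<Sum>k\<in>UNIV. \<Sum>l\<le>N. (-1) ^ p * (int (adim i (int l) k) * H p k (N - l)))"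
      by (rule sum.swap)
    also have "\<dots> = (\<Sum>p\<le>N. (-1) ^ p * int (pdim (P p) i (int N)))"
      by (simp add: dim sum_distrib_left)
    also have "\<dots> = (if i = j \<and> N = 0 then 1 else 0)" by (rule R.euler_characteristic)
    finally show ?thesis .
  qed
  show ?thesis
    by (simp add: vec_eq_iff fps_eq_iff entry mat_def)
qed

end
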